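(* Let $L$ be a finite-dimensional Lie algebra over a field, and let $v$ be the number of $L$-equivalence classes of irreducible $L$-algebras of $cc'$-type in $L$. Then, for any two chief series of $L$, the numbers of complemented chief factors ($c$-factors) occurring in them differ by at most $v$.
   Context: An $L$-algebra is a Lie algebra $A$ (product denoted by juxtaposition) together with a Lie homomorphism $\theta:L\to \mathrm{Der}\,A$; write $x.a=\theta(x)(a)$. It is irreducible if it is irreducible as an $L$-module. For ideals $B\subseteq A$ of $L$, $A/B$ is an $L$-algebra in the natural way. The semi-direct sum $A\rtimes L$ is the set of pairs $(a,x)$ with product $(a_1,x_1)(a_2,x_2)=(x_1.a_2-x_2.a_1+a_1a_2,[x_1,x_2])$. $L$-algebras $A,B$ are $L$-equivalent, $A\sim_L B$, if there is a Lie algebra isomorphism $\Phi:A\rtimes L\to B\rtimes L$ which maps $A$ onto $B$ and induces the identity on the quotient $L$ (i.e. an isomorphism of the extensions $A\hookrightarrow A\rtimes L\twoheadrightarrow L$ and $B\hookrightarrow B\rtimes L\twoheadrightarrow L$). A chief factor of $L$ is $A/B$ with $B\subset A$ ideals of $L$ and $A/B$ a minimal ideal of $L/B$; a chief series is a chain of ideals from $0$ to $L$ all of whose successive quotients are chief factors. A subalgebra $M$ is a supplement of $A/B$ in $L$ if $L=A+M$ and $B\subseteq A\cap M$; it is a complement if moreover $A\cap M=B$. $A/B$ is a $c$-factor if it has a complement in $L$, and a $c'$-factor otherwise; it is an $m$-factor if it has a complement which is a maximal subalgebra of $L$, and an $m'$-factor otherwise. $A/B$ is Frattini if $A/B\subseteq\phi(L/B)$,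 where the Frattini ideal $\phi$ of a Lie algebra is the largest ideal contained in the intersection of all its maximal subalgebras. $A/B\searrow C/D$ (also written $C/D\swarrow A/B$) means $A=B+C$ and $B\cap C=D$. An $m$-crossing $[A/B\searrow C/D]$ is the situation $A/B\searrow C/D$ with $A/B$ Frattini and $C/D$ supplemented by a maximal subalgebra of $L$. Chief factors $A/B$ and $C/D$ of $L$ are $m$-related if one of the following holds: (1) there is a chief factor $R/S$ supplemented by a maximal subalgebra of $L$ with $A/B\swarrow R/S\searrow C/D$; (2) there is an $m$-crossing $[U/V\searrow W/X]$ with $A/B\swarrow V/X$ and $W/X\searrow C/D$; (3) there is a Frattini chief factor $Y/Z$ with $A/B\searrow Y/Z\swarrow C/D$; (4) there is an $m$-crossing $[U/V\searrow W/X]$ with $A/B\searrow U/V$ and $U/W\swarrow C/D$. It is known that any two chief series $(X_i)_{0\le i\le n}$ and $(Y_j)_{0\le j\le m}$ of $L$ have $n=m$ and there is a unique permutation $\pi\in S_n$ such that $X_i/X_{i-1}$ and $Y_{\pi(i)}/Y_{\pi(i)-1}$ are $m$-related for all $i$. A Lie algebra is primitive if it has a maximal subalgebra containing no nonzero ideal; it is primitive of type 2 if in addition it has a unique minimal ideal and that ideal is non-abelian. $Soc(L)$ is the sum of the minimal ideals of $L$. An irreducible $L$-algebra $A$ is of $cc'$-type in $L$ if there exist two chief series $(X_i)_{0\le i\le n}$, $(Y_i)_{0\le i\le n}$ of $L$ and an index $i$ such that, with $\pi\in S_n$ the unique permutation for which $X_k/X_{k-1}$ and $Y_{\pi(k)}/Y_{\pi(k)-1}$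 are $m$-related for all $1\le k\le n$, $A\sim_L X_i/X_{i-1}$, both $X_i/X_{i-1}$ and $Y_{\pi(i)}/Y_{\pi(i)-1}$ are $m'$-factors, both are nonabelian, one of them (call it $A^*/A_*$) is a $c$-factor and the other (call it $B^*/B_*$) is a $c'$-factor, and there exist ideals $I,C,X,N$ of $L$ such that: (i) $I/C\searrow B^*/B_*$ and $I/C$ is a $c'$-factor; (ii) $X\subseteq I$, $N=X\cap C$, $X/N\searrow A^*/A_*$, $I/C\searrow X/N$, and $X/N$ is a $c$-factor; (iii) there is a supplement $F$ of $I/C$ in $L$ such that $L/N$ is isomorphic to the natural semi-direct sum of $I/C$ by $F/C$; (iv) $L/C$ is primitive of type 2 and $Soc(L/C)=I/C$. *)

theory Defs
  imports "HOL-Algebra.Module" "HOL-Algebra.QuotRing" "HOL-Combinatorics.Permutations"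
begin

section \<open>Lie algebras over a field\<close>

text \<open>A Lie algebra is a \<^type>\<open>module\<close> record whose multiplication \<open>\<otimes>\<close> is the Lie bracket
  (juxtaposition in the mathematical text). The \<open>one\<close> field of the record plays no role.\<close>

locale lie_algebra = field K + module K L for K (structure) and L (structure) +
  assumes bracket_closed:
      "\<lbrakk>x \<in> carrier L; y \<in> carrier L\<rbrakk> \<Longrightarrow> x \<otimes>\<^bsub>L\<^esub> y \<in> carrier L"
    and bracket_add_left:
      "\<lbrakk>x \<in> carrier L; y \<in> carrier L; z \<in> carrier L\<rbrakk> \<Longrightarrow>
       (x \<oplus>\<^bsub>L\<^esub> y) \<otimes>\<^bsub>L\<^esub> z = (x \<otimes>\<^bsub>L\<^esub> z) \<oplus>\<^bsub>L\<^esub> (y \<otimes>\<^bsub>L\<^esub> z)"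
    and bracket_add_right:
      "\<lbrakk>x \<in> carrier L; y \<in> carrier L; z \<in> carrier L\<rbrakk> \<Longrightarrow>
       x \<otimes>\<^bsub>L\<^esub> (y \<oplus>\<^bsub>L\<^esub> z) = (x \<otimes>\<^bsub>L\<^esub> y) \<oplus>\<^bsub>L\<^esub> (x \<otimes>\<^bsub>L\<^esub> z)"
    and bracket_smult_left:
      "\<lbrakk>k \<in> carrier K; x \<in> carrier L; y \<in> carrier L\<rbrakk> \<Longrightarrow>
       (k \<odot>\<^bsub>L\<^esub> x) \<otimes>\<^bsub>L\<^esub> y = k \<odot>\<^bsub>L\<^esub> (x \<otimes>\<^bsub>L\<^esub> y)"
    and bracket_smult_right:
      "\<lbrakk>k \<in> carrier K; x \<in> carrier L; y \<in> carrier L\<rbrakk> \<Longrightarrow>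
       x \<otimes>\<^bsub>L\<^esub> (k \<odot>\<^bsub>L\<^esub> y) = k \<odot>\<^bsub>L\<^esub> (x \<otimes>\<^bsub>L\<^esub> y)"
    and bracket_self:
      "x \<in> carrier L \<Longrightarrow> x \<otimes>\<^bsub>L\<^esub> x = \<zero>\<^bsub>L\<^esub>"
    and jacobi:
      "\<lbrakk>x \<in> carrier L; y \<in> carrier L; z \<in> carrier L\<rbrakk> \<Longrightarrow>
       x \<otimes>\<^bsub>L\<^esub> (y \<otimes>\<^bsub>L\<^esub> z) \<oplus>\<^bsub>L\<^esub> y \<otimes>\<^bsub>L\<^esub> (z \<otimes>\<^bsub>L\<^esub> x) \<oplus>\<^bsub>L\<^esub> z \<otimes>\<^bsub>L\<^esub> (x \<otimes>\<^bsub>L\<^esub> y) = \<zero>\<^bsub>L\<^esub>"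

text \<open>Spanned by a finite set: no proper subspace contains it.\<close>

definition finite_dimensional :: "('k, 'r) ring_scheme \<Rightarrow> ('k, 'a, 'm) module_scheme \<Rightarrow> bool" where
  "finite_dimensional K L \<longleftrightarrow>
     (\<exists>S. finite S \<and> S \<subseteq> carrier L \<and> (\<forall>H. submodule H K L \<and> S \<subseteq> H \<longrightarrow> H = carrier L))"

definition lie_subalgebra ::
    "('k, 'r) ring_scheme \<Rightarrow> ('k, 'a, 'm) module_scheme \<Rightarrow> 'a set \<Rightarrow> bool" where
  "lie_subalgebra K L H \<longleftrightarrow> submodule H K L \<and> (\<forall>x\<in>H. \<forall>y\<in>H. x \<otimes>\<^bsub>L\<^esub> y \<in> H)"

definition lie_ideal ::
    "('k, 'r) ring_scheme \<Rightarrow> ('k, 'a, 'm) module_scheme \<Rightarrow> 'a set \<Rightarrow> bool" where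
  "lie_ideal K L H \<longleftrightarrow> submodule H K L \<and> (\<forall>x\<in>carrier L. \<forall>y\<in>H. x \<otimes>\<^bsub>L\<^esub> y \<in> H)"

definition minimal_ideal ::
    "('k, 'r) ring_scheme \<Rightarrow> ('k, 'a, 'm) module_scheme \<Rightarrow> 'a set \<Rightarrow> bool" where
  "minimal_ideal K L H \<longleftrightarrow> lie_ideal K L H \<and> H \<noteq> {\<zero>\<^bsub>L\<^esub>} \<and>
     (\<forall>J. lie_ideal K L J \<and> J \<subseteq> H \<longrightarrow> J = {\<zero>\<^bsub>L\<^esub>} \<or> J = H)"

definition maximal_subalgebra ::
    "('k, 'r) ring_scheme \<Rightarrow> ('k, 'a, 'm) module_scheme \<Rightarrow> 'a set \<Rightarrow> bool" where
  "maximal_subalgebra K L M \<longleftrightarrow> lie_subalgebra K L M \<and> M \<noteq> carrier L \<and>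
     (\<forall>H. lie_subalgebra K L H \<and> M \<subseteq> H \<longrightarrow> H = M \<or> H = carrier L)"

text \<open>The largest ideal contained in all maximal subalgebras (in \<^term>\<open>carrier L\<close> if there is
  no maximal subalgebra).\<close>

definition frattini_ideal ::
    "('k, 'r) ring_scheme \<Rightarrow> ('k, 'a, 'm) module_scheme \<Rightarrow> 'a set" where
  "frattini_ideal K L =
     (GREATEST H. lie_ideal K L H \<and> (\<forall>M. maximal_subalgebra K L M \<longrightarrow> H \<subseteq> M))"

text \<open>The sum of a family of subspaces is the least subspace containing all of them.\<close>

definition socle :: "('k, 'r) ring_scheme \<Rightarrow> ('k, 'a, 'm) module_scheme \<Rightarrow> 'a set" where
  "socle K L = \<Inter>{H. submodule H K L \<and> (\<forall>S. minimal_ideal K L S \<longrightarrow> S \<subseteq> H)}"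

definition nonabelian_on :: "('k, 'a, 'm) module_scheme \<Rightarrow> 'a set \<Rightarrow> bool" where
  "nonabelian_on L H \<longleftrightarrow> (\<exists>x\<in>H. \<exists>y\<in>H. x \<otimes>\<^bsub>L\<^esub> y \<noteq> \<zero>\<^bsub>L\<^esub>)"

definition primitive ::
    "('k, 'r) ring_scheme \<Rightarrow> ('k, 'a, 'm) module_scheme \<Rightarrow> bool" where
  "primitive K L \<longleftrightarrow> (\<exists>M. maximal_subalgebra K L M \<and>
     (\<forall>H. lie_ideal K L H \<and> H \<subseteq> M \<longrightarrow> H = {\<zero>\<^bsub>L\<^esub>}))"

definition primitive_type2 ::
    "('k, 'r) ring_scheme \<Rightarrow> ('k, 'a, 'm) module_scheme \<Rightarrow> bool" where
  "primitive_type2 K L \<longleftrightarrow> primitive K L \<and> (\<exists>!S. minimal_ideal K L S) \<and>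
     (\<forall>S. minimal_ideal K L S \<longrightarrow> nonabelian_on L S)"

definition linear_map :: "('k, 'r) ring_scheme \<Rightarrow> ('k, 'a, 'm) module_scheme \<Rightarrow>
    ('k, 'b, 'n) module_scheme \<Rightarrow> ('a \<Rightarrow> 'b) \<Rightarrow> bool" where
  "linear_map K A B f \<longleftrightarrow> f \<in> carrier A \<rightarrow> carrier B \<and>
     (\<forall>x\<in>carrier A. \<forall>y\<in>carrier A. f (x \<oplus>\<^bsub>A\<^esub> y) = f x \<oplus>\<^bsub>B\<^esub> f y) \<and>
     (\<forall>k\<in>carrier K. \<forall>x\<in>carrier A. f (k \<odot>\<^bsub>A\<^esub> x) = k \<odot>\<^bsub>B\<^esub> f x)"

definition lie_iso :: "('k, 'r) ring_scheme \<Rightarrow> ('k, 'a, 'm) module_scheme \<Rightarrow>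
    ('k, 'b, 'n) module_scheme \<Rightarrow> ('a \<Rightarrow> 'b) \<Rightarrow> bool" where
  "lie_iso K A B f \<longleftrightarrow> linear_map K A B f \<and>
     (\<forall>x\<in>carrier A. \<forall>y\<in>carrier A. f (x \<otimes>\<^bsub>A\<^esub> y) = f x \<otimes>\<^bsub>B\<^esub> f y) \<and>
     bij_betw f (carrier A) (carrier B)"

section \<open>Quotients\<close>

text \<open>The quotient \<open>L/B\<close>: the quotient \<open>L Quot B\<close> of the library, extended by
  the scalar multiplication of cosets.\<close>

definition lie_quot :: "('k, 'a, 'm) module_scheme \<Rightarrow> 'a set \<Rightarrow> ('k, 'a set) module" where
  "lie_quot L B = ring.extend (L Quot B)
     (module.fields (\<lambda>k S. \<Union>x\<in>S. B +>\<^bsub>L\<^esub> (k \<odot>\<^bsub>L\<^esub> x)))"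

text \<open>\<open>A/B\<close> for a subalgebra \<open>A\<close> of \<open>L\<close> and an ideal \<open>B \<subseteq> A\<close>; its elements are cosets
  of \<open>B\<close> in \<open>L\<close>, so the carrier of \<open>A/B\<close> is literally a subset of that of \<open>L/B\<close>.\<close>

definition factor :: "('k, 'a, 'm) module_scheme \<Rightarrow> 'a set \<Rightarrow> 'a set \<Rightarrow> ('k, 'a set) module" where
  "factor L A B = lie_quot (L\<lparr>carrier := A\<rparr>) B"

text \<open>The action of \<open>L\<close> on \<open>A/B\<close>: \<open>x.(B + a) = B + xa\<close>.\<close>

definition factor_action :: "('k, 'a, 'm) module_scheme \<Rightarrow> 'a set \<Rightarrow> 'a \<Rightarrow> 'a set \<Rightarrow> 'a set" where
  "factor_action L B x S = (\<Union>a\<in>S. B +>\<^bsub>L\<^esub> (x \<otimes>\<^bsub>L\<^esub> a))"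

section \<open>\<open>L\<close>-algebras, semi-direct sums and \<open>L\<close>-equivalence\<close>

definition derivation ::
    "('k, 'r) ring_scheme \<Rightarrow> ('k, 'b, 'n) module_scheme \<Rightarrow> ('b \<Rightarrow> 'b) \<Rightarrow> bool" where
  "derivation K A D \<longleftrightarrow> linear_map K A A D \<and>
     (\<forall>a\<in>carrier A. \<forall>b\<in>carrier A. D (a \<otimes>\<^bsub>A\<^esub> b) = (D a \<otimes>\<^bsub>A\<^esub> b) \<oplus>\<^bsub>A\<^esub> (a \<otimes>\<^bsub>A\<^esub> D b))"

text \<open>\<open>\<theta>\<close> is a Lie homomorphism from \<open>L\<close> to \<open>Der A\<close>, the latter carrying the pointwise
  linear structure and the commutator bracket; equality of derivations is equality on
  \<^term>\<open>carrier A\<close>.\<close>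

definition L_algebra :: "('k, 'r) ring_scheme \<Rightarrow> ('k, 'a, 'm) module_scheme \<Rightarrow>
    ('k, 'b, 'n) module_scheme \<Rightarrow> ('a \<Rightarrow> 'b \<Rightarrow> 'b) \<Rightarrow> bool" where
  "L_algebra K L A \<theta> \<longleftrightarrow> lie_algebra K A \<and>
     (\<forall>x\<in>carrier L. derivation K A (\<theta> x)) \<and>
     (\<forall>x\<in>carrier L. \<forall>y\<in>carrier L. \<forall>a\<in>carrier A. \<theta> (x \<oplus>\<^bsub>L\<^esub> y) a = \<theta> x a \<oplus>\<^bsub>A\<^esub> \<theta> y a) \<and>
     (\<forall>k\<in>carrier K. \<forall>x\<in>carrier L. \<forall>a\<in>carrier A. \<theta> (k \<odot>\<^bsub>L\<^esub> x) a = k \<odot>\<^bsub>A\<^esub> \<theta> x a) \<and>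
     (\<forall>x\<in>carrier L. \<forall>y\<in>carrier L. \<forall>a\<in>carrier A.
        \<theta> (x \<otimes>\<^bsub>L\<^esub> y) a = \<theta> x (\<theta> y a) \<ominus>\<^bsub>A\<^esub> \<theta> y (\<theta> x a))"

definition irreducible_L_algebra :: "('k, 'r) ring_scheme \<Rightarrow> ('k, 'a, 'm) module_scheme \<Rightarrow>
    ('k, 'b, 'n) module_scheme \<Rightarrow> ('a \<Rightarrow> 'b \<Rightarrow> 'b) \<Rightarrow> bool" where
  "irreducible_L_algebra K L A \<theta> \<longleftrightarrow> L_algebra K L A \<theta> \<and> carrier A \<noteq> {\<zero>\<^bsub>A\<^esub>} \<and>
     (\<forall>H. submodule H K A \<and> (\<forall>x\<in>carrier L. \<forall>a\<in>H. \<theta> x a \<in> H) \<longrightarrow>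
          H = {\<zero>\<^bsub>A\<^esub>} \<or> H = carrier A)"

definition semidirect :: "('k, 'b, 'n) module_scheme \<Rightarrow> ('a \<Rightarrow> 'b \<Rightarrow> 'b) \<Rightarrow>
    ('k, 'a, 'm) module_scheme \<Rightarrow> ('k, 'b \<times> 'a) module" where
  "semidirect A \<theta> L =
     \<lparr>carrier = carrier A \<times> carrier L,
      monoid.mult = (\<lambda>(a1, x1) (a2, x2).
        ((\<theta> x1 a2 \<ominus>\<^bsub>A\<^esub> \<theta> x2 a1) \<oplus>\<^bsub>A\<^esub> (a1 \<otimes>\<^bsub>A\<^esub> a2), x1 \<otimes>\<^bsub>L\<^esub> x2)),
      one = (\<one>\<^bsub>A\<^esub>, \<one>\<^bsub>L\<^esub>),
      zero = (\<zero>\<^bsub>A\<^esub>, \<zero>\<^bsub>L\<^esub>),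
      add = (\<lambda>(a1, x1) (a2, x2). (a1 \<oplus>\<^bsub>A\<^esub> a2, x1 \<oplus>\<^bsub>L\<^esub> x2)),
      smult = (\<lambda>k (a, x). (k \<odot>\<^bsub>A\<^esub> a, k \<odot>\<^bsub>L\<^esub> x))\<rparr>"

definition L_equivalent :: "('k, 'r) ring_scheme \<Rightarrow> ('k, 'a, 'm) module_scheme \<Rightarrow>
    ('k, 'b, 'n) module_scheme \<Rightarrow> ('a \<Rightarrow> 'b \<Rightarrow> 'b) \<Rightarrow>
    ('k, 'c, 'p) module_scheme \<Rightarrow> ('a \<Rightarrow> 'c \<Rightarrow> 'c) \<Rightarrow> bool" where
  "L_equivalent K L A \<theta> B \<eta> \<longleftrightarrow>
     (\<exists>\<Phi>. lie_iso K (semidirect A \<theta> L) (semidirect B \<eta> L) \<Phi> \<and>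
          \<Phi> ` (carrier A \<times> {\<zero>\<^bsub>L\<^esub>}) = carrier B \<times> {\<zero>\<^bsub>L\<^esub>} \<and>
          (\<forall>a\<in>carrier A. \<forall>x\<in>carrier L. snd (\<Phi> (a, x)) = x))"

section \<open>Chief factors\<close>

definition chief_factor :: "('k, 'r) ring_scheme \<Rightarrow> ('k, 'a, 'm) module_scheme \<Rightarrow>
    'a set \<Rightarrow> 'a set \<Rightarrow> bool" where
  "chief_factor K L A B \<longleftrightarrow> lie_ideal K L A \<and> lie_ideal K L B \<and> B \<subset> A \<and>
     minimal_ideal K (lie_quot L B) (carrier (factor L A B))"

definition chief_series :: "('k, 'r) ring_scheme \<Rightarrow> ('k, 'a, 'm) module_scheme \<Rightarrow>
    nat \<Rightarrow> (nat \<Rightarrow> 'a set) \<Rightarrow> bool" where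
  "chief_series K L n X \<longleftrightarrow> X 0 = {\<zero>\<^bsub>L\<^esub>} \<and> X n = carrier L \<and>
     (\<forall>i\<in>{1..n}. chief_factor K L (X i) (X (i - 1)))"

definition supplement :: "('k, 'r) ring_scheme \<Rightarrow> ('k, 'a, 'm) module_scheme \<Rightarrow>
    'a set \<Rightarrow> 'a set \<Rightarrow> 'a set \<Rightarrow> bool" where
  "supplement K L A B M \<longleftrightarrow>
     lie_subalgebra K L M \<and> carrier L = A <+>\<^bsub>L\<^esub> M \<and> B \<subseteq> A \<inter> M"

definition complement :: "('k, 'r) ring_scheme \<Rightarrow> ('k, 'a, 'm) module_scheme \<Rightarrow>
    'a set \<Rightarrow> 'a set \<Rightarrow> 'a set \<Rightarrow> bool" where
  "complement K L A B M \<longleftrightarrow> supplement K L A B M \<and> A \<inter> M = B"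

definition c_factor :: "('k, 'r) ring_scheme \<Rightarrow> ('k, 'a, 'm) module_scheme \<Rightarrow>
    'a set \<Rightarrow> 'a set \<Rightarrow> bool" where
  "c_factor K L A B \<longleftrightarrow> chief_factor K L A B \<and> (\<exists>M. complement K L A B M)"

definition c'_factor :: "('k, 'r) ring_scheme \<Rightarrow> ('k, 'a, 'm) module_scheme \<Rightarrow>
    'a set \<Rightarrow> 'a set \<Rightarrow> bool" where
  "c'_factor K L A B \<longleftrightarrow> chief_factor K L A B \<and> \<not> (\<exists>M. complement K L A B M)"

definition m'_factor :: "('k, 'r) ring_scheme \<Rightarrow> ('k, 'a, 'm) module_scheme \<Rightarrow>
    'a set \<Rightarrow> 'a set \<Rightarrow> bool" where
  "m'_factor K L A B \<longleftrightarrow> chief_factor K L A B \<and>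
     \<not> (\<exists>M. complement K L A B M \<and> maximal_subalgebra K L M)"

definition max_supplemented :: "('k, 'r) ring_scheme \<Rightarrow> ('k, 'a, 'm) module_scheme \<Rightarrow>
    'a set \<Rightarrow> 'a set \<Rightarrow> bool" where
  "max_supplemented K L A B \<longleftrightarrow> chief_factor K L A B \<and>
     (\<exists>M. supplement K L A B M \<and> maximal_subalgebra K L M)"

definition frattini_factor :: "('k, 'r) ring_scheme \<Rightarrow> ('k, 'a, 'm) module_scheme \<Rightarrow>
    'a set \<Rightarrow> 'a set \<Rightarrow> bool" where
  "frattini_factor K L A B \<longleftrightarrow> chief_factor K L A B \<and>
     carrier (factor L A B) \<subseteq> frattini_ideal K (lie_quot L B)"

text \<open>\<open>searrow L A B C D\<close> is \<open>A/B \<searrow> C/D\<close>, equivalently \<open>C/D \<swarrow> A/B\<close>.\<close>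

definition searrow ::
    "('k, 'a, 'm) module_scheme \<Rightarrow> 'a set \<Rightarrow> 'a set \<Rightarrow> 'a set \<Rightarrow> 'a set \<Rightarrow> bool" where
  "searrow L A B C D \<longleftrightarrow> A = B <+>\<^bsub>L\<^esub> C \<and> B \<inter> C = D"

definition m_crossing :: "('k, 'r) ring_scheme \<Rightarrow> ('k, 'a, 'm) module_scheme \<Rightarrow>
    'a set \<Rightarrow> 'a set \<Rightarrow> 'a set \<Rightarrow> 'a set \<Rightarrow> bool" where
  "m_crossing K L U V W X \<longleftrightarrow>
     searrow L U V W X \<and> frattini_factor K L U V \<and> max_supplemented K L W X"

definition m_related :: "('k, 'r) ring_scheme \<Rightarrow> ('k, 'a, 'm) module_scheme \<Rightarrow>
    'a set \<Rightarrow> 'a set \<Rightarrow> 'a set \<Rightarrow> 'a set \<Rightarrow> bool" where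
  "m_related K L A B C D \<longleftrightarrow> chief_factor K L A B \<and> chief_factor K L C D \<and>
     ((\<exists>R S. max_supplemented K L R S \<and> searrow L R S A B \<and> searrow L R S C D) \<or>
      (\<exists>U V W X. m_crossing K L U V W X \<and> searrow L V X A B \<and> searrow L W X C D) \<or>
      (\<exists>Y Z. frattini_factor K L Y Z \<and> searrow L A B Y Z \<and> searrow L C D Y Z) \<or>
      (\<exists>U V W X. m_crossing K L U V W X \<and> searrow L A B U V \<and> searrow L C D U W))"

text \<open>The unique permutation of the indices matching two chief series through \<open>m\<close>-related
  factors.\<close>

definition m_perm :: "('k, 'r) ring_scheme \<Rightarrow> ('k, 'a, 'm) module_scheme \<Rightarrow>
    nat \<Rightarrow> (nat \<Rightarrow> 'a set) \<Rightarrow> (nat \<Rightarrow> 'a set) \<Rightarrow> nat \<Rightarrow> nat" where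
  "m_perm K L n X Y =
     (THE \<pi>. \<pi> permutes {1..n} \<and>
       (\<forall>k\<in>{1..n}. m_related K L (X k) (X (k - 1)) (Y (\<pi> k)) (Y (\<pi> k - 1))))"

section \<open>\<open>L\<close>-algebras of \<open>cc'\<close>-type\<close>

text \<open>Conditions (i)--(iv) on a pair consisting of a \<open>c\<close>-factor \<open>A1/A0\<close> (written \<open>A\<^sup>*/A\<^sub>*\<close>)
  and a \<open>c'\<close>-factor \<open>B1/B0\<close> (written \<open>B\<^sup>*/B\<^sub>*\<close>). In (iii), \<open>F/C\<close> acts on \<open>I/C\<close> by the
  bracket of \<open>L/C\<close>.\<close>

definition cc'_configuration :: "('k, 'r) ring_scheme \<Rightarrow> ('k, 'a, 'm) module_scheme \<Rightarrow>
    'a set \<Rightarrow> 'a set \<Rightarrow> 'a set \<Rightarrow> 'a set \<Rightarrow> bool" where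
  "cc'_configuration K L A1 A0 B1 B0 \<longleftrightarrow>
     (\<exists>I C X N. lie_ideal K L I \<and> lie_ideal K L C \<and> lie_ideal K L X \<and> lie_ideal K L N \<and>
        searrow L I C B1 B0 \<and> c'_factor K L I C \<and>
        X \<subseteq> I \<and> N = X \<inter> C \<and> searrow L X N A1 A0 \<and> searrow L I C X N \<and> c_factor K L X N \<and>
        (\<exists>F. supplement K L I C F \<and>
          (\<exists>h. lie_iso K (lie_quot L N)
                 (semidirect (factor L I C) (monoid.mult (lie_quot L C)) (factor L F C)) h)) \<and>
        primitive_type2 K (lie_quot L C) \<and>
        socle K (lie_quot L C) = carrier (factor L I C))"

definition cc'_type :: "('k, 'r) ring_scheme \<Rightarrow> ('k, 'a, 'm) module_scheme \<Rightarrow>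
    ('k, 'b, 'n) module_scheme \<Rightarrow> ('a \<Rightarrow> 'b \<Rightarrow> 'b) \<Rightarrow> bool" where
  "cc'_type K L A \<theta> \<longleftrightarrow> irreducible_L_algebra K L A \<theta> \<and>
     (\<exists>n X Y. chief_series K L n X \<and> chief_series K L n Y \<and>
       (\<exists>i\<in>{1..n}. \<exists>P P' Q Q'.
          P = X i \<and> P' = X (i - 1) \<and>
          Q = Y (m_perm K L n X Y i) \<and> Q' = Y (m_perm K L n X Y i - 1) \<and>
          L_equivalent K L A \<theta> (factor L P P') (factor_action L P') \<and>
          m'_factor K L P P' \<and> m'_factor K L Q Q' \<and>
          nonabelian_on (factor L P P') (carrier (factor L P P')) \<and>
          nonabelian_on (factor L Q Q') (carrier (factor L Q Q')) \<and>
          (c_factor K L P P' \<and> c'_factor K L Q Q' \<and> cc'_configuration K L P P' Q Q' \<or>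
           c_factor K L Q Q' \<and> c'_factor K L P P' \<and> cc'_configuration K L Q Q' P P')))"

text \<open>The \<open>L\<close>-equivalence classes of irreducible \<open>L\<close>-algebras of \<open>cc'\<close>-type. An \<open>L\<close>-algebra of
  \<open>cc'\<close>-type is by definition \<open>L\<close>-equivalent to some chief factor of \<open>L\<close>, whose elements are
  cosets in \<open>L\<close>; so nothing is lost by restricting to \<open>L\<close>-algebras with carrier in the type
  \<^typ>\<open>'a set\<close>, where \<^typ>\<open>'a\<close> is the type of elements of \<open>L\<close>. Values of the operations outside
  the carriers are irrelevant to \<^const>\<open>L_equivalent\<close> and hence do not affect the classes.\<close>

definition cc'_algebras :: "('k, 'r) ring_scheme \<Rightarrow> ('k, 'a, 'm) module_scheme \<Rightarrow>
    (('k, 'a set) module \<times> ('a \<Rightarrow> 'a set \<Rightarrow> 'a set)) set" where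
  "cc'_algebras K L = {(A, \<theta>). cc'_type K L A \<theta>}"

definition cc'_classes :: "('k, 'r) ring_scheme \<Rightarrow> ('k, 'a, 'm) module_scheme \<Rightarrow>
    (('k, 'a set) module \<times> ('a \<Rightarrow> 'a set \<Rightarrow> 'a set)) set set" where
  "cc'_classes K L = cc'_algebras K L //
     {((A, \<theta>), (B, \<eta>)). (A, \<theta>) \<in> cc'_algebras K L \<and> (B, \<eta>) \<in> cc'_algebras K L \<and>
        L_equivalent K L A \<theta> B \<eta>}"

definition num_c_factors :: "('k, 'r) ring_scheme \<Rightarrow> ('k, 'a, 'm) module_scheme \<Rightarrow>
    nat \<Rightarrow> (nat \<Rightarrow> 'a set) \<Rightarrow> nat" where
  "num_c_factors K L n X = card {i \<in> {1..n}. c_factor K L (X i) (X (i - 1))}"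

end

theory Submission
  imports Defs
begin

text \<open>
  Complemented abelian chief factors are equally many in all chief series: the equality
  survives the exchange of one ideal in a diamond, the only critical case being an
  \<open>m\<close>-crossing. A nonabelian chief factor \<open>A/B\<close> is determined, within a given chief series, by
  its centralizer \<open>Z\<close>, and it is \<open>L\<close>-isomorphic to the unique minimal ideal \<open>I/Z\<close> of \<open>L/Z\<close>. If
  another factor of the same \<open>L\<close>-equivalence class lies above \<open>A/B\<close>, then the kernel of the
  crossed homomorphism given by the equivalence complements \<open>A/B\<close>. Hence each
  \<open>L\<close>-equivalence class contributes at most one noncomplemented nonabelian factor to a chief
  series, namely its last one, and the numbers for two series can only differ through
  classes for which the last factor is complemented in one series and not in the other.
  For such a class \<open>I/Z\<close> is not complemented, and raising the complemented last factor to
  \<open>I/Z\<close> shows that the class is of \<open>cc'\<close>-type.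
\<close>

section \<open>Subspaces, subalgebras and ideals\<close>

text \<open>An \<open>L\<close>-equivalence of nonabelian chief factors is weaker than an
  isomorphism of \<open>L\<close>-modules: it admits a crossed map \<delta>, so equivalent factors
  may have different centralizers and occupy several places of one chief series. Complementability
  passes only downwards between perspective factors, from (B + C)/B to C/(B \<inter> C); among the
  factors with centralizer Z, the top one I/Z is therefore the hardest to complement, and a
  complement below it can get lost on the way up. The factors in the definition of cc'-type must
  also be m'-factors. A maximal complement M of A/B would either contain Z and then complement I/Z,
  or yield an equivalent factor Z/(M \<inter> Z) centralized by A; taking the last factor of the
  class excludes both. Engel's theorem enters because a nonabelian chief factor must have a maximal
  supplement: this makes L/Z primitive and keeps nonabelian factors out of m-crossings, so that the
  permutation for two series differing in one diamond can be computed. Calculations use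
  representatives in L modulo ideals and are carried over to the quotient records
  separately.\<close>

locale lie_alg = lie_algebra K L for L :: "('k, 'a, 'm) module_scheme" (structure)
    and K :: "('k, 'r) ring_scheme" (structure)
begin

abbreviation "subsp H \<equiv> submodule H K L"
abbreviation "subalg H \<equiv> lie_subalgebra K L H"
abbreviation "idl H \<equiv> lie_ideal K L H"
abbreviation ssum (infixl "\<boxplus>" 65)
  where "A \<boxplus> B \<equiv> A <+>\<^bsub>L\<^esub> B"

lemma K_closed: "\<zero>\<^bsub>K\<^esub> \<in> carrier K" "\<one>\<^bsub>K\<^esub> \<in> carrier K"
  by simp_all

lemma is_lie_algebra: "lie_algebra K L"
  using lie_algebra_axioms .

lemma subsp_closed: "subsp H \<Longrightarrow> x \<in> H \<Longrightarrow> x \<in> carrier L"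
  using submoduleE(1) by blast

lemma subsp_subset: "subsp H \<Longrightarrow> H \<subseteq> carrier L"
  using submoduleE(1) by blast

lemma subsp_zero: "subsp H \<Longrightarrow> \<zero> \<in> H"
  using submodule.axioms(1) subgroup.one_closed by force

lemma subsp_add: "subsp H \<Longrightarrow> x \<in> H \<Longrightarrow> y \<in> H \<Longrightarrow> x \<oplus> y \<in> H"
  using submoduleE(5) by blast

lemma subsp_neg: "subsp H \<Longrightarrow> x \<in> H \<Longrightarrow> \<ominus> x \<in> H"
  using submoduleE(3) by blast

lemma subsp_minus: "subsp H \<Longrightarrow> x \<in> H \<Longrightarrow> y \<in> H \<Longrightarrow> x \<ominus> y \<in> H"
  using subsp_add subsp_neg M.minus_eq subsp_closed by metis

lemma subsp_smult: "subsp H \<Longrightarrow> k \<in> carrier K \<Longrightarrow> x \<in> H \<Longrightarrow> k \<odot> x \<in> H"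
  using submoduleE(4) by blast

lemmas subsp_simps = subsp_zero subsp_add subsp_neg subsp_minus subsp_smult

lemma idl_subsp: "idl H \<Longrightarrow> subsp H"
  by (simp add: lie_ideal_def)

lemma subalg_subsp: "subalg H \<Longrightarrow> subsp H"
  by (simp add: lie_subalgebra_def)

lemma idl_carrier: "idl (carrier L)"
  by (simp add: lie_ideal_def carrier_is_submodule bracket_closed)

lemma subsp_triv: "subsp {\<zero>}"
  by (rule submoduleI) auto

lemma bracket_zero_right [simp]: "x \<in> carrier L \<Longrightarrow> x \<otimes> \<zero> = \<zero>"
  by (metis M.add.l_cancel_one' M.l_zero M.zero_closed bracket_add_right bracket_closed)

lemma bracket_zero_left [simp]: "x \<in> carrier L \<Longrightarrow> \<zero> \<otimes> x = \<zero>"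
  by (metis M.add.l_cancel_one' M.l_zero M.zero_closed bracket_add_left bracket_closed)

lemma idl_triv: "idl {\<zero>}"
  by (simp add: lie_ideal_def subsp_triv)

lemma bracket_neg_right: "x \<in> carrier L \<Longrightarrow> y \<in> carrier L \<Longrightarrow> x \<otimes> (\<ominus> y) = \<ominus> (x \<otimes> y)"
  by (metis M.a_inv_closed M.minus_equality M.l_neg bracket_add_right bracket_closed bracket_zero_right)

lemma bracket_neg_left: "x \<in> carrier L \<Longrightarrow> y \<in> carrier L \<Longrightarrow> (\<ominus> x) \<otimes> y = \<ominus> (x \<otimes> y)"
  by (metis M.a_inv_closed M.minus_equality M.l_neg bracket_add_left bracket_closed bracket_zero_left)

lemma bracket_minus_right:
  "x \<in> carrier L \<Longrightarrow> y \<in> carrier L \<Longrightarrow> z \<in> carrier L \<Longrightarrow> x \<otimes> (y \<ominus> z) = x \<otimes> y \<ominus> x \<otimes> z"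
  by (simp add: M.minus_eq bracket_add_right bracket_neg_right)

lemma bracket_minus_left:
  "x \<in> carrier L \<Longrightarrow> y \<in> carrier L \<Longrightarrow> z \<in> carrier L \<Longrightarrow> (y \<ominus> z) \<otimes> x = y \<otimes> x \<ominus> z \<otimes> x"
  by (simp add: M.minus_eq bracket_add_left bracket_neg_left)

lemma bracket_anti:
  assumes "x \<in> carrier L" "y \<in> carrier L" shows "x \<otimes> y = \<ominus> (y \<otimes> x)"
proof -
  have "\<zero> = (x \<oplus> y) \<otimes> (x \<oplus> y)" using assms bracket_self by simp
  also have "\<dots> = x \<otimes> y \<oplus> y \<otimes> x"
    unfolding bracket_add_left[OF assms M.a_closed[OF assms]]
    using assms by (simp add: bracket_add_right bracket_self bracket_closed)
  finally show ?thesis using assms by (metis M.minus_equality bracket_closed)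
qed

declare bracket_closed [simp]

lemma cancel_simps:
  assumes "x \<in> carrier L" "y \<in> carrier L"
  shows "x \<oplus> (\<ominus> x \<oplus> y) = y" "\<ominus> x \<oplus> (x \<oplus> y) = y" "x \<oplus> \<ominus> x = \<zero>" "\<ominus> x \<oplus> x = \<zero>"
  using assms by (simp_all add: M.r_neg1 M.r_neg2 M.r_neg M.l_neg)

text \<open>Sorting by associativity and commutativity can leave one or two terms between a summand
  and its negative; cancelling such pairs lets \<open>lin_simps\<close> settle the linear identities
  below.\<close>

lemma cancel_simps2:
  assumes "x \<in> carrier L" "y \<in> carrier L" "z \<in> carrier L"
  shows "x \<oplus> (y \<oplus> \<ominus> x) = y" "\<ominus> x \<oplus> (y \<oplus> x) = y"
    "x \<oplus> (y \<oplus> (\<ominus> x \<oplus> z)) = y \<oplus> z" "\<ominus> x \<oplus> (y \<oplus> (x \<oplus> z)) = y \<oplus> z"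
    "x \<oplus> (y \<oplus> (z \<oplus> \<ominus> x)) = y \<oplus> z" "\<ominus> x \<oplus> (y \<oplus> (z \<oplus> x)) = y \<oplus> z"
proof -
  have 1: "x \<oplus> (y \<oplus> \<ominus> x) = y" "\<ominus> x \<oplus> (y \<oplus> x) = y" if "y \<in> carrier L" for y
    using assms(1) that M.a_lcomm[of x y "\<ominus> x"] M.a_lcomm[of "\<ominus> x" y x]
    by (simp_all add: cancel_simps)
  show "x \<oplus> (y \<oplus> \<ominus> x) = y" "\<ominus> x \<oplus> (y \<oplus> x) = y" using 1 assms by auto
  show "x \<oplus> (y \<oplus> (\<ominus> x \<oplus> z)) = y \<oplus> z" "\<ominus> x \<oplus> (y \<oplus> (x \<oplus> z)) = y \<oplus> z"
    using assms M.a_lcomm[of x y "\<ominus> x \<oplus> z"] M.a_lcomm[of "\<ominus> x" y "x \<oplus> z"]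
    by (simp_all add: cancel_simps)
  show "x \<oplus> (y \<oplus> (z \<oplus> \<ominus> x)) = y \<oplus> z" "\<ominus> x \<oplus> (y \<oplus> (z \<oplus> x)) = y \<oplus> z"
    using assms 1[of "y \<oplus> z"] by (simp_all add: M.a_assoc)
qed

lemmas lin_simps = M.a_ac M.minus_eq M.minus_add cancel_simps cancel_simps2

text \<open>The Jacobi identity in the form in which it is mostly used: the adjoint map of x is a
  derivation. Antisymmetry turns the cyclic sum into it.\<close>

lemma jacobi_left:
  assumes "x \<in> carrier L" "y \<in> carrier L" "z \<in> carrier L"
  shows "x \<otimes> (y \<otimes> z) = (x \<otimes> y) \<otimes> z \<oplus> y \<otimes> (x \<otimes> z)"
proof -
  have "z \<otimes> (x \<otimes> y) = \<ominus> ((x \<otimes> y) \<otimes> z)" "y \<otimes> (z \<otimes> x) = \<ominus> (y \<otimes> (x \<otimes> z))"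
    using assms bracket_anti[of z "x \<otimes> y"] bracket_anti[of z x] by (simp_all add: bracket_neg_right)
  then have "x \<otimes> (y \<otimes> z) \<oplus> (\<ominus> (y \<otimes> (x \<otimes> z))) \<oplus> (\<ominus> ((x \<otimes> y) \<otimes> z)) = \<zero>"
    using jacobi[OF assms] by simp
  then have "x \<otimes> (y \<otimes> z) \<oplus> \<ominus> ((x \<otimes> y) \<otimes> z \<oplus> y \<otimes> (x \<otimes> z)) = \<zero>"
    using assms by (simp add: lin_simps)
  then show ?thesis using assms
    by (metis M.a_closed M.a_inv_closed M.minus_equality M.minus_minus bracket_closed)
qed

lemma jacobi_comm:
  assumes "x \<in> carrier L" "y \<in> carrier L" "z \<in> carrier L"
  shows "(x \<otimes> y) \<otimes> z = x \<otimes> (y \<otimes> z) \<ominus> y \<otimes> (x \<otimes> z)"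
proof -
  have "x \<otimes> (y \<otimes> z) \<ominus> y \<otimes> (x \<otimes> z) = (x \<otimes> y) \<otimes> z \<oplus> (y \<otimes> (x \<otimes> z) \<ominus> y \<otimes> (x \<otimes> z))"
    unfolding jacobi_left[OF assms] using assms by (simp add: M.minus_eq M.a_assoc)
  then show ?thesis using assms by (simp add: lin_simps)
qed

lemma subalg_bracket: "subalg H \<Longrightarrow> x \<in> H \<Longrightarrow> y \<in> H \<Longrightarrow> x \<otimes> y \<in> H"
  by (simp add: lie_subalgebra_def)

lemma idl_left: "idl H \<Longrightarrow> x \<in> carrier L \<Longrightarrow> y \<in> H \<Longrightarrow> x \<otimes> y \<in> H"
  by (simp add: lie_ideal_def)

lemma idl_right: "idl H \<Longrightarrow> x \<in> carrier L \<Longrightarrow> y \<in> H \<Longrightarrow> y \<otimes> x \<in> H"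
  by (metis bracket_anti idl_left idl_subsp subsp_closed subsp_neg)

lemma idl_subalg: "idl H \<Longrightarrow> subalg H"
  by (meson idl_left idl_subsp lie_subalgebra_def subsp_closed)

lemma subspI:
  assumes "H \<subseteq> carrier L" "\<zero> \<in> H" "\<And>a b. a \<in> H \<Longrightarrow> b \<in> H \<Longrightarrow> a \<oplus> b \<in> H"
    "\<And>k a. k \<in> carrier K \<Longrightarrow> a \<in> H \<Longrightarrow> k \<odot> a \<in> H"
  shows "subsp H"
proof (rule submoduleI)
  fix a assume "a \<in> H"
  then have "\<ominus> a = (\<ominus>\<^bsub>K\<^esub> \<one>\<^bsub>K\<^esub>) \<odot> a" using assms(1) smult_l_minus[of "\<one>\<^bsub>K\<^esub>" a] by auto
  then show "\<ominus> a \<in> H" using assms(4) \<open>a \<in> H\<close> by simp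
qed (use assms in auto)

lemma subalgI: "subsp H \<Longrightarrow> (\<And>x y. x \<in> H \<Longrightarrow> y \<in> H \<Longrightarrow> x \<otimes> y \<in> H) \<Longrightarrow> subalg H"
  by (simp add: lie_subalgebra_def)

lemma idlI: "subsp H \<Longrightarrow> (\<And>x y. x \<in> carrier L \<Longrightarrow> y \<in> H \<Longrightarrow> x \<otimes> y \<in> H) \<Longrightarrow> idl H"
  by (simp add: lie_ideal_def)

lemma subsp_Int: "subsp A \<Longrightarrow> subsp B \<Longrightarrow> subsp (A \<inter> B)"
  by (rule subspI) (auto simp: subsp_simps dest: subsp_closed)

lemma subalg_Int: "subalg A \<Longrightarrow> subalg B \<Longrightarrow> subalg (A \<inter> B)"
  by (simp add: lie_subalgebra_def subsp_Int)

lemma idl_Int: "idl A \<Longrightarrow> idl B \<Longrightarrow> idl (A \<inter> B)"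
  by (simp add: lie_ideal_def subsp_Int)

lemma mem_sum: "x \<in> A \<boxplus> B \<longleftrightarrow> (\<exists>a\<in>A. \<exists>b\<in>B. x = a \<oplus> b)"
  by (auto simp: set_add_def')

lemma sumI: "a \<in> A \<Longrightarrow> b \<in> B \<Longrightarrow> a \<oplus> b \<in> A \<boxplus> B"
  by (auto simp: mem_sum)

lemma subsp_sum:
  assumes A: "subsp A" and B: "subsp B" shows "subsp (A \<boxplus> B)"
proof (rule subspI)
  show "A \<boxplus> B \<subseteq> carrier L" using A B by (auto simp: mem_sum intro!: M.a_closed intro: subsp_closed)
  show "\<zero> \<in> A \<boxplus> B" unfolding mem_sum using A B subsp_zero M.l_zero by (metis M.zero_closed)
next
  fix x y assume "x \<in> A \<boxplus> B" "y \<in> A \<boxplus> B"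
  then obtain a b c d where *: "x = a \<oplus> b" "y = c \<oplus> d" "a \<in> A" "b \<in> B" "c \<in> A" "d \<in> B"
    unfolding mem_sum by blast
  moreover have "a \<in> carrier L" "b \<in> carrier L" "c \<in> carrier L" "d \<in> carrier L"
    using * A B subsp_closed by blast+
  ultimately have "x \<oplus> y = (a \<oplus> c) \<oplus> (b \<oplus> d)" by (simp add: M.a_ac)
  then show "x \<oplus> y \<in> A \<boxplus> B" using * A B by (auto intro!: sumI subsp_add)
next
  fix k x assume k: "k \<in> carrier K" "x \<in> A \<boxplus> B"
  then obtain a b where *: "x = a \<oplus> b" "a \<in> A" "b \<in> B" unfolding mem_sum by blast
  then have "k \<odot> x = (k \<odot> a) \<oplus> (k \<odot> b)" using k A B by (simp add: smult_r_distr subsp_closed)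
  then show "k \<odot> x \<in> A \<boxplus> B" using * k A B by (auto intro!: sumI subsp_smult)
qed

lemma sum_upper1: "subsp A \<Longrightarrow> subsp B \<Longrightarrow> A \<subseteq> A \<boxplus> B"
  by (metis M.r_zero subsetI subsp_closed subsp_zero sumI)

lemma sum_upper2: "subsp A \<Longrightarrow> subsp B \<Longrightarrow> B \<subseteq> A \<boxplus> B"
  by (metis M.l_zero subsetI subsp_closed subsp_zero sumI)

lemma sum_least: "subsp C \<Longrightarrow> A \<subseteq> C \<Longrightarrow> B \<subseteq> C \<Longrightarrow> A \<boxplus> B \<subseteq> C"
  by (auto simp: mem_sum intro!: subsp_add)

lemma sum_comm: "subsp A \<Longrightarrow> subsp B \<Longrightarrow> A \<boxplus> B = B \<boxplus> A"
  by (simp add: subset_antisym subsp_sum sum_least sum_upper1 sum_upper2)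

lemma sum_absorb: "subsp A \<Longrightarrow> subsp B \<Longrightarrow> B \<subseteq> A \<Longrightarrow> A \<boxplus> B = A"
  by (simp add: subset_antisym sum_least sum_upper1)

lemma sum_assoc:
  assumes "subsp A" "subsp B" "subsp C" shows "(A \<boxplus> B) \<boxplus> C = A \<boxplus> (B \<boxplus> C)"
proof -
  note * = subsp_sum[OF assms(1,2)] subsp_sum[OF assms(2,3)]
  show ?thesis
    using assms * sum_upper1[OF assms(1) *(2)] sum_upper2[OF assms(1) *(2)] sum_upper1[OF *(1) assms(3)]
      sum_upper2[OF *(1) assms(3)] sum_upper1[OF assms(1,2)] sum_upper2[OF assms(1,2)]
      sum_upper1[OF assms(2,3)] sum_upper2[OF assms(2,3)]
    by (intro subset_antisym sum_least subsp_sum) auto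
qed

lemma sum_mono: "A \<subseteq> A' \<Longrightarrow> B \<subseteq> B' \<Longrightarrow> A \<boxplus> B \<subseteq> A' \<boxplus> B'"
  unfolding mem_sum[abs_def] by (smt (verit) mem_sum subset_iff)

lemma idl_sum:
  assumes A: "idl A" and B: "idl B" shows "idl (A \<boxplus> B)"
proof (rule idlI)
  fix x y assume x: "x \<in> carrier L" and "y \<in> A \<boxplus> B"
  then obtain a b where *: "y = a \<oplus> b" "a \<in> A" "b \<in> B" unfolding mem_sum by blast
  then have "x \<otimes> y = x \<otimes> a \<oplus> x \<otimes> b"
    using x A B by (metis bracket_add_right idl_subsp subsp_closed)
  then show "x \<otimes> y \<in> A \<boxplus> B" using * x A B by (auto intro!: sumI idl_left)
qed (use A B in \<open>simp add: idl_subsp subsp_sum\<close>)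

text \<open>Every bracket with an A-component falls into the ideal A, so closure only depends on the
  product of the two B-components.\<close>

lemma subalg_sum:
  assumes A: "idl A" and B: "subalg B" shows "subalg (A \<boxplus> B)"
proof (rule subalgI)
  fix x y assume "x \<in> A \<boxplus> B" "y \<in> A \<boxplus> B"
  then obtain a b c d where *: "x = a \<oplus> b" "y = c \<oplus> d" "a \<in> A" "b \<in> B" "c \<in> A" "d \<in> B"
    unfolding mem_sum by blast
  then have cl: "a \<in> carrier L" "b \<in> carrier L" "c \<in> carrier L" "d \<in> carrier L"
    using A B subsp_closed idl_subsp subalg_subsp by blast+
  have "x \<otimes> y = (a \<otimes> (c \<oplus> d) \<oplus> b \<otimes> c) \<oplus> b \<otimes> d"
    using * cl by (simp add: bracket_add_left bracket_add_right M.a_ac)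
  moreover have "a \<otimes> (c \<oplus> d) \<oplus> b \<otimes> c \<in> A"
    using * cl A B idl_right[of A "c \<oplus> d" a] idl_left[of A b c] subsp_add[of A] idl_subsp by simp
  ultimately show "x \<otimes> y \<in> A \<boxplus> B" using * B by (auto intro!: sumI subalg_bracket)
qed (use A B in \<open>simp add: idl_subsp subalg_subsp subsp_sum\<close>)

text \<open>Dedekind's law for the lattice of subspaces. Most of the later statements about
  complements reduce to it.\<close>

lemma modular:
  assumes "subsp A" "subsp B" "subsp C" "A \<subseteq> C"
  shows "(A \<boxplus> B) \<inter> C = A \<boxplus> (B \<inter> C)"
proof
  show "(A \<boxplus> B) \<inter> C \<subseteq> A \<boxplus> (B \<inter> C)"
  proof
    fix x assume "x \<in> (A \<boxplus> B) \<inter> C"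
    then obtain a b where *: "x = a \<oplus> b" "a \<in> A" "b \<in> B" "x \<in> C" using mem_sum by auto
    moreover have "a \<in> carrier L" "b \<in> carrier L" using * assms subsp_closed by blast+
    ultimately have "b = x \<ominus> a" by (simp add: lin_simps)
    then have "b \<in> C" using * assms subsp_minus[of C x a] by auto
    then show "x \<in> A \<boxplus> (B \<inter> C)" using * by (auto intro!: sumI)
  qed
  show "A \<boxplus> (B \<inter> C) \<subseteq> (A \<boxplus> B) \<inter> C"
    using sum_mono[of A A "B \<inter> C" B] sum_least[of C A "B \<inter> C"] assms by blast
qed

lemma subsp_add_cancel:
  assumes "subsp H" "x \<in> H" "y \<in> carrier L" "x \<oplus> y \<in> H" shows "y \<in> H"
proof -
  have "x \<in> carrier L" using assms subsp_closed by blast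
  then have "y = \<ominus> x \<oplus> (x \<oplus> y)" using assms by (simp add: cancel_simps)
  then show ?thesis using assms subsp_neg subsp_add by metis
qed

lemma subsp_add_cancel2:
  assumes "subsp H" "x \<in> H" "y \<in> carrier L" "y \<oplus> x \<in> H" shows "y \<in> H"
  using assms subsp_add_cancel[of H x y] M.a_comm subsp_closed by metis

end

section \<open>Dimension and Engel's theorem\<close>

context lie_alg begin

text \<open>Chief factors as covering pairs in the lattice of ideals of L, so that arguments can
  stay inside L; \<open>chief_factor_iff\<close> identifies this notion with
  \<open>chief_factor\<close>.\<close>

definition chief :: "'a set \<Rightarrow> 'a set \<Rightarrow> bool" where
  "chief A B \<longleftrightarrow> idl A \<and> idl B \<and> B \<subset> A \<and> (\<forall>J. idl J \<and> B \<subseteq> J \<and> J \<subseteq> A \<longrightarrow> J = B \<or> J = A)"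

definition abelian_factor :: "'a set \<Rightarrow> 'a set \<Rightarrow> bool" where
  "abelian_factor A B \<longleftrightarrow> (\<forall>x\<in>A. \<forall>y\<in>A. x \<otimes> y \<in> B)"

definition centralizer :: "'a set \<Rightarrow> 'a set \<Rightarrow> 'a set" where
  "centralizer A B = {x \<in> carrier L. \<forall>a\<in>A. x \<otimes> a \<in> B}"

lemma chiefD: "chief A B \<Longrightarrow> idl J \<Longrightarrow> B \<subseteq> J \<Longrightarrow> J \<subseteq> A \<Longrightarrow> J = B \<or> J = A"
  by (simp add: chief_def)

lemma chief_idl: "chief A B \<Longrightarrow> idl A" "chief A B \<Longrightarrow> idl B" "chief A B \<Longrightarrow> B \<subset> A"
  by (simp_all add: chief_def)

text \<open>The recursion makes the tails of the list span a flag whose terms differ by at most one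
  dimension at each step; dimensions are read off from this flag.\<close>

primrec lspan :: "'a list \<Rightarrow> 'a set" where
  "lspan [] = {\<zero>}"
| "lspan (s # ss) = {k \<odot> s \<oplus> y | k y. k \<in> carrier K \<and> y \<in> lspan ss}"

lemma subsp_lspan: "set ss \<subseteq> carrier L \<Longrightarrow> subsp (lspan ss)"
proof (induction ss)
  case (Cons s ss)
  then have s: "s \<in> carrier L" and H: "subsp (lspan ss)" by auto
  have cl: "y \<in> carrier L" if "y \<in> lspan ss" for y using that H subsp_closed by blast
  show ?case
  proof (rule subspI)
    show "lspan (s # ss) \<subseteq> carrier L" using s cl by auto
    have "\<zero> = \<zero>\<^bsub>K\<^esub> \<odot> s \<oplus> \<zero>" using s by simp
    then show "\<zero> \<in> lspan (s # ss)" using H subsp_zero by (simp, metis K_closed(1))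
  next
    fix a b assume "a \<in> lspan (s # ss)" "b \<in> lspan (s # ss)"
    then obtain k y l z where *: "k \<in> carrier K" "y \<in> lspan ss" "a = k \<odot> s \<oplus> y"
      "l \<in> carrier K" "z \<in> lspan ss" "b = l \<odot> s \<oplus> z" by auto
    then have "a \<oplus> b = (k \<oplus>\<^bsub>K\<^esub> l) \<odot> s \<oplus> (y \<oplus> z)"
      using s cl by (simp add: smult_l_distr M.a_ac)
    moreover have "k \<oplus>\<^bsub>K\<^esub> l \<in> carrier K" "y \<oplus> z \<in> lspan ss" using * H subsp_add by auto
    ultimately show "a \<oplus> b \<in> lspan (s # ss)" by auto
  next
    fix l a assume l: "l \<in> carrier K" and "a \<in> lspan (s # ss)"
    then obtain k y where *: "k \<in> carrier K" "y \<in> lspan ss" "a = k \<odot> s \<oplus> y" by auto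
    then have "l \<odot> a = (l \<otimes>\<^bsub>K\<^esub> k) \<odot> s \<oplus> l \<odot> y"
      using s cl l by (simp add: smult_r_distr smult_assoc1)
    moreover have "l \<otimes>\<^bsub>K\<^esub> k \<in> carrier K" "l \<odot> y \<in> lspan ss" using * H l subsp_smult by auto
    ultimately show "l \<odot> a \<in> lspan (s # ss)" by auto
  qed
qed (simp add: subsp_triv)

lemma lspan_mono: "set (s # ss) \<subseteq> carrier L \<Longrightarrow> lspan ss \<subseteq> lspan (s # ss)"
proof
  fix y assume s: "set (s # ss) \<subseteq> carrier L" and y: "y \<in> lspan ss"
  then have "y \<in> carrier L" using subsp_closed[of "lspan ss"] subsp_lspan[of ss] by auto
  then have "y = \<zero>\<^bsub>K\<^esub> \<odot> s \<oplus> y" using s by simp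
  then show "y \<in> lspan (s # ss)" using y by auto
qed

lemma set_lspan: "set ss \<subseteq> carrier L \<Longrightarrow> set ss \<subseteq> lspan ss"
proof (induction ss)
  case (Cons s ss)
  have "s = \<one>\<^bsub>K\<^esub> \<odot> s \<oplus> \<zero>" using Cons by simp
  then have "s \<in> lspan (s # ss)" using Cons subsp_zero[OF subsp_lspan] by (simp, metis K_closed(2))
  moreover have "set ss \<subseteq> lspan (s # ss)" using Cons lspan_mono[of s ss] by auto
  ultimately show ?case by simp
qed simp

lemma lspan_single: "y \<in> carrier L \<Longrightarrow> lspan [y] = {k \<odot> y | k. k \<in> carrier K}"
  by auto (metis M.r_zero smult_closed)+

text \<open>The number of jumps of \<open>H\<close> along the flag given by the tails of a spanning list, that is,
  the dimension of \<open>H\<close>.\<close>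

primrec flag_rank :: "'a list \<Rightarrow> 'a set \<Rightarrow> nat" where
  "flag_rank [] H = 0"
| "flag_rank (s # ss) H = flag_rank ss H + (if H \<inter> lspan (s # ss) \<subseteq> lspan ss then 0 else 1)"

lemma flag_rank_le: "flag_rank ss H \<le> length ss"
  by (induction ss) auto

lemma flag_rank_mono: "H \<subseteq> H' \<Longrightarrow> flag_rank ss H \<le> flag_rank ss H'"
proof (induction ss)
  case (Cons s ss)
  then have "flag_rank ss H \<le> flag_rank ss H'" by simp
  moreover have "H \<inter> lspan (s # ss) \<subseteq> lspan ss" if "H' \<inter> lspan (s # ss) \<subseteq> lspan ss"
    using that Cons.prems by blast
  ultimately show ?case by (simp del: lspan.simps)
qed simp

text \<open>If two nested subspaces jump at the same places of the flag, an element of the larger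
  one can be reduced by elements of the smaller one, step by step down the flag. This makes
  \<open>rank\<close> strictly monotone.\<close>

lemma flag_rank_eq:
  assumes "subsp H" "subsp H'" "H \<subseteq> H'"
  shows "set ss \<subseteq> carrier L \<Longrightarrow> flag_rank ss H = flag_rank ss H' \<Longrightarrow> H' \<inter> lspan ss \<subseteq> H"
proof (induction ss)
  case (Cons s ss)
  let ?P = "\<lambda>H. H \<inter> lspan (s # ss) \<subseteq> lspan ss"
  have s: "s \<in> carrier L" "set ss \<subseteq> carrier L" using Cons.prems by auto
  have imp: "?P H' \<Longrightarrow> ?P H" using assms by blast
  have le: "flag_rank ss H \<le> flag_rank ss H'" using flag_rank_mono assms by blast
  have eq: "flag_rank ss H = flag_rank ss H'" and iff: "?P H = ?P H'"
    using Cons.prems(2) imp le by (auto simp del: lspan.simps split: if_splits)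
  have IH: "H' \<inter> lspan ss \<subseteq> H" using Cons.IH[OF s(2) eq] .
  show ?case
  proof
    fix x assume x: "x \<in> H' \<inter> lspan (s # ss)"
    show "x \<in> H"
    proof (cases "x \<in> lspan ss")
      case True then show ?thesis using IH x by blast
    next
      case False
      then have "\<not> ?P H" using iff x by blast
      then obtain h where h: "h \<in> H" "h \<in> lspan (s # ss)" "h \<notin> lspan ss" by blast
      obtain k y where ky: "k \<in> carrier K" "y \<in> lspan ss" "h = k \<odot> s \<oplus> y" using h by auto
      obtain l z where lz: "l \<in> carrier K" "z \<in> lspan ss" "x = l \<odot> s \<oplus> z" using x by auto
      have cl: "y \<in> carrier L" "z \<in> carrier L" "h \<in> carrier L" "x \<in> carrier L"
        using ky lz subsp_lspan[OF s(2)] subsp_closed h x assms by blast+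
      have "k \<noteq> \<zero>\<^bsub>K\<^esub>" using h ky cl s by auto
      then have kU: "k \<in> Units K" using ky field_Units by blast
      \<comment> \<open>The coefficient k of h at s is nonzero because h lies outside the smaller
        flag term, so this multiple of h removes the s-component of x.\<close>
      define c where "c = l \<otimes>\<^bsub>K\<^esub> inv\<^bsub>K\<^esub> k"
      have c: "c \<in> carrier K" "c \<otimes>\<^bsub>K\<^esub> k = l" using kU lz ky by (auto simp: c_def m_assoc)
      have "x \<ominus> c \<odot> h = z \<ominus> c \<odot> y"
      proof -
        have "c \<odot> h = l \<odot> s \<oplus> c \<odot> y" using c ky cl s by (simp add: smult_r_distr smult_assoc1[symmetric])
        then show ?thesis using lz cl c s by (simp add: lin_simps)
      qed
      moreover have "z \<ominus> c \<odot> y \<in> lspan ss"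
        using ky lz c subsp_lspan[OF s(2)] by (simp add: subsp_minus subsp_smult)
      moreover have "x \<ominus> c \<odot> h \<in> H'" using x h assms c by (meson IntD1 subsetD subsp_minus subsp_smult)
      ultimately have "x \<ominus> c \<odot> h \<in> H" using IH by auto
      then have "(x \<ominus> c \<odot> h) \<oplus> c \<odot> h \<in> H" using assms h c by (simp add: subsp_add subsp_smult)
      then show ?thesis using cl c by (simp add: lin_simps)
    qed
  qed
qed (use assms subsp_zero in auto)

end

locale fd_lie_alg = lie_alg L K for L :: "('k, 'a, 'm) module_scheme" (structure)
    and K :: "('k, 'r) ring_scheme" (structure) +
  assumes fd: "finite_dimensional K L"
begin

text \<open>A redundant entry of a spanning list leaves the flag unchanged and causes no jump, so
  any spanning list measures the dimension.\<close>

definition basis_list :: "'a list" where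
  "basis_list = (SOME ss. set ss \<subseteq> carrier L \<and> lspan ss = carrier L)"

lemma basis_list: "set basis_list \<subseteq> carrier L" "lspan basis_list = carrier L"
proof -
  obtain S where S: "finite S \<and> S \<subseteq> carrier L \<and> (\<forall>H. subsp H \<and> S \<subseteq> H \<longrightarrow> H = carrier L)"
    using fd unfolding finite_dimensional_def by (rule exE)
  then obtain ss where ss: "set ss = S" using finite_list by metis
  have sub: "set ss \<subseteq> carrier L" using S ss by simp
  then have "lspan ss = carrier L"
    using S subsp_lspan[OF sub] set_lspan[OF sub] ss by simp
  then have "set ss \<subseteq> carrier L \<and> lspan ss = carrier L" using sub by simp
  then have "set basis_list \<subseteq> carrier L \<and> lspan basis_list = carrier L"
    unfolding basis_list_def by (rule someI)
  then show "set basis_list \<subseteq> carrier L" "lspan basis_list = carrier L" by auto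
qed

definition rank :: "'a set \<Rightarrow> nat" where "rank H = flag_rank basis_list H"

lemma rank_strict_mono: "subsp H \<Longrightarrow> subsp H' \<Longrightarrow> H \<subset> H' \<Longrightarrow> rank H < rank H'"
proof -
  assume *: "subsp H" "subsp H'" "H \<subset> H'"
  have "flag_rank basis_list H \<noteq> flag_rank basis_list H'"
  proof
    assume "flag_rank basis_list H = flag_rank basis_list H'"
    then have "H' \<inter> carrier L \<subseteq> H" using flag_rank_eq[of H H' basis_list] * basis_list by auto
    then show False using * subsp_subset by blast
  qed
  moreover have "flag_rank basis_list H \<le> flag_rank basis_list H'" using * flag_rank_mono by blast
  ultimately show "rank H < rank H'" unfolding rank_def by linarith
qed

text \<open>A candidate of greatest rank is maximal because \<open>rank\<close> is strictly
  monotone; finite dimension takes the place of Zorn's lemma.\<close>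

lemma ex_maximal_subsp:
  assumes P: "P H0" and "\<And>H. P H \<Longrightarrow> subsp H"
  obtains H where "P H" "H0 \<subseteq> H" "\<And>H'. P H' \<Longrightarrow> H \<subseteq> H' \<Longrightarrow> H' = H"
proof -
  let ?Q = "\<lambda>H. P H \<and> H0 \<subseteq> H"
  have "\<exists>H. ?Q H \<and> (\<forall>y. ?Q y \<longrightarrow> rank y \<le> rank H)"
    by (rule ex_has_greatest_nat[of ?Q H0 rank "Suc (length basis_list)"])
      (use P flag_rank_le[of basis_list] in \<open>auto simp: rank_def le_imp_less_Suc\<close>)
  then obtain H where H: "?Q H" "\<And>y. ?Q y \<Longrightarrow> rank y \<le> rank H" by auto
  have "H' = H" if "P H'" "H \<subseteq> H'" for H'
  proof (rule ccontr)
    assume "H' \<noteq> H"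
    then have "rank H < rank H'" using that H assms by (intro rank_strict_mono) auto
    moreover have "rank H' \<le> rank H" using H that by auto
    ultimately show False by simp
  qed
  then show ?thesis using that[of H] H(1) by blast
qed

lemma ex_minimal_subsp:
  assumes P: "P H0" and "\<And>H. P H \<Longrightarrow> subsp H"
  obtains H where "P H" "H \<subseteq> H0" "\<And>H'. P H' \<Longrightarrow> H' \<subseteq> H \<Longrightarrow> H' = H"
proof -
  let ?Q = "\<lambda>H. P H \<and> H \<subseteq> H0"
  obtain H where H: "?Q H" "\<And>y. ?Q y \<Longrightarrow> rank H \<le> rank y"
    using ex_has_least_nat[of ?Q H0 rank] P by blast
  have "H' = H" if "P H'" "H' \<subseteq> H" for H'
  proof (rule ccontr)
    assume "H' \<noteq> H"
    then have "rank H' < rank H" using that H assms by (intro rank_strict_mono) auto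
    moreover have "rank H \<le> rank H'" using H that by auto
    ultimately show False by simp
  qed
  then show ?thesis using that[of H] H(1) by blast
qed

lemma ex_maximal_subalgebra:
  assumes "subalg H" "H \<noteq> carrier L"
  obtains M where "maximal_subalgebra K L M" "H \<subseteq> M"
proof -
  obtain M where M: "subalg M \<and> M \<noteq> carrier L" "H \<subseteq> M"
    "\<And>H'. subalg H' \<and> H' \<noteq> carrier L \<Longrightarrow> M \<subseteq> H' \<Longrightarrow> H' = M"
    by (rule ex_maximal_subsp[of "\<lambda>H. subalg H \<and> H \<noteq> carrier L" H])
      (use assms subalg_subsp in auto)
  then have "maximal_subalgebra K L M" unfolding maximal_subalgebra_def by blast
  then show ?thesis using that M by blast
qed

lemma ex_chief_above:
  assumes "idl D" "idl Z" "D \<subset> Z" obtains D' where "chief D' D" "D' \<subseteq> Z"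
proof -
  obtain D' where D': "idl D' \<and> D \<subset> D' \<and> D' \<subseteq> Z"
    and min: "\<And>H'. idl H' \<and> D \<subset> H' \<and> H' \<subseteq> Z \<Longrightarrow> H' \<subseteq> D' \<Longrightarrow> H' = D'"
    by (rule ex_minimal_subsp[of "\<lambda>H. idl H \<and> D \<subset> H \<and> H \<subseteq> Z" Z])
      (use assms in \<open>auto simp: lie_ideal_def\<close>)
  have "J = D \<or> J = D'" if "idl J" "D \<subseteq> J" "J \<subseteq> D'" for J
    using min[of J] that D' by auto
  then have "chief D' D" unfolding chief_def using D' assms by simp
  then show ?thesis using that D' by blast
qed

end

section \<open>Nilpotency of adjoint maps and the Fitting decomposition\<close>

context lie_alg begin

abbreviation ad_pow :: "'a \<Rightarrow> nat \<Rightarrow> 'a \<Rightarrow> 'a" where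
  "ad_pow x n \<equiv> (\<lambda>y. x \<otimes> y) ^^ n"

lemma ad_pow_closed [simp]: "x \<in> carrier L \<Longrightarrow> y \<in> carrier L \<Longrightarrow> ad_pow x n y \<in> carrier L"
  by (induction n) auto

lemma ad_pow_add: "x \<in> carrier L \<Longrightarrow> y \<in> carrier L \<Longrightarrow> z \<in> carrier L \<Longrightarrow>
    ad_pow x n (y \<oplus> z) = ad_pow x n y \<oplus> ad_pow x n z"
  by (induction n) (auto simp: bracket_add_right)

lemma ad_pow_smult: "x \<in> carrier L \<Longrightarrow> y \<in> carrier L \<Longrightarrow> k \<in> carrier K \<Longrightarrow>
    ad_pow x n (k \<odot> y) = k \<odot> ad_pow x n y"
  by (induction n) (auto simp: bracket_smult_right)

lemma ad_pow_idl: "idl B \<Longrightarrow> x \<in> carrier L \<Longrightarrow> y \<in> B \<Longrightarrow> ad_pow x n y \<in> B"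
  by (induction n) (auto simp: idl_left)

lemma ad_pow_Suc_right: "ad_pow x (Suc n) y = ad_pow x n (x \<otimes> y)"
  by (induction n) auto

text \<open>Leibniz rule: when ad x is applied p + q times to a product, every term of the expansion
  applies it at least p times to y or at least q times to z. The induction moves one application
  inside, lowering p in one summand and q in the other.\<close>

lemma ad_pow_bracket:
  assumes B: "idl B" and cl: "x \<in> carrier L"
  shows "y \<in> carrier L \<Longrightarrow> z \<in> carrier L \<Longrightarrow> ad_pow x p y \<in> B \<Longrightarrow> ad_pow x q z \<in> B \<Longrightarrow>
    ad_pow x (p + q) (y \<otimes> z) \<in> B"
proof (induction "p + q" arbitrary: p q y z)
  case 0
  then show ?case using B idl_left by simp
next
  case (Suc k)
  show ?case
  proof (cases "p = 0 \<or> q = 0")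
    case True
    then have "y \<in> B \<or> z \<in> B" using Suc.prems by auto
    then have "y \<otimes> z \<in> B" using idl_left[OF B Suc.prems(1)] idl_right[OF B Suc.prems(2)] by auto
    then show ?thesis using ad_pow_idl B cl by blast
  next
    case False
    then obtain p' q' where pq: "p = Suc p'" "q = Suc q'" by (meson not0_implies_Suc)
    have k: "k = p' + q" "k = p + q'" using Suc(2) pq by auto
    have "ad_pow x k ((x \<otimes> y) \<otimes> z) \<in> B" unfolding k(1)
      by (rule Suc.hyps(1)[OF k(1)]) (use Suc.prems cl in \<open>simp_all only: pq(1) ad_pow_Suc_right bracket_closed\<close>)
    moreover have "ad_pow x k (y \<otimes> (x \<otimes> z)) \<in> B" unfolding k(2)
      by (rule Suc.hyps(1)[OF k(2)]) (use Suc.prems cl in \<open>simp_all only: pq(2) ad_pow_Suc_right bracket_closed\<close>)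
    moreover have "ad_pow x (p + q) (y \<otimes> z) = ad_pow x k (x \<otimes> (y \<otimes> z))"
      unfolding Suc(2)[symmetric] ad_pow_Suc_right ..
    moreover have "ad_pow x k (x \<otimes> (y \<otimes> z)) = ad_pow x k ((x \<otimes> y) \<otimes> z) \<oplus> ad_pow x k (y \<otimes> (x \<otimes> z))"
      unfolding jacobi_left[OF cl Suc.prems(1,2)] using Suc.prems cl by (simp add: ad_pow_add)
    ultimately show ?thesis using subsp_add[OF idl_subsp[OF B]] by simp
  qed
qed

text \<open>The set is the Fitting null component of ad x acting on L/B. Closure under the bracket
  is the estimate of \<open>ad_pow_bracket\<close>.\<close>

lemma subalg_fitting_null:
  assumes B: "idl B" and x: "x \<in> carrier L"
  shows "subalg {y \<in> carrier L. \<exists>n. ad_pow x n y \<in> B}"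
proof -
  have up: "ad_pow x (n + m) y \<in> B" if "ad_pow x n y \<in> B" for n m y
    using ad_pow_idl[OF B x that, of m] by (simp add: add.commute[of n m] funpow_add)
  have sB: "subsp B" using B idl_subsp by blast
  show ?thesis
  proof (intro subalgI subspI)
    show "\<zero> \<in> {y \<in> carrier L. \<exists>n. ad_pow x n y \<in> B}"
      using subsp_zero[OF sB] by (auto intro!: exI[of _ 0])
  next
    fix a b assume "a \<in> {y \<in> carrier L. \<exists>n. ad_pow x n y \<in> B}" "b \<in> {y \<in> carrier L. \<exists>n. ad_pow x n y \<in> B}"
    then obtain n m where nm: "a \<in> carrier L" "b \<in> carrier L" "ad_pow x n a \<in> B" "ad_pow x m b \<in> B" by blast
    have "ad_pow x (n + m) (a \<oplus> b) \<in> B"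
      using up[OF nm(3), of m] up[OF nm(4), of n] subsp_add[OF sB]
      by (simp add: ad_pow_add[OF x nm(1,2)] add.commute)
    then show "a \<oplus> b \<in> {y \<in> carrier L. \<exists>n. ad_pow x n y \<in> B}" using nm by auto
    show "a \<otimes> b \<in> {y \<in> carrier L. \<exists>n. ad_pow x n y \<in> B}"
      using ad_pow_bracket[OF B x nm(1,2,3,4)] nm by auto
  next
    fix k a assume "k \<in> carrier K" "a \<in> {y \<in> carrier L. \<exists>n. ad_pow x n y \<in> B}"
    then show "k \<odot> a \<in> {y \<in> carrier L. \<exists>n. ad_pow x n y \<in> B}"
      using x subsp_smult[OF sB] by (auto simp: ad_pow_smult)
  qed auto
qed

end

context fd_lie_alg begin

text \<open>L/B is the sum of the null component and the stable image of ad x, and this image lies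
  in A because x does.\<close>

lemma fitting_decomposition:
  assumes A: "idl A" and B: "idl B" and x: "x \<in> A"
  shows "A \<boxplus> {y \<in> carrier L. \<exists>n. ad_pow x n y \<in> B} = carrier L"
proof -
  have xc: "x \<in> carrier L" using A x idl_subsp subsp_closed by blast
  define P where "P n = ad_pow x n ` carrier L \<boxplus> B" for n
  have sub_im: "subsp (ad_pow x n ` carrier L)" for n
  proof (rule subspI)
    show "\<zero> \<in> ad_pow x n ` carrier L"
      using ad_pow_idl[OF idl_triv xc] by (metis M.zero_closed imageI singletonD singletonI)
  next
    fix a b assume "a \<in> ad_pow x n ` carrier L" "b \<in> ad_pow x n ` carrier L"
    then show "a \<oplus> b \<in> ad_pow x n ` carrier L"
      using ad_pow_add[OF xc] M.a_closed by (smt (verit) imageE image_eqI)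
  next
    fix k a assume "k \<in> carrier K" "a \<in> ad_pow x n ` carrier L"
    then show "k \<odot> a \<in> ad_pow x n ` carrier L"
      using ad_pow_smult[OF xc] smult_closed by (smt (verit) imageE image_eqI)
  qed (use xc in auto)
  have sP: "subsp (P n)" for n unfolding P_def using sub_im B idl_subsp subsp_sum by blast
  have dec: "P (n + m) \<subseteq> P n" for n m
  proof -
    have "ad_pow x (n + m) ` carrier L \<subseteq> ad_pow x n ` carrier L"
      using xc by (auto simp: funpow_add)
    then show ?thesis unfolding P_def by (rule sum_mono) simp
  qed
  obtain n0 where n0: "\<And>m. rank (P n0) \<le> rank (P m)"
    using ex_has_least_nat[of "\<lambda>_. True" undefined "\<lambda>n. rank (P n)"] by blast
  have stable: "P (n0 + m) = P n0" for m
    using dec[of n0 m] n0[of "n0 + m"] rank_strict_mono[OF sP sP, of "n0 + m" n0] by fastforce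
  \<comment> \<open>The successor makes k positive, so that the k-th power of ad x maps L into the
    ideal A; the images are already stable at k, hence equal at k and 2k.\<close>
  define k where "k = Suc n0"
  have k: "P k = P (k + k)" using stable[of 1] stable[of "Suc k"] unfolding k_def by simp
  have "y \<in> A \<boxplus> {y \<in> carrier L. \<exists>n. ad_pow x n y \<in> B}" if y: "y \<in> carrier L" for y
  proof -
    have "ad_pow x k y \<in> P k" unfolding P_def
      using y sum_upper1[OF sub_im idl_subsp[OF B]] by blast
    then obtain z b where z: "z \<in> carrier L" "b \<in> B" "ad_pow x k y = ad_pow x (k + k) z \<oplus> b"
      unfolding k by (auto simp: P_def mem_sum)
    \<comment> \<open>The k-th power of ad x takes y and w to the same element modulo B, so y - w
      lies in the null component.\<close>
    define w where "w = ad_pow x k z"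
    have w: "w \<in> carrier L" using z xc by (simp add: w_def)
    have "w \<in> A" unfolding w_def k_def using A x z xc by (simp add: idl_right)
    have bc: "b \<in> carrier L" using z B idl_subsp subsp_closed by blast
    have "ad_pow x k (\<ominus> w) = \<ominus> ad_pow x k w"
      using ad_pow_add[OF xc w, of "\<ominus> w" k] w xc ad_pow_idl[OF idl_triv xc, of \<zero> k]
      by (metis M.a_inv_closed M.a_comm M.minus_equality M.r_neg ad_pow_closed singletonD singletonI)
    then have "ad_pow x k (y \<ominus> w) = ad_pow x k y \<ominus> ad_pow x k w"
      using y w xc by (simp add: M.minus_eq ad_pow_add)
    also have "\<dots> = b" using z bc xc w by (simp add: w_def funpow_add lin_simps)
    finally have "y \<ominus> w \<in> {y \<in> carrier L. \<exists>n. ad_pow x n y \<in> B}" using z y w by auto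
    moreover have "y = w \<oplus> (y \<ominus> w)" using y w by (simp add: lin_simps)
    ultimately show ?thesis using \<open>w \<in> A\<close> unfolding mem_sum by blast
  qed
  moreover have "A \<boxplus> {y \<in> carrier L. \<exists>n. ad_pow x n y \<in> B} \<subseteq> carrier L"
    using A idl_subsp subsp_subset by (intro sum_least carrier_is_submodule) auto
  ultimately show ?thesis by blast
qed

text \<open>Engel's theorem for the action of \<open>T\<close> on \<open>V/W\<close>, everything taken inside \<open>L\<close>: a maximal
  proper subalgebra of \<open>T\<close> has codimension one, because by induction it kills a vector of \<open>T\<close>
  modulo itself.\<close>

lemma engel:
  assumes B: "idl B"
  shows "subalg T \<Longrightarrow> B \<subseteq> T \<Longrightarrow> (\<And>x y. x \<in> T \<Longrightarrow> y \<in> carrier L \<Longrightarrow> \<exists>n. ad_pow x n y \<in> B) \<Longrightarrow>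
    subsp V \<Longrightarrow> subsp W \<Longrightarrow> B \<subseteq> W \<Longrightarrow> W \<subset> V \<Longrightarrow>
    (\<And>t v. t \<in> T \<Longrightarrow> v \<in> V \<Longrightarrow> t \<otimes> v \<in> V) \<Longrightarrow> (\<And>t v. t \<in> T \<Longrightarrow> v \<in> W \<Longrightarrow> t \<otimes> v \<in> W) \<Longrightarrow>
    \<exists>v \<in> V - W. \<forall>t\<in>T. t \<otimes> v \<in> W"
proof (induction "rank T" arbitrary: T V W rule: less_induct)
  case less
  note T = less.prems(1,2) and nil = less.prems(3) and V = less.prems(4) and W = less.prems(5,6,7)
    and TV = less.prems(8) and TW = less.prems(9)
  have cT: "t \<in> carrier L" if "t \<in> T" for t using that T subalg_subsp subsp_closed by blast
  have cV: "t \<in> carrier L" if "t \<in> V" for t using that V subsp_closed by blast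
  show ?case
  proof (cases "T = B")
    case True
    obtain v where v: "v \<in> V - W" using W by blast
    then have "t \<otimes> v \<in> W" if "t \<in> T" for t
      using idl_right[OF B cV[of v] that[unfolded True]] W(2) by blast
    then show ?thesis using v by blast
  next
    case False
    obtain T' where "subalg T' \<and> B \<subseteq> T' \<and> T' \<subset> T"
      and max: "\<And>H. subalg H \<and> B \<subseteq> H \<and> H \<subset> T \<Longrightarrow> T' \<subseteq> H \<Longrightarrow> H = T'"
      by (rule ex_maximal_subsp[of "\<lambda>H. subalg H \<and> B \<subseteq> H \<and> H \<subset> T" B])
        (use B T False idl_subalg subalg_subsp in auto)
    then have T': "subalg T'" "B \<subseteq> T'" "T' \<subset> T" by auto
    have r: "rank T' < rank T" by (rule rank_strict_mono) (use T' T in \<open>simp_all add: subalg_subsp\<close>)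
    have nil': "\<And>x y. x \<in> T' \<Longrightarrow> y \<in> carrier L \<Longrightarrow> \<exists>n. ad_pow x n y \<in> B"
      using nil T' by blast
    have "\<exists>v\<in>T - T'. \<forall>t\<in>T'. t \<otimes> v \<in> T'"
      by (rule less.hyps[OF r T'(1,2) nil' subalg_subsp[OF T(1)] subalg_subsp[OF T'(1)] T'(2,3)])
        (use subalg_bracket[OF T(1)] subalg_bracket[OF T'(1)] T'(3) in auto)
    then obtain y where y: "y \<in> T - T'" "\<forall>t\<in>T'. t \<otimes> y \<in> T'" by blast
    have yc: "y \<in> carrier L" using y cT by blast
    define T2 where "T2 = T' \<boxplus> lspan [y]"
    have sl: "subsp (lspan [y])" using yc by (intro subsp_lspan) auto
    have T2: "T2 = T"
    proof -
      have sT2: "subsp T2" unfolding T2_def using subsp_sum T' sl subalg_subsp by blast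
      have yT2: "y \<in> T2" using sum_upper2[OF subalg_subsp[OF T'(1)] sl] set_lspan[of "[y]"] yc
        by (auto simp: T2_def)
      have T'T2: "T' \<subseteq> T2" using sum_upper1[OF subalg_subsp[OF T'(1)] sl] by (simp add: T2_def)
      have "subalg T2"
      proof (rule subalgI[OF sT2])
        fix u v assume "u \<in> T2" "v \<in> T2"
        then obtain t k t' k' where *: "t \<in> T'" "k \<in> carrier K" "u = t \<oplus> k \<odot> y"
            "t' \<in> T'" "k' \<in> carrier K" "v = t' \<oplus> k' \<odot> y"
          unfolding T2_def mem_sum lspan_single[OF yc] by blast
        have tc: "t \<in> carrier L" "t' \<in> carrier L" using *(1,4) T'(3) cT by auto
        have yt: "y \<otimes> t' \<in> T'" using bracket_anti[OF yc tc(2)] y(2) *(4) subsp_neg[OF subalg_subsp[OF T'(1)]] by simp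
        have "u \<otimes> v = t \<otimes> t' \<oplus> (k' \<odot> (t \<otimes> y) \<oplus> k \<odot> (y \<otimes> t'))"
          using * tc yc by (simp add: bracket_add_left bracket_add_right bracket_smult_left bracket_smult_right bracket_self M.a_ac)
        moreover have "\<dots> \<in> T'" using * y(2) yt subalg_bracket[OF T'(1)]
          by (intro subsp_add subsp_smult subalg_subsp[OF T'(1)]) auto
        ultimately show "u \<otimes> v \<in> T2" using T'T2 by (simp add: subset_iff)
      qed
      moreover have "T2 \<subseteq> T"
        unfolding T2_def lspan_single[OF yc] using T' y subsp_smult[OF subalg_subsp[OF T(1)]]
        by (intro sum_least subalg_subsp[OF T(1)]) auto
      moreover have "T2 \<noteq> T'" using yT2 y by blast
      ultimately show ?thesis using max[of T2] T'T2 T' by blast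
    qed
    have "\<exists>v\<in>V - W. \<forall>t\<in>T'. t \<otimes> v \<in> W"
      by (rule less.hyps[OF r T'(1,2) nil' V W(1,2,3)]) (use TV TW T'(3) in auto)
    then obtain v0 where v0: "v0 \<in> V - W" "\<forall>t\<in>T'. t \<otimes> v0 \<in> W" by blast
    have yT: "y \<in> T" using y by blast
    \<comment> \<open>The vectors of V that T' sends into W are stable under y, because T' sends y
      into T' itself.\<close>
    have inv: "ad_pow y i v0 \<in> V \<and> (\<forall>t\<in>T'. t \<otimes> ad_pow y i v0 \<in> W)" for i
    proof (induction i)
      case 0 then show ?case using v0 by auto
    next
      case (Suc i)
      let ?v = "ad_pow y i v0"
      have v: "?v \<in> V" "?v \<in> carrier L" using Suc cV by auto
      have "t \<otimes> (y \<otimes> ?v) \<in> W" if t: "t \<in> T'" for t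
      proof -
        have tc: "t \<in> carrier L" using t T'(3) cT by auto
        have "t \<otimes> (y \<otimes> ?v) = (t \<otimes> y) \<otimes> ?v \<oplus> y \<otimes> (t \<otimes> ?v)" using jacobi_left tc yc v by blast
        moreover have "(t \<otimes> y) \<otimes> ?v \<in> W" "y \<otimes> (t \<otimes> ?v) \<in> W" using Suc t y(2) TW[OF yT] by auto
        ultimately show ?thesis using subsp_add[OF W(1)] by simp
      qed
      then show ?case using TV[OF yT] v by auto
    qed
    \<comment> \<open>As y acts nilpotently, there is a first power of ad y taking v0 into W. The
      vector one step earlier is outside W and is sent into W both by y and by T'.\<close>
    have "\<exists>N. ad_pow y N v0 \<in> W" using nil[OF yT cV[of v0]] v0(1) W(2) by auto
    then obtain n where n: "ad_pow y n v0 \<in> W" "\<And>m. m < n \<Longrightarrow> ad_pow y m v0 \<notin> W"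
      using exists_least_iff[of "\<lambda>n. ad_pow y n v0 \<in> W"] by auto
    then obtain m where m: "n = Suc m" using v0 by (cases n) auto
    define v where "v = ad_pow y m v0"
    have v: "v \<in> V - W" "\<And>t. t \<in> T' \<Longrightarrow> t \<otimes> v \<in> W" "y \<otimes> v \<in> W"
      using inv[of m] n m by (auto simp: v_def)
    have "t \<otimes> v \<in> W" if "t \<in> T" for t
    proof -
      have "t \<in> T2" using that T2 by simp
      then obtain t' k where *: "t' \<in> T'" "k \<in> carrier K" "t = t' \<oplus> k \<odot> y"
        unfolding T2_def mem_sum lspan_single[OF yc] by blast
      moreover have "v \<in> carrier L" "t' \<in> carrier L" using v(1) cV T'(3) cT *(1) by auto
      ultimately have "t \<otimes> v = t' \<otimes> v \<oplus> k \<odot> (y \<otimes> v)"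
        using yc by (simp add: bracket_add_left bracket_smult_left)
      then show ?thesis using v * subsp_add[OF W(1)] subsp_smult[OF W(1)] by simp
    qed
    then show ?thesis using v(1) by blast
  qed
qed

text \<open>Otherwise every maximal subalgebra containing B contains A. If the Fitting null
  component of some x in A were proper, it would lie in such a subalgebra, although its sum with A
  is L. So A acts nilpotently on L/B, and Engel's theorem gives A/B a nonzero centre, which by
  minimality is all of A/B.\<close>

lemma nonabelian_max_supplemented:
  assumes ch: "chief A B" and na: "\<not> abelian_factor A B"
  obtains M where "maximal_subalgebra K L M" "B \<subseteq> M" "A \<boxplus> M = carrier L"
proof (rule ccontr)
  assume contra: "\<not> thesis"
  note witness = that
  have A: "idl A" and B: "idl B" and BA: "B \<subset> A" using ch by (auto simp: chief_def)
  have sA: "subsp A" using A idl_subsp by blast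
  have inc: "A \<subseteq> M" if M: "maximal_subalgebra K L M" "B \<subseteq> M" for M
  proof (rule ccontr)
    assume "\<not> A \<subseteq> M"
    have sM: "subalg M" "subsp M" using M(1) by (simp_all add: maximal_subalgebra_def lie_subalgebra_def)
    have "A \<boxplus> M = M \<or> A \<boxplus> M = carrier L"
      using M(1) subalg_sum[OF A sM(1)] sum_upper2[OF sA sM(2)] by (simp add: maximal_subalgebra_def)
    then have "A \<boxplus> M = carrier L" using \<open>\<not> A \<subseteq> M\<close> sum_upper1[OF sA sM(2)] by auto
    with witness[OF M] contra show False by simp
  qed
  have nil: "\<exists>n. ad_pow x n y \<in> B" if x: "x \<in> A" and y: "y \<in> carrier L" for x y
  proof -
    have xc: "x \<in> carrier L" using x sA subsp_closed by blast
    let ?E = "{y \<in> carrier L. \<exists>n. ad_pow x n y \<in> B}"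
    have E: "subalg ?E" using subalg_fitting_null[OF B xc] .
    have BE: "B \<subseteq> ?E" using subsp_subset[OF idl_subsp[OF B]] by (auto intro!: exI[of _ 0])
    have "?E = carrier L"
    proof (rule ccontr)
      assume "?E \<noteq> carrier L"
      then obtain M where M: "maximal_subalgebra K L M" "?E \<subseteq> M" by (rule ex_maximal_subalgebra[OF E])
      then have sM: "subsp M" "M \<noteq> carrier L" by (simp_all add: maximal_subalgebra_def lie_subalgebra_def)
      have "A \<subseteq> M" by (rule inc[OF M(1)]) (rule subset_trans[OF BE M(2)])
      from sum_least[OF sM(1) this M(2)] have "carrier L \<subseteq> M"
        unfolding fitting_decomposition[OF A B x] .
      then show False using sM subsp_subset[OF sM(1)] by simp
    qed
    then show ?thesis using y by blast
  qed
  obtain v where v: "v \<in> A - B" "\<forall>t\<in>A. t \<otimes> v \<in> B"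
  proof -
    have "\<exists>v\<in>A - B. \<forall>t\<in>A. t \<otimes> v \<in> B"
      by (rule engel[OF B idl_subalg[OF A] _ nil sA idl_subsp[OF B] subset_refl BA])
        (use BA in \<open>auto intro: idl_left[OF A] idl_left[OF B] subsp_closed[OF sA]\<close>)
    then show thesis using that by blast
  qed
  \<comment> \<open>The centre of A/B, pulled back to A. It is an ideal of L because A and B
    are.\<close>
  define C where "C = {v \<in> A. \<forall>t\<in>A. t \<otimes> v \<in> B}"
  have Ac: "a \<in> carrier L" if "a \<in> A" for a using that sA subsp_closed by blast
  have "idl C"
  proof (intro idlI subspI)
    fix x c assume x: "x \<in> carrier L" and c: "c \<in> C"
    have "t \<otimes> (x \<otimes> c) \<in> B" if t: "t \<in> A" for t
    proof -
      have "t \<otimes> (x \<otimes> c) = (t \<otimes> x) \<otimes> c \<oplus> x \<otimes> (t \<otimes> c)"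
        using c by (intro jacobi_left Ac t x) (simp add: C_def)
      moreover have "t \<otimes> x \<in> A" using idl_right[OF A x t] .
      ultimately show ?thesis using c t subsp_add[OF idl_subsp[OF B]] idl_left[OF B x] by (simp add: C_def)
    qed
    then show "x \<otimes> c \<in> C" using c idl_left[OF A x] by (simp add: C_def)
  qed (use Ac in \<open>auto simp: C_def bracket_add_right bracket_smult_right
      subsp_simps[OF sA] subsp_simps[OF idl_subsp[OF B]]\<close>)
  moreover have "B \<subseteq> C" using BA idl_left[OF B Ac] by (auto simp: C_def)
  moreover have "C \<subseteq> A" "C \<noteq> B" using v by (auto simp: C_def)
  ultimately have "C = A" using chiefD[OF ch] by metis
  then show False using na unfolding abelian_factor_def C_def by blast
qed

end

section \<open>Abelian chief factors\<close>

context lie_alg begin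

lemma chief_subsp: "chief A B \<Longrightarrow> subsp A" "chief A B \<Longrightarrow> subsp B"
  using chief_idl idl_subsp by blast+

definition compl :: "'a set \<Rightarrow> 'a set \<Rightarrow> 'a set \<Rightarrow> bool" where
  "compl A B M \<longleftrightarrow> subalg M \<and> A \<boxplus> M = carrier L \<and> A \<inter> M = B"

definition complemented :: "'a set \<Rightarrow> 'a set \<Rightarrow> bool" where
  "complemented A B \<longleftrightarrow> (\<exists>M. compl A B M)"

text \<open>The second isomorphism theorem for (B + C)/B and C/(B \<inter> C), phrased for intervals
  of ideals: J \<mapsto> B + J and J \<mapsto> C \<inter> J are inverse to each other by the modular
  law.\<close>

lemma chief_transfer:
  assumes B: "idl B" and C: "idl C"
  shows "chief (B \<boxplus> C) B \<longleftrightarrow> chief C (B \<inter> C)"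
proof
  note s = idl_subsp[OF B] idl_subsp[OF C]
  assume ch: "chief (B \<boxplus> C) B"
  show "chief C (B \<inter> C)" unfolding chief_def
  proof (intro conjI allI impI)
    have "\<not> C \<subseteq> B" using chief_idl(3)[OF ch] sum_least[OF s(1) subset_refl, of C] by auto
    then show "B \<inter> C \<subset> C" by blast
  next
    fix J assume J: "idl J \<and> B \<inter> C \<subseteq> J \<and> J \<subseteq> C"
    then have sJ: "subsp J" using idl_subsp by blast
    have "B \<boxplus> J = B \<or> B \<boxplus> J = B \<boxplus> C"
      by (rule chiefD[OF ch]) (use J B idl_sum sum_upper1[OF s(1) sJ] sum_mono[of B B J C] in auto)
    then show "J = B \<inter> C \<or> J = C"
    proof
      assume "B \<boxplus> J = B"
      then have "J \<subseteq> B" using sum_upper2[OF s(1) sJ] by simp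
      then show ?thesis using J by auto
    next
      assume "B \<boxplus> J = B \<boxplus> C"
      then have "C = (J \<boxplus> B) \<inter> C" using sum_upper2[OF s] sum_comm[OF s(1) sJ] by auto
      also have "\<dots> = J \<boxplus> (B \<inter> C)" by (rule modular) (use s sJ J in auto)
      also have "\<dots> = J" by (rule sum_absorb) (use s sJ J subsp_Int in auto)
      finally show ?thesis by simp
    qed
  qed (use B C idl_Int in auto)
next
  note s = idl_subsp[OF B] idl_subsp[OF C]
  assume ch: "chief C (B \<inter> C)"
  show "chief (B \<boxplus> C) B" unfolding chief_def
  proof (intro conjI allI impI)
    have "\<not> C \<subseteq> B" using chief_idl(3)[OF ch] by blast
    then show "B \<subset> B \<boxplus> C" using sum_upper1[OF s] sum_upper2[OF s] by auto
  next
    fix J assume J: "idl J \<and> B \<subseteq> J \<and> J \<subseteq> B \<boxplus> C"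
    then have sJ: "subsp J" using idl_subsp by blast
    have JC: "J = B \<boxplus> (C \<inter> J)" using modular[OF s sJ] J by auto
    have "C \<inter> J = B \<inter> C \<or> C \<inter> J = C" by (rule chiefD[OF ch]) (use J C idl_Int in auto)
    then show "J = B \<or> J = B \<boxplus> C"
    proof
      assume "C \<inter> J = B \<inter> C"
      then show ?thesis using JC sum_absorb[OF s(1) subsp_Int[OF s]] by simp
    next
      assume "C \<inter> J = C"
      then show ?thesis using JC by simp
    qed
  qed (use B C idl_sum in auto)
qed

lemma abelian_factor_transfer:
  assumes B: "idl B" and C: "idl C"
  shows "abelian_factor (B \<boxplus> C) B \<longleftrightarrow> abelian_factor C (B \<inter> C)"
proof
  note s = idl_subsp[OF B] idl_subsp[OF C]
  assume "abelian_factor (B \<boxplus> C) B"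
  then show "abelian_factor C (B \<inter> C)"
    using sum_upper2[OF s] subalg_bracket[OF idl_subalg[OF C]] unfolding abelian_factor_def by blast
next
  note s = idl_subsp[OF B] idl_subsp[OF C]
  assume ab: "abelian_factor C (B \<inter> C)"
  show "abelian_factor (B \<boxplus> C) B" unfolding abelian_factor_def
  proof (intro ballI)
    fix x y assume "x \<in> B \<boxplus> C" "y \<in> B \<boxplus> C"
    then obtain b c b' c' where *: "b \<in> B" "c \<in> C" "x = b \<oplus> c" "b' \<in> B" "c' \<in> C" "y = b' \<oplus> c'"
      unfolding mem_sum by blast
    note cl = subsp_closed[OF s(1) *(1)] subsp_closed[OF s(2) *(2)] subsp_closed[OF s(1) *(4)]
      subsp_closed[OF s(2) *(5)]
    have "x \<otimes> y = b \<otimes> y \<oplus> (c \<otimes> b' \<oplus> c \<otimes> c')"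
      using * cl by (simp add: bracket_add_left bracket_add_right M.a_ac)
    moreover have "c \<otimes> c' \<in> B" using ab * unfolding abelian_factor_def by blast
    moreover have "b \<otimes> y \<in> B" "c \<otimes> b' \<in> B" using * cl idl_left[OF B] idl_right[OF B] by simp_all
    ultimately show "x \<otimes> y \<in> B" using subsp_add[OF s(1)] by simp
  qed
qed

lemma centralizer_transfer:
  assumes B: "idl B" and C: "idl C"
  shows "centralizer (B \<boxplus> C) B = centralizer C (B \<inter> C)"
proof
  note s = idl_subsp[OF B] idl_subsp[OF C]
  show "centralizer (B \<boxplus> C) B \<subseteq> centralizer C (B \<inter> C)"
    using sum_upper2[OF s] idl_left[OF C] unfolding centralizer_def by blast
  show "centralizer C (B \<inter> C) \<subseteq> centralizer (B \<boxplus> C) B"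
  proof
    fix x assume x: "x \<in> centralizer C (B \<inter> C)"
    then have xc: "x \<in> carrier L" by (simp add: centralizer_def)
    have "x \<otimes> y \<in> B" if y: "y \<in> B \<boxplus> C" for y
    proof -
      obtain b c where *: "b \<in> B" "c \<in> C" "y = b \<oplus> c" using y unfolding mem_sum by blast
      note cl = subsp_closed[OF s(1) *(1)] subsp_closed[OF s(2) *(2)]
      have "x \<otimes> y = x \<otimes> b \<oplus> x \<otimes> c" using * cl xc by (simp add: bracket_add_right)
      moreover have "x \<otimes> c \<in> B" using x * by (simp add: centralizer_def)
      ultimately show ?thesis using * xc idl_left[OF B] subsp_add[OF s(1)] by simp
    qed
    then show "x \<in> centralizer (B \<boxplus> C) B" using xc by (simp add: centralizer_def)
  qed
qed

lemma idl_centralizer: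
  assumes A: "idl A" and B: "idl B" shows "idl (centralizer A B)"
proof -
  note s = idl_subsp[OF A] idl_subsp[OF B]
  have cl: "a \<in> carrier L" if "a \<in> A" for a using that s subsp_closed by blast
  show ?thesis
  proof (intro idlI subspI)
    show "centralizer A B \<subseteq> carrier L" by (auto simp: centralizer_def)
    show "\<zero> \<in> centralizer A B" using cl subsp_zero[OF s(2)] by (simp add: centralizer_def)
  next
    fix x y assume x: "x \<in> carrier L" and y: "y \<in> centralizer A B"
    then have yc: "y \<in> carrier L" by (simp add: centralizer_def)
    have "(x \<otimes> y) \<otimes> a \<in> B" if a: "a \<in> A" for a
    proof -
      have "(x \<otimes> y) \<otimes> a = x \<otimes> (y \<otimes> a) \<ominus> y \<otimes> (x \<otimes> a)" using jacobi_comm[OF x yc cl[OF a]] .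
      moreover have "y \<otimes> a \<in> B" "y \<otimes> (x \<otimes> a) \<in> B"
        using y a idl_left[OF A x a] by (simp_all add: centralizer_def)
      ultimately show ?thesis using idl_left[OF B x] subsp_minus[OF s(2)] by simp
    qed
    then show "x \<otimes> y \<in> centralizer A B" using x yc by (simp add: centralizer_def)
  qed (use cl subsp_add[OF s(2)] subsp_smult[OF s(2)] in
      \<open>auto simp: centralizer_def bracket_add_left bracket_smult_left\<close>)
qed

text \<open>A complement of (B + C)/B contains B, so the same subalgebra complements the lower
  factor. The converse fails in general, and this is where two chief series can differ.\<close>

lemma compl_transfer:
  assumes B: "idl B" and C: "idl C" and M: "compl (B \<boxplus> C) B M"
  shows "compl C (B \<inter> C) M"
proof -
  note s = idl_subsp[OF B] idl_subsp[OF C]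
  have M': "subalg M" "(B \<boxplus> C) \<boxplus> M = carrier L" "(B \<boxplus> C) \<inter> M = B" using M by (auto simp: compl_def)
  have sM: "subsp M" using M'(1) subalg_subsp by blast
  have BM: "B \<subseteq> M" using M'(3) by blast
  have "(B \<boxplus> C) \<boxplus> M = C \<boxplus> (B \<boxplus> M)" using sum_comm[OF s] sum_assoc[OF s(2,1) sM] by simp
  also have "B \<boxplus> M = M" using sum_absorb[OF sM s(1) BM] sum_comm[OF s(1) sM] by simp
  finally have "C \<boxplus> M = carrier L" using M'(2) by simp
  moreover have "C \<inter> M = B \<inter> C" using M'(3) BM sum_upper2[OF s] by blast
  ultimately show ?thesis using M'(1) by (simp add: compl_def)
qed

lemma complemented_transfer:
  "idl B \<Longrightarrow> idl C \<Longrightarrow> complemented (B \<boxplus> C) B \<Longrightarrow> complemented C (B \<inter> C)"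
  using compl_transfer unfolding complemented_def by metis

text \<open>In L = A + M, the summand M preserves A \<inter> M, and A maps it into B because the
  factor is abelian.\<close>

lemma compl_supplement_abelian:
  assumes A: "idl A" and ab: "abelian_factor A B" and M: "subalg M" "A \<boxplus> M = carrier L" "B \<subseteq> M" "B \<subseteq> A"
  shows "idl (A \<inter> M)"
proof (rule idlI)
  note s = idl_subsp[OF A] subalg_subsp[OF M(1)]
  show "subsp (A \<inter> M)" using subsp_Int[OF s] .
  fix x y assume "x \<in> carrier L" and y: "y \<in> A \<inter> M"
  then obtain a m where x: "a \<in> A" "m \<in> M" "x = a \<oplus> m" unfolding M(2)[symmetric] mem_sum by blast
  note cl = subsp_closed[OF s(1) x(1)] subsp_closed[OF s(2) x(2)]
  have yc: "y \<in> carrier L" using y s(2) subsp_closed by blast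
  have "x \<otimes> y = a \<otimes> y \<oplus> m \<otimes> y" using cl yc x by (simp add: bracket_add_left)
  moreover have "a \<otimes> y \<in> A \<inter> M" using ab x y M(3,4) unfolding abelian_factor_def by blast
  moreover have "m \<otimes> y \<in> A \<inter> M" using x y idl_left[OF A cl(2)] subalg_bracket[OF M(1)] by blast
  ultimately show "x \<otimes> y \<in> A \<inter> M" using subsp_add[OF subsp_Int[OF s]] by simp
qed

text \<open>A \<inter> M is an ideal between B and A, and it is not A because M is proper.\<close>

lemma abelian_supplement_compl:
  assumes ch: "chief A B" and ab: "abelian_factor A B" and M: "subalg M" "A \<boxplus> M = carrier L" "B \<subseteq> M"
    and MA: "M \<noteq> carrier L"
  shows "compl A B M"
proof -
  note i = chief_idl[OF ch]
  have sM: "subsp M" using M(1) subalg_subsp by blast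
  have "\<not> A \<subseteq> M" using sum_least[OF sM _ subset_refl, of A] M(2) MA subsp_subset[OF sM] by auto
  moreover have "A \<inter> M = B \<or> A \<inter> M = A"
    by (rule chiefD[OF ch compl_supplement_abelian[OF i(1) ab M]]) (use i(3) M(3) in auto)
  ultimately show ?thesis using M by (auto simp: compl_def)
qed

text \<open>A subalgebra H above M equals M + (A \<inter> H) by the modular law, and A \<inter> H is
  an ideal between B and A, which leaves only the two extreme cases.\<close>

lemma abelian_compl_maximal:
  assumes ch: "chief A B" and ab: "abelian_factor A B" and M: "compl A B M"
  shows "maximal_subalgebra K L M"
proof -
  note i = chief_idl[OF ch]
  have M': "subalg M" "A \<boxplus> M = carrier L" "A \<inter> M = B" using M by (auto simp: compl_def)
  note s = idl_subsp[OF i(1)] subalg_subsp[OF M'(1)]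
  have neq: "M \<noteq> carrier L" using M'(3) i(3) subsp_subset[OF s(1)] by auto
  have "H = M \<or> H = carrier L" if H: "subalg H" "M \<subseteq> H" for H
  proof -
    have sH: "subsp H" using H(1) subalg_subsp by blast
    have AH: "A \<boxplus> H = carrier L"
      using sum_mono[OF subset_refl H(2), of A] M'(2) subsp_subset[OF subsp_sum[OF s(1) sH]] by auto
    have eq: "H = M \<boxplus> (A \<inter> H)"
    proof -
      have "H = (M \<boxplus> A) \<inter> H" using sum_comm[OF s] M'(2) subsp_subset[OF sH] by auto
      then show ?thesis using modular[OF s(2,1) sH H(2)] by simp
    qed
    have BH: "B \<subseteq> H" using M'(3) H(2) by blast
    have "A \<inter> H = B \<or> A \<inter> H = A"
      by (rule chiefD[OF ch compl_supplement_abelian[OF i(1) ab H(1) AH BH]]) (use i(3) BH in auto)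
    then show ?thesis
    proof
      assume "A \<inter> H = B"
      then have "H = M" using eq sum_absorb[OF s(2) idl_subsp[OF i(2)]] M'(3) by auto
      then show ?thesis ..
    next
      assume "A \<inter> H = A"
      then have "H = carrier L" using eq sum_comm[OF s] M'(2) by simp
      then show ?thesis ..
    qed
  qed
  then show ?thesis using M'(1) neq by (simp add: maximal_subalgebra_def)
qed

lemma maximal_sum_ideal:
  assumes M: "maximal_subalgebra K L M" and V: "idl V" and VM: "\<not> V \<subseteq> M"
  shows "V \<boxplus> M = carrier L"
proof -
  have sM: "subalg M" "subsp M" using M by (simp_all add: maximal_subalgebra_def lie_subalgebra_def)
  note sV = idl_subsp[OF V]
  have "V \<boxplus> M = M \<or> V \<boxplus> M = carrier L"
    using M subalg_sum[OF V sM(1)] sum_upper2[OF sV sM(2)] by (simp add: maximal_subalgebra_def)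
  then show ?thesis using VM sum_upper1[OF sV sM(2)] by auto
qed

text \<open>The abelian case of an \<open>m\<close>-crossing: a complement of \<open>U/W\<close> would meet the complement of
  \<open>W/X\<close> in a complement of \<open>U/X\<close>, and this would yield a complement of \<open>U/V\<close>.\<close>

lemma abelian_crossing:
  assumes V: "chief V (V \<inter> W)" and W: "chief W (V \<inter> W)"
    and ab: "abelian_factor W (V \<inter> W)" and cW: "complemented W (V \<inter> W)"
    and ncU: "\<not> complemented (V \<boxplus> W) V"
  shows "abelian_factor V (V \<inter> W) \<and> complemented V (V \<inter> W) \<and> \<not> complemented (V \<boxplus> W) W"
proof -
  let ?X = "V \<inter> W" and ?U = "V \<boxplus> W"
  note iV = chief_idl(1)[OF V] and iW = chief_idl(1)[OF W]
  note sV = idl_subsp[OF iV] and sW = idl_subsp[OF iW]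
  note sX = subsp_Int[OF sV sW] and sU = subsp_sum[OF sV sW]
  obtain M where M: "compl W ?X M" using cW by (auto simp: complemented_def)
  have M': "subalg M" "W \<boxplus> M = carrier L" "W \<inter> M = ?X" using M by (auto simp: compl_def)
  have sM: "subsp M" using M'(1) subalg_subsp by blast
  have max: "maximal_subalgebra K L M" using abelian_compl_maximal[OF W ab M] .
  have XM: "?X \<subseteq> M" using M'(3) by blast
  \<comment> \<open>If V were inside M, then M itself would complement U/V.\<close>
  have VM: "\<not> V \<subseteq> M"
  proof
    assume VM: "V \<subseteq> M"
    have "?U \<inter> M = V \<boxplus> ?X" using modular[OF sV sW sM VM] M'(3) by simp
    then have 1: "?U \<inter> M = V" using sum_absorb[OF sV sX] by auto
    have "carrier L \<subseteq> ?U \<boxplus> M" using sum_mono[OF sum_upper2[OF sV sW] subset_refl, of M] M'(2) by simp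
    then have "?U \<boxplus> M = carrier L" using subsp_subset[OF subsp_sum[OF sU sM]] by auto
    then show False using ncU 1 M'(1) unfolding complemented_def compl_def by blast
  qed
  have VML: "V \<boxplus> M = carrier L" by (rule maximal_sum_ideal[OF max iV VM])
  \<comment> \<open>The centralizer of W/X in M is an ideal of L = W + M: it sends W into X, hence
    into M, and M normalizes it.\<close>
  define T where "T = centralizer W ?X \<inter> M"
  have iC: "idl (centralizer W ?X)" by (rule idl_centralizer[OF iW idl_Int[OF iV iW]])
  note sC = idl_subsp[OF iC]
  have WC: "W \<subseteq> centralizer W ?X"
    using ab sW subsp_closed[OF sW] by (auto simp: centralizer_def abelian_factor_def)
  have VC: "V \<subseteq> centralizer W ?X"
  proof
    fix v assume v: "v \<in> V"
    note vc = subsp_closed[OF sV v]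
    have "v \<otimes> w \<in> ?X" if w: "w \<in> W" for w
      using idl_left[OF iW vc w] idl_right[OF iV subsp_closed[OF sW w] v] by simp
    then show "v \<in> centralizer W ?X" using vc by (simp add: centralizer_def)
  qed
  have XC: "?X \<subseteq> centralizer W ?X" using WC by blast
  have sT: "subsp T" unfolding T_def using subsp_Int[OF sC sM] .
  have iT: "idl T"
  proof (rule idlI[OF sT])
    fix x t assume x: "x \<in> carrier L" and t: "t \<in> T"
    obtain w m where xw: "w \<in> W" "m \<in> M" "x = w \<oplus> m" using x unfolding M'(2)[symmetric] mem_sum by blast
    note cl = subsp_closed[OF sW xw(1)] subsp_closed[OF sM xw(2)] subsp_closed[OF sT t]
    have "t \<otimes> w \<in> ?X" using t xw by (simp add: T_def centralizer_def)
    then have "w \<otimes> t \<in> ?X" using bracket_anti[OF cl(1,3)] subsp_neg[OF sX] by simp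
    then have "w \<otimes> t \<in> M" using XM by blast
    moreover have "m \<otimes> t \<in> M" using subalg_bracket[OF M'(1) xw(2)] t by (simp add: T_def)
    moreover have "x \<otimes> t = w \<otimes> t \<oplus> m \<otimes> t" using xw cl by (simp add: bracket_add_left)
    ultimately have "x \<otimes> t \<in> M" using subsp_add[OF sM] by simp
    then show "x \<otimes> t \<in> T" using idl_left[OF iC x] t by (simp add: T_def)
  qed
  have CT: "centralizer W ?X = W \<boxplus> T"
  proof -
    have "centralizer W ?X = (W \<boxplus> M) \<inter> centralizer W ?X" using M'(2) subsp_subset[OF sC] by auto
    also have "\<dots> = W \<boxplus> (M \<inter> centralizer W ?X)" by (rule modular[OF sW sM sC WC])
    finally show ?thesis by (simp add: T_def Int_commute)
  qed
  have "V \<inter> T = ?X \<or> V \<inter> T = V"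
    by (rule chiefD[OF V idl_Int[OF iV iT]]) (use XM XC in \<open>auto simp: T_def\<close>)
  moreover have "V \<inter> T \<noteq> V" using VM by (auto simp: T_def)
  ultimately have VT: "V \<inter> T = ?X" by simp
  \<comment> \<open>V centralizes W/X, so V \<subseteq> W + T. Brackets of V with W fall into V
    \<inter> W = X, and those with T into V \<inter> T = X.\<close>
  have abV: "abelian_factor V ?X" unfolding abelian_factor_def
  proof (intro ballI)
    fix x y assume x: "x \<in> V" and y: "y \<in> V"
    obtain w t where yw: "w \<in> W" "t \<in> T" "y = w \<oplus> t" using subsetD[OF VC y] unfolding CT mem_sum by blast
    note cl = subsp_closed[OF sV x] subsp_closed[OF sW yw(1)] subsp_closed[OF sT yw(2)]
    have "x \<otimes> w \<in> ?X" using idl_left[OF iW cl(1) yw(1)] idl_right[OF iV cl(2) x] by simp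
    moreover have "x \<otimes> t \<in> V \<inter> T" using idl_left[OF iT cl(1) yw(2)] idl_right[OF iV cl(3) x] by simp
    moreover have "x \<otimes> y = x \<otimes> w \<oplus> x \<otimes> t" using yw cl by (simp add: bracket_add_right)
    ultimately show "x \<otimes> y \<in> ?X" using VT subsp_add[OF sX] by simp
  qed
  have cV: "compl V ?X M"
    using abelian_supplement_compl[OF V abV M'(1) VML XM] max by (simp add: maximal_subalgebra_def)
  have "\<not> complemented ?U W"
  proof
    assume "complemented ?U W"
    then obtain M1 where "compl ?U W M1" by (auto simp: complemented_def)
    then have M1: "subalg M1" "?U \<boxplus> M1 = carrier L" "?U \<inter> M1 = W" by (auto simp: compl_def)
    have sM1: "subsp M1" using M1(1) subalg_subsp by blast
    have WM1: "W \<subseteq> M1" using M1(3) by blast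
    define D where "D = M \<inter> M1"
    have D: "subalg D" "subsp D" using subalg_Int[OF M'(1) M1(1)] subalg_subsp by (auto simp: D_def)
    have M1D: "M1 = W \<boxplus> D"
    proof -
      have "M1 = (W \<boxplus> M) \<inter> M1" using M'(2) subsp_subset[OF sM1] by auto
      then show ?thesis using modular[OF sW sM sM1 WM1] by (simp add: D_def)
    qed
    have UD: "?U \<inter> D = ?X"
    proof -
      have "?U \<inter> D = W \<inter> M" using M1(3) by (auto simp: D_def)
      then show ?thesis using M'(3) by simp
    qed
    define H where "H = V \<boxplus> D"
    have "?U \<boxplus> H = carrier L"
    proof -
      have "carrier L = ?U \<boxplus> (W \<boxplus> D)" using M1(2) M1D by simp
      also have "\<dots> = (?U \<boxplus> W) \<boxplus> D" using sum_assoc[OF sU sW D(2)] by simp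
      also have "?U \<boxplus> W = ?U" using sum_absorb[OF sU sW sum_upper2[OF sV sW]] .
      finally have "carrier L \<subseteq> ?U \<boxplus> H"
        using sum_mono[OF subset_refl sum_upper2[OF sV D(2)], of ?U] by (simp add: H_def)
      then show ?thesis using subsp_subset[OF subsp_sum[OF sU subsp_sum[OF sV D(2)]]] by (auto simp: H_def)
    qed
    moreover have "?U \<inter> H = V"
    proof -
      have "?U \<inter> H = (V \<boxplus> D) \<inter> ?U" by (auto simp: H_def)
      also have "\<dots> = V \<boxplus> (D \<inter> ?U)" by (rule modular[OF sV D(2) sU sum_upper1[OF sV sW]])
      also have "\<dots> = V" using UD sum_absorb[OF sV sX] by (simp add: Int_commute)
      finally show ?thesis .
    qed
    moreover have "subalg H" unfolding H_def using subalg_sum[OF iV D(1)] .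
    ultimately show False using ncU unfolding complemented_def compl_def by blast
  qed
  then show ?thesis using abV cV by (auto simp: complemented_def)
qed

section \<open>The number of complemented abelian chief factors\<close>

definition abelian_complemented :: "'a set \<Rightarrow> 'a set \<Rightarrow> nat" where
  "abelian_complemented A B = (if abelian_factor A B \<and> complemented A B then 1 else 0)"

lemma chief_diamond:
  assumes V: "chief U V" and W: "chief U W" and ne: "V \<noteq> W"
  shows "V \<boxplus> W = U" "chief V (V \<inter> W)" "chief W (V \<inter> W)"
proof -
  note i = chief_idl[OF V] chief_idl[OF W]
  note s = idl_subsp[OF i(2)] idl_subsp[OF i(5)]
  have "V \<boxplus> W = V \<or> V \<boxplus> W = U"
    by (rule chiefD[OF V idl_sum[OF i(2,5)] sum_upper1[OF s]])
      (rule sum_least[OF idl_subsp[OF i(1)]], use i in auto)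
  moreover have "V \<boxplus> W \<noteq> V"
  proof
    assume "V \<boxplus> W = V"
    then have "W \<subseteq> V" using sum_upper2[OF s] by simp
    then show False using chiefD[OF W i(2)] i ne by auto
  qed
  ultimately show U: "V \<boxplus> W = U" by simp
  show "chief W (V \<inter> W)" using chief_transfer[OF i(2,5)] V U by simp
  have "chief (W \<boxplus> V) W" using W U sum_comm[OF s] by simp
  then show "chief V (V \<inter> W)" using chief_transfer[OF i(5,2)] by (simp add: Int_commute)
qed

text \<open>U/V and W/(V \<inter> W) are perspective, and so are U/W and V/(V \<inter> W); each pair
  contributes equally unless a complement is lost on the way up. By \<open>abelian_crossing\<close>
  it is then lost in both pairs, while both lower factors are complemented, and each side equals
  1.\<close>

lemma abelian_complemented_diamond:
  assumes V: "chief U V" and W: "chief U W" and ne: "V \<noteq> W"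
  shows "abelian_complemented U V + abelian_complemented V (V \<inter> W) =
    abelian_complemented U W + abelian_complemented W (V \<inter> W)"
proof -
  note d = chief_diamond[OF assms]
  note i = chief_idl(1)[OF d(2)] chief_idl(1)[OF d(3)]
  have comm: "W \<boxplus> V = U" "W \<inter> V = V \<inter> W" using sum_comm[OF idl_subsp[OF i(1)] idl_subsp[OF i(2)]] d by auto
  have t: "abelian_factor U V = abelian_factor W (V \<inter> W)" "abelian_factor U W = abelian_factor V (V \<inter> W)"
    "complemented U V \<Longrightarrow> complemented W (V \<inter> W)" "complemented U W \<Longrightarrow> complemented V (V \<inter> W)"
    using abelian_factor_transfer[OF i] abelian_factor_transfer[OF i(2,1)] complemented_transfer[OF i]
      complemented_transfer[OF i(2,1)] d(1) unfolding comm by auto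
  have c1: "abelian_factor V (V \<inter> W) \<and> complemented V (V \<inter> W) \<and> \<not> complemented U W"
    if "abelian_factor W (V \<inter> W)" "complemented W (V \<inter> W)" "\<not> complemented U V"
    using abelian_crossing[OF d(2,3) that(1,2)] that(3) unfolding d(1) by auto
  have c2: "abelian_factor W (V \<inter> W) \<and> complemented W (V \<inter> W) \<and> \<not> complemented U V"
    if "abelian_factor V (V \<inter> W)" "complemented V (V \<inter> W)" "\<not> complemented U W"
    using abelian_crossing[of W V] d that unfolding comm by auto
  show ?thesis
  proof (cases "abelian_factor W (V \<inter> W) \<and> complemented W (V \<inter> W) \<and> \<not> complemented U V")
    case True
    with c1 show ?thesis by (simp add: abelian_complemented_def t(1,2))
  next
    case F1: False
    show ?thesis
    proof (cases "abelian_factor V (V \<inter> W) \<and> complemented V (V \<inter> W) \<and> \<not> complemented U W")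
      case True
      with c2 show ?thesis by (simp add: abelian_complemented_def t(1,2))
    next
      case False
      then have "abelian_complemented U V = abelian_complemented W (V \<inter> W)"
        "abelian_complemented U W = abelian_complemented V (V \<inter> W)"
        using F1 t by (auto simp: abelian_complemented_def)
      then show ?thesis by simp
    qed
  qed
qed

text \<open>A relation rather than a function, since the sum may depend on the chief series along
  which it is taken; \<open>chief_sum_unique\<close> shows independence for suitable g.\<close>

inductive chief_sum :: "('a set \<Rightarrow> 'a set \<Rightarrow> nat) \<Rightarrow> 'a set \<Rightarrow> nat \<Rightarrow> bool" for g where
  zero: "chief_sum g {\<zero>} 0"
| step: "chief_sum g V s \<Longrightarrow> chief U V \<Longrightarrow> chief_sum g U (s + g U V)"

text \<open>Free end terms allow a chief series to be assembled from a lower chain, a diamond and an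
  upper chain.\<close>

definition chief_chain :: "nat \<Rightarrow> (nat \<Rightarrow> 'a set) \<Rightarrow> 'a set \<Rightarrow> 'a set \<Rightarrow> bool" where
  "chief_chain n X D T \<longleftrightarrow> X 0 = D \<and> X n = T \<and> (\<forall>i\<in>{1..n}. chief (X i) (X (i - 1)))"

lemma chief_chain_step:
  assumes "chief_chain n X D T" "k < n" shows "chief (X (Suc k)) (X k)"
proof -
  have "Suc k \<in> {1..n}" using assms(2) by simp
  then have "chief (X (Suc k)) (X (Suc k - 1))" using assms(1) unfolding chief_chain_def by blast
  then show ?thesis by simp
qed

lemma chief_chain_sum:
  assumes "chief_chain n X {\<zero>} T"
  shows "chief_sum g T (\<Sum>i\<in>{1..n}. g (X i) (X (i - 1)))"
proof -
  have "k \<le> n \<Longrightarrow> chief_sum g (X k) (\<Sum>i\<in>{1..k}. g (X i) (X (i - 1)))" for k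
  proof (induction k)
    case 0
    then show ?case using assms chief_sum.zero by (simp add: chief_chain_def)
  next
    case (Suc k)
    have "chief (X (Suc k)) (X k)" using chief_chain_step[OF assms] Suc.prems by simp
    then show ?case using chief_sum.step[OF Suc.IH] Suc.prems by simp
  qed
  then show ?thesis using assms by (auto simp: chief_chain_def)
qed

lemma chief_chain_mono:
  assumes "chief_chain n X D T" "i \<le> j" "j \<le> n" shows "X i \<subseteq> X j"
  using assms(2,3)
proof (induction j rule: dec_induct)
  case (step j)
  have "chief (X (Suc j)) (X j)" using chief_chain_step[OF assms(1)] step.prems by simp
  from chief_idl(3)[OF this] show ?case using step by simp
qed simp

end

context fd_lie_alg begin

lemma ex_chief_below:
  assumes "idl D" "idl T" "D \<subset> T" obtains V where "chief T V" "D \<subseteq> V"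
proof -
  obtain V where V: "idl V \<and> D \<subseteq> V \<and> V \<subset> T"
    and max: "\<And>H'. idl H' \<and> D \<subseteq> H' \<and> H' \<subset> T \<Longrightarrow> V \<subseteq> H' \<Longrightarrow> H' = V"
    by (rule ex_maximal_subsp[of "\<lambda>H. idl H \<and> D \<subseteq> H \<and> H \<subset> T" D])
      (use assms in \<open>auto simp: lie_ideal_def\<close>)
  have "J = V \<or> J = T" if "idl J" "V \<subseteq> J" "J \<subseteq> T" for J
    using max[of J] that V by auto
  then have "chief T V" unfolding chief_def using V assms by simp
  then show ?thesis using that V by blast
qed

lemma ex_chief_chain:
  "idl T \<Longrightarrow> idl D \<Longrightarrow> D \<subseteq> T \<Longrightarrow> \<exists>n X. chief_chain n X D T"
proof (induction "rank T" arbitrary: T rule: less_induct)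
  case less
  show ?case
  proof (cases "T = D")
    case True
    then have "chief_chain 0 (\<lambda>_. D) D T" by (simp add: chief_chain_def)
    then show ?thesis by blast
  next
    case False
    then obtain V where V: "chief T V" "D \<subseteq> V" using ex_chief_below[OF less.prems(2,1)] less.prems(3) by blast
    have "rank V < rank T" by (rule rank_strict_mono) (use chief_subsp[OF V(1)] chief_idl[OF V(1)] in auto)
    then obtain n X where X: "chief_chain n X D V" using less.hyps[OF _ _ less.prems(2) V(2)] chief_idl[OF V(1)] by blast
    have "chief_chain (Suc n) (X(Suc n := T)) D T"
      using X V(1) unfolding chief_chain_def by (auto simp: le_Suc_eq)
    then show ?thesis by blast
  qed
qed

lemma ex_chief_sum: "idl T \<Longrightarrow> \<exists>s. chief_sum g T s"
  using ex_chief_chain[OF _ idl_triv] chief_chain_sum subsp_zero[OF idl_subsp] by (metis empty_subsetI insert_subset)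

text \<open>The Jordan-Hoelder argument: if the last steps V and W differ, both sums are compared
  with sums through V \<inter> W, and the hypothesis on g is the exchange in this diamond.\<close>

lemma chief_sum_unique:
  assumes g: "\<And>U V W. chief U V \<Longrightarrow> chief U W \<Longrightarrow> V \<noteq> W \<Longrightarrow> g U V + g V (V \<inter> W) = g U W + g W (V \<inter> W)"
  shows "chief_sum g T s \<Longrightarrow> chief_sum g T s' \<Longrightarrow> s = s'"
proof (induction "rank T" arbitrary: T s s' rule: less_induct)
  case less
  have r: "rank V < rank T" if "chief T V" for V
    by (rule rank_strict_mono) (use chief_subsp[OF that] chief_idl[OF that] in auto)
  have no: "\<not> chief {\<zero>} V" for V
    using chief_idl(3)[of "{\<zero>}" V] subsp_zero[OF chief_subsp(2)[of "{\<zero>}" V]] by blast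
  show ?case using less.prems(1)
  proof cases
    case zero
    show ?thesis using less.prems(2) zero no by cases auto
  next
    case V: (step V s1)
    show ?thesis using less.prems(2)
    proof cases
      case zero
      then show ?thesis using V no by auto
    next
      case W: (step W s2)
      show ?thesis
      proof (cases "V = W")
        case True
        then show ?thesis using less.hyps[OF r[OF V(3)] V(2)] V W by simp
      next
        case False
        note d = chief_diamond[OF V(3) W(3) False]
        obtain t where t: "chief_sum g (V \<inter> W) t" using ex_chief_sum chief_idl(2)[OF d(2)] by blast
        have "s1 = t + g V (V \<inter> W)" using less.hyps[OF r[OF V(3)] V(2) chief_sum.step[OF t d(2)]] .
        moreover have "s2 = t + g W (V \<inter> W)" using less.hyps[OF r[OF W(3)] W(2) chief_sum.step[OF t d(3)]] .
        ultimately show ?thesis using g[OF V(3) W(3) False] V(1) W(1) by simp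
      qed
    qed
  qed
qed

lemma abelian_complemented_invariant:
  assumes "chief_chain n X {\<zero>} T" "chief_chain m Y {\<zero>} T"
  shows "(\<Sum>i\<in>{1..n}. abelian_complemented (X i) (X (i - 1))) =
    (\<Sum>i\<in>{1..m}. abelian_complemented (Y i) (Y (i - 1)))"
  by (rule chief_sum_unique[OF abelian_complemented_diamond chief_chain_sum[OF assms(1)] chief_chain_sum[OF assms(2)]])

end

section \<open>Nonabelian chief factors\<close>

context lie_alg begin

lemma neg_zero [simp]: "\<ominus> \<zero> = \<zero>"
  using M.minus_equality[of \<zero> \<zero>] by simp

text \<open>The intersection of A with the centralizer is an ideal between B and A, and it is not A
  because the factor is nonabelian.\<close>

lemma centralizer_props:
  assumes ch: "chief A B" and na: "\<not> abelian_factor A B"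
  shows "idl (centralizer A B)" "B \<subseteq> centralizer A B" "A \<inter> centralizer A B = B"
    "\<not> A \<subseteq> centralizer A B"
proof -
  note i = chief_idl[OF ch]
  note s = chief_subsp[OF ch]
  show iZ: "idl (centralizer A B)" using idl_centralizer[OF i(1,2)] .
  show BZ: "B \<subseteq> centralizer A B"
  proof
    fix b assume b: "b \<in> B"
    then show "b \<in> centralizer A B"
      using subsp_closed[OF s(2) b] idl_right[OF i(2) subsp_closed[OF s(1)] b] by (simp add: centralizer_def)
  qed
  show nA: "\<not> A \<subseteq> centralizer A B" using na by (auto simp: centralizer_def abelian_factor_def)
  have "A \<inter> centralizer A B = B \<or> A \<inter> centralizer A B = A"
    by (rule chiefD[OF ch idl_Int[OF i(1) iZ]]) (use i(3) BZ in auto)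
  then show "A \<inter> centralizer A B = B" using nA by auto
qed

text \<open>The ideals \<open>Z\<close> that are centralizers of nonabelian chief factors, recognised by \<open>L/Z\<close>.\<close>

definition nonabelian_center :: "'a set \<Rightarrow> 'a set \<Rightarrow> bool" where
  "nonabelian_center I Z \<longleftrightarrow> chief I Z \<and> \<not> abelian_factor I Z \<and> centralizer I Z = Z"

lemma nonabelian_center_centralizer:
  assumes ch: "chief A B" and na: "\<not> abelian_factor A B"
  shows "nonabelian_center (centralizer A B \<boxplus> A) (centralizer A B)"
proof -
  note p = centralizer_props[OF assms]
  note t = p(1) chief_idl(1)[OF ch]
  have e: "centralizer A B \<inter> A = B" using p(3) by blast
  show ?thesis unfolding nonabelian_center_def
    using chief_transfer[OF t] abelian_factor_transfer[OF t] centralizer_transfer[OF t] ch na unfolding e by simp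
qed

text \<open>Brackets of J with I lie in J \<inter> I, so J \<inter> I \<subseteq> Z would make J
  centralize I/Z, that is, J \<subseteq> Z. In L/Z this says that every nonzero ideal meets I/Z
  nontrivially.\<close>

lemma nonabelian_center_not_le:
  assumes n: "nonabelian_center I Z" and J: "idl J" "\<not> J \<subseteq> Z"
  shows "\<not> J \<inter> I \<subseteq> Z"
proof
  assume sub: "J \<inter> I \<subseteq> Z"
  have ch: "chief I Z" and c: "centralizer I Z = Z" using n by (auto simp: nonabelian_center_def)
  note i = chief_idl[OF ch]
  note s = chief_subsp[OF ch]
  have "J \<subseteq> centralizer I Z"
  proof
    fix x assume x: "x \<in> J"
    note xc = subsp_closed[OF idl_subsp[OF J(1)] x]
    have "x \<otimes> a \<in> Z" if a: "a \<in> I" for a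
      using idl_right[OF J(1) subsp_closed[OF s(1) a] x] idl_left[OF i(1) xc a] sub by blast
    then show "x \<in> centralizer I Z" using xc by (simp add: centralizer_def)
  qed
  then show False using c J(2) by simp
qed

text \<open>The step at which a chief series leaves Z is perspective to I/Z: A \<inter> I is not
  inside Z, so together with B it fills A, whence A \<subseteq> I and Z + A = I. This is how Z finds
  its factor in a chief series.\<close>

lemma nonabelian_center_factor:
  assumes n: "nonabelian_center I Z" and ch: "chief A B" and AB: "B \<subseteq> Z" "\<not> A \<subseteq> Z"
  shows "\<not> abelian_factor A B" "centralizer A B = Z" "Z \<boxplus> A = I" "Z \<inter> A = B"
proof -
  have chI: "chief I Z" and naI: "\<not> abelian_factor I Z" and c: "centralizer I Z = Z"
    using n by (auto simp: nonabelian_center_def)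
  note i = chief_idl[OF ch] and iI = chief_idl[OF chI]
  note s = chief_subsp[OF ch] and sI = chief_subsp[OF chI]
  have "Z \<inter> A = B \<or> Z \<inter> A = A"
    by (rule chiefD[OF ch idl_Int[OF iI(2) i(1)]]) (use AB i(3) in auto)
  then show ZA: "Z \<inter> A = B" using AB by auto
  have AI: "\<not> A \<inter> I \<subseteq> Z" by (rule nonabelian_center_not_le[OF n i(1) AB(2)])
  note sAI = subsp_Int[OF s(1) sI(1)]
  have "(A \<inter> I) \<boxplus> B = B \<or> (A \<inter> I) \<boxplus> B = A"
    by (rule chiefD[OF ch idl_sum[OF idl_Int[OF i(1) iI(1)] i(2)] sum_upper2[OF sAI s(2)]])
      (rule sum_least[OF s(1)], use i(3) in auto)
  moreover have "(A \<inter> I) \<boxplus> B \<noteq> B" using sum_upper1[OF sAI s(2)] AI AB(1) by auto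
  ultimately have A: "(A \<inter> I) \<boxplus> B = A" by simp
  have "(A \<inter> I) \<boxplus> B \<subseteq> I" by (rule sum_least[OF sI(1)]) (use AB(1) iI(3) in auto)
  then have AI': "A \<subseteq> I" using A by simp
  have "Z \<boxplus> A = Z \<or> Z \<boxplus> A = I"
    by (rule chiefD[OF chI idl_sum[OF iI(2) i(1)] sum_upper1[OF sI(2) s(1)]])
      (rule sum_least[OF sI(1)], use AI' iI(3) in auto)
  moreover have "Z \<boxplus> A \<noteq> Z" using sum_upper2[OF sI(2) s(1)] AB(2) by auto
  ultimately show I: "Z \<boxplus> A = I" by simp
  show "\<not> abelian_factor A B" using abelian_factor_transfer[OF iI(2) i(1)] naI unfolding I ZA by simp
  show "centralizer A B = Z" using centralizer_transfer[OF iI(2) i(1)] c unfolding I ZA by simp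
qed

lemma nonabelian_center_unique:
  assumes n: "nonabelian_center I Z" and ch: "chief J Z" shows "J = I"
  using nonabelian_center_factor(3)[OF n ch subset_refl] chief_idl(3)[OF ch] chief_subsp[OF ch]
    sum_absorb[of J Z] sum_comm[of J Z] by auto

lemma complemented_of_center:
  assumes "nonabelian_center I Z" "chief A B" "B \<subseteq> Z" "\<not> A \<subseteq> Z" "complemented I Z"
  shows "complemented A B"
proof -
  note f = nonabelian_center_factor[OF assms(1-4)]
  have "idl Z" using assms(1) chief_idl(2)[of I Z] by (simp add: nonabelian_center_def)
  then show ?thesis using complemented_transfer[of Z A] chief_idl(1)[OF assms(2)] assms(5) unfolding f(3,4) by simp
qed

section \<open>Congruence modulo an ideal and \<open>L\<close>-equivalence on
  representatives\<close>

definition eqm :: "'a set \<Rightarrow> 'a \<Rightarrow> 'a \<Rightarrow> bool" where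
  "eqm B x y \<longleftrightarrow> x \<in> carrier L \<and> y \<in> carrier L \<and> x \<ominus> y \<in> B"

lemma eqm_closed: "eqm B x y \<Longrightarrow> x \<in> carrier L" "eqm B x y \<Longrightarrow> y \<in> carrier L"
  by (simp_all add: eqm_def)

lemma eqm_refl: "subsp B \<Longrightarrow> x \<in> carrier L \<Longrightarrow> eqm B x x"
  using subsp_zero by (simp add: eqm_def M.minus_eq M.r_neg)

lemma eqm_trans: assumes "subsp B" "eqm B x y" "eqm B y z" shows "eqm B x z"
proof -
  have "x \<ominus> z = (x \<ominus> y) \<oplus> (y \<ominus> z)" using assms by (simp add: eqm_def lin_simps)
  then show ?thesis using assms subsp_add[OF assms(1)] by (simp add: eqm_def)
qed

lemma eqm_sym: assumes "subsp B" "eqm B x y" shows "eqm B y x"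
proof -
  have "y \<ominus> x = \<ominus> (x \<ominus> y)" using assms by (simp add: eqm_def lin_simps)
  then show ?thesis using assms subsp_neg[OF assms(1)] by (simp add: eqm_def)
qed

lemma eqm_add: assumes "subsp B" "eqm B x y" "eqm B x' y'" shows "eqm B (x \<oplus> x') (y \<oplus> y')"
proof -
  have "(x \<oplus> x') \<ominus> (y \<oplus> y') = (x \<ominus> y) \<oplus> (x' \<ominus> y')" using assms by (simp add: eqm_def lin_simps)
  then show ?thesis using assms subsp_add[OF assms(1)] by (simp add: eqm_def)
qed

lemma eqm_neg: assumes "subsp B" "eqm B x y" shows "eqm B (\<ominus> x) (\<ominus> y)"
proof -
  have "(\<ominus> x) \<ominus> (\<ominus> y) = \<ominus> (x \<ominus> y)" using assms by (simp add: eqm_def lin_simps)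
  then show ?thesis using assms subsp_neg[OF assms(1)] by (simp add: eqm_def)
qed

lemma eqm_minus: assumes "subsp B" "eqm B x y" "eqm B x' y'" shows "eqm B (x \<ominus> x') (y \<ominus> y')"
  using eqm_add[OF assms(1,2) eqm_neg[OF assms(1,3)]] by (simp add: M.minus_eq)

lemma eqm_smult: assumes "subsp B" "eqm B x y" "k \<in> carrier K" shows "eqm B (k \<odot> x) (k \<odot> y)"
proof -
  have "k \<odot> x \<ominus> k \<odot> y = k \<odot> (x \<ominus> y)"
    using assms by (simp add: eqm_def M.minus_eq smult_r_distr smult_r_minus)
  then show ?thesis using assms subsp_smult[OF assms(1)] by (simp add: eqm_def)
qed

lemma eqm_bracket:
  assumes "idl B" "eqm B x y" "eqm B x' y'" shows "eqm B (x \<otimes> x') (y \<otimes> y')"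
proof -
  have cl: "x \<in> carrier L" "y \<in> carrier L" "x' \<in> carrier L" "y' \<in> carrier L"
    using assms by (auto simp: eqm_def)
  have "x \<otimes> x' \<ominus> y \<otimes> y' = (x \<ominus> y) \<otimes> x' \<oplus> y \<otimes> (x' \<ominus> y')"
    using cl by (simp add: bracket_minus_left bracket_minus_right) (simp add: lin_simps)
  moreover have "(x \<ominus> y) \<otimes> x' \<in> B" "y \<otimes> (x' \<ominus> y') \<in> B"
    using assms cl idl_left[OF assms(1)] idl_right[OF assms(1)] by (simp_all add: eqm_def)
  ultimately show ?thesis using cl subsp_add[OF idl_subsp[OF assms(1)]] by (simp add: eqm_def)
qed

lemma eqm_zero: "subsp B \<Longrightarrow> eqm B x \<zero> \<longleftrightarrow> x \<in> B"
  using subsp_closed[of B x] by (auto simp: eqm_def M.minus_eq)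

lemma eqm_mem:
  assumes "subsp H" "B \<subseteq> H" "eqm B x y" shows "x \<in> H \<longleftrightarrow> y \<in> H"
proof -
  have cl: "x \<in> carrier L" "y \<in> carrier L" and d: "x \<ominus> y \<in> H" using assms by (auto simp: eqm_def)
  have e: "x = (x \<ominus> y) \<oplus> y" "y = x \<ominus> (x \<ominus> y)" using cl by (simp_all add: lin_simps)
  show ?thesis using subsp_add[OF assms(1) d] subsp_minus[OF assms(1) _ d] e by metis
qed

lemma eqm_mono: "B \<subseteq> H \<Longrightarrow> eqm B x y \<Longrightarrow> eqm H x y"
  by (auto simp: eqm_def)

text \<open>The equations hold only modulo B because f chooses representatives of cosets, and such
  choices are not additive in general.\<close>

definition linear_mod :: "'a set \<Rightarrow> 'a set \<Rightarrow> 'a set \<Rightarrow> ('a \<Rightarrow> 'a) \<Rightarrow> bool" where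
  "linear_mod D A B f \<longleftrightarrow> (\<forall>x\<in>D. f x \<in> A) \<and>
     (\<forall>x\<in>D. \<forall>y\<in>D. eqm B (f (x \<oplus> y)) (f x \<oplus> f y)) \<and>
     (\<forall>k\<in>carrier K. \<forall>x\<in>D. eqm B (f (k \<odot> x)) (k \<odot> f x))"

text \<open>\<open>L\<close>-equivalence of \<open>A/B\<close> and \<open>A'/B'\<close> in terms of representatives: an isomorphism of the
  extensions is \<open>(a, x) \<mapsto> (\<phi> a + \<delta> x, x)\<close> with an isomorphism \<open>\<phi>\<close> and a crossed map \<open>\<delta>\<close>.\<close>

definition equiv_data :: "('a \<Rightarrow> 'a) \<Rightarrow> ('a \<Rightarrow> 'a) \<Rightarrow> 'a set \<Rightarrow> 'a set \<Rightarrow> 'a set \<Rightarrow> 'a set \<Rightarrow> bool" where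
  "equiv_data \<phi> \<delta> A B A' B' \<longleftrightarrow>
     linear_mod A A' B' \<phi> \<and> linear_mod (carrier L) A' B' \<delta> \<and>
     (\<forall>a\<in>A. \<forall>b\<in>A. eqm B' (\<phi> (a \<otimes> b)) (\<phi> a \<otimes> \<phi> b)) \<and>
     (\<forall>x\<in>carrier L. \<forall>y\<in>carrier L.
        eqm B' (\<delta> (x \<otimes> y)) ((x \<otimes> \<delta> y \<ominus> y \<otimes> \<delta> x) \<oplus> \<delta> x \<otimes> \<delta> y)) \<and>
     (\<forall>x\<in>carrier L. \<forall>a\<in>A. eqm B' (\<phi> (x \<otimes> a)) (x \<otimes> \<phi> a \<oplus> \<delta> x \<otimes> \<phi> a)) \<and>
     (\<forall>a\<in>A. \<phi> a \<in> B' \<longleftrightarrow> a \<in> B) \<and> (\<forall>b\<in>A'. \<exists>a\<in>A. eqm B' (\<phi> a) b)"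

lemma equiv_dataD:
  assumes "equiv_data \<phi> \<delta> A B A' B'"
  shows "a \<in> A \<Longrightarrow> \<phi> a \<in> A'"
    and "x \<in> carrier L \<Longrightarrow> \<delta> x \<in> A'"
    and "a \<in> A \<Longrightarrow> b \<in> A \<Longrightarrow> eqm B' (\<phi> (a \<oplus> b)) (\<phi> a \<oplus> \<phi> b)"
    and "k \<in> carrier K \<Longrightarrow> a \<in> A \<Longrightarrow> eqm B' (\<phi> (k \<odot> a)) (k \<odot> \<phi> a)"
    and "x \<in> carrier L \<Longrightarrow> y \<in> carrier L \<Longrightarrow> eqm B' (\<delta> (x \<oplus> y)) (\<delta> x \<oplus> \<delta> y)"
    and "k \<in> carrier K \<Longrightarrow> x \<in> carrier L \<Longrightarrow> eqm B' (\<delta> (k \<odot> x)) (k \<odot> \<delta> x)"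
    and "a \<in> A \<Longrightarrow> b \<in> A \<Longrightarrow> eqm B' (\<phi> (a \<otimes> b)) (\<phi> a \<otimes> \<phi> b)"
    and "x \<in> carrier L \<Longrightarrow> y \<in> carrier L \<Longrightarrow>
        eqm B' (\<delta> (x \<otimes> y)) ((x \<otimes> \<delta> y \<ominus> y \<otimes> \<delta> x) \<oplus> \<delta> x \<otimes> \<delta> y)"
    and "x \<in> carrier L \<Longrightarrow> a \<in> A \<Longrightarrow> eqm B' (\<phi> (x \<otimes> a)) (x \<otimes> \<phi> a \<oplus> \<delta> x \<otimes> \<phi> a)"
    and "a \<in> A \<Longrightarrow> \<phi> a \<in> B' \<longleftrightarrow> a \<in> B"
    and "b \<in> A' \<Longrightarrow> \<exists>a\<in>A. eqm B' (\<phi> a) b"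
  using assms unfolding equiv_data_def linear_mod_def by blast+

text \<open>Perspective factors are isomorphic with the same action of L, so the inclusion of C
  serves as \<phi> and the crossed map is zero.\<close>

lemma equiv_data_transfer:
  assumes B: "idl B" and C: "idl C"
  shows "equiv_data (\<lambda>x. x) (\<lambda>x. \<zero>) C (B \<inter> C) (B \<boxplus> C) B"
proof -
  note s = idl_subsp[OF B] idl_subsp[OF C]
  note cl = subsp_closed[OF s(2)]
  have CU: "C \<subseteq> B \<boxplus> C" using sum_upper2[OF s] .
  have z: "\<zero> \<in> B \<boxplus> C" using subsp_zero[OF subsp_sum[OF s]] .
  have r: "eqm B x x" if "x \<in> carrier L" for x using eqm_refl[OF s(1) that] .
  have "\<exists>a\<in>C. eqm B a y" if y: "y \<in> B \<boxplus> C" for y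
  proof -
    obtain b c where *: "b \<in> B" "c \<in> C" "y = b \<oplus> c" using y unfolding mem_sum by blast
    note bc = subsp_closed[OF s(1) *(1)] cl[OF *(2)]
    have "c \<ominus> y = \<ominus> b" using bc * by (simp add: lin_simps)
    then have "eqm B c y" using * bc subsp_neg[OF s(1)] by (simp add: eqm_def)
    then show ?thesis using *(2) by blast
  qed
  then show ?thesis unfolding equiv_data_def linear_mod_def
    using CU z cl r by (auto simp: M.minus_eq)
qed

text \<open>Acting through \<open>x + \<delta> x\<close>, \<open>L\<close> acts on \<open>A'/B'\<close> as it does on \<open>A/B\<close>, transported along \<open>\<phi>\<close>.\<close>

definition conj_map :: "('a \<Rightarrow> 'a) \<Rightarrow> 'a \<Rightarrow> 'a" where "conj_map \<delta> x = x \<oplus> \<delta> x"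

text \<open>The crossed product rule for \<delta> is exactly multiplicativity of x \<mapsto> x +
  \<delta> x modulo B'.\<close>

lemma conj_map:
  assumes d: "equiv_data \<phi> \<delta> A B A' B'" and A: "idl A" and A': "idl A'" and B': "idl B'"
  shows "x \<in> carrier L \<Longrightarrow> conj_map \<delta> x \<in> carrier L"
    and "x \<in> carrier L \<Longrightarrow> y \<in> carrier L \<Longrightarrow>
      eqm B' (conj_map \<delta> (x \<oplus> y)) (conj_map \<delta> x \<oplus> conj_map \<delta> y)"
    and "k \<in> carrier K \<Longrightarrow> x \<in> carrier L \<Longrightarrow> eqm B' (conj_map \<delta> (k \<odot> x)) (k \<odot> conj_map \<delta> x)"
    and "x \<in> carrier L \<Longrightarrow> y \<in> carrier L \<Longrightarrow>
      eqm B' (conj_map \<delta> (x \<otimes> y)) (conj_map \<delta> x \<otimes> conj_map \<delta> y)"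
    and "x \<in> carrier L \<Longrightarrow> a \<in> A \<Longrightarrow> eqm B' (\<phi> (x \<otimes> a)) (conj_map \<delta> x \<otimes> \<phi> a)"
proof -
  note D = equiv_dataD[OF d]
  note s = idl_subsp[OF A] idl_subsp[OF A'] idl_subsp[OF B']
  have dc: "\<delta> x \<in> carrier L" if "x \<in> carrier L" for x using subsp_closed[OF s(2) D(2)[OF that]] .
  have pc: "\<phi> a \<in> carrier L" if "a \<in> A" for a using subsp_closed[OF s(2) D(1)[OF that]] .
  show "conj_map \<delta> x \<in> carrier L" if "x \<in> carrier L" using dc that by (simp add: conj_map_def)
  show "eqm B' (conj_map \<delta> (x \<oplus> y)) (conj_map \<delta> x \<oplus> conj_map \<delta> y)"
    if x: "x \<in> carrier L" and y: "y \<in> carrier L" for x y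
  proof -
    have "eqm B' (x \<oplus> y \<oplus> \<delta> (x \<oplus> y)) (x \<oplus> y \<oplus> (\<delta> x \<oplus> \<delta> y))"
      by (rule eqm_add[OF s(3) eqm_refl[OF s(3)] D(5)]) (use x y in auto)
    then show ?thesis using x y dc by (simp add: conj_map_def M.a_ac)
  qed
  show "eqm B' (conj_map \<delta> (k \<odot> x)) (k \<odot> conj_map \<delta> x)"
    if k: "k \<in> carrier K" and x: "x \<in> carrier L" for x k
  proof -
    have "eqm B' (k \<odot> x \<oplus> \<delta> (k \<odot> x)) (k \<odot> x \<oplus> k \<odot> \<delta> x)"
      by (rule eqm_add[OF s(3) eqm_refl[OF s(3)] D(6)]) (use x k in auto)
    then show ?thesis using x k dc by (simp add: conj_map_def smult_r_distr)
  qed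
  show "eqm B' (conj_map \<delta> (x \<otimes> y)) (conj_map \<delta> x \<otimes> conj_map \<delta> y)"
    if x: "x \<in> carrier L" and y: "y \<in> carrier L" for x y
  proof -
    have "eqm B' (x \<otimes> y \<oplus> \<delta> (x \<otimes> y)) (x \<otimes> y \<oplus> ((x \<otimes> \<delta> y \<ominus> y \<otimes> \<delta> x) \<oplus> \<delta> x \<otimes> \<delta> y))"
      by (rule eqm_add[OF s(3) eqm_refl[OF s(3)] D(8)]) (use x y in auto)
    moreover have "y \<otimes> \<delta> x = \<ominus> (\<delta> x \<otimes> y)" using bracket_anti[OF y dc[OF x]] .
    ultimately show ?thesis using x y dc
      by (simp add: conj_map_def bracket_add_left bracket_add_right M.minus_eq M.a_ac)
  qed
  show "eqm B' (\<phi> (x \<otimes> a)) (conj_map \<delta> x \<otimes> \<phi> a)" if x: "x \<in> carrier L" and a: "a \<in> A" for x a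
    using D(9)[OF x a] x dc[OF x] pc[OF a] by (simp add: conj_map_def bracket_add_left)
qed

text \<open>The element x + \<delta> x acts on \<phi> a as the transported action of x on a, and
  \<phi> is onto modulo B' with kernel B, so the centralizers correspond. For x in A, both x +
  \<delta> x and \<phi> x send \<phi> a to \<phi> (x \<otimes> a) modulo B', hence they differ by an
  element of the centralizer.\<close>

lemma conj_map_ideal:
  assumes d: "equiv_data \<phi> \<delta> A B A' B'" and A: "idl A" and A': "idl A'" and B': "idl B'"
    and B: "B \<subseteq> A" and x: "x \<in> carrier L"
  shows "conj_map \<delta> x \<in> centralizer A' B' \<longleftrightarrow> x \<in> centralizer A B"
    and "x \<in> A \<Longrightarrow> eqm (centralizer A' B') (conj_map \<delta> x) (\<phi> x)"
proof -
  note D = equiv_dataD[OF d]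
  note s = idl_subsp[OF A] idl_subsp[OF A'] idl_subsp[OF B']
  note c = conj_map[OF d A A' B']
  have pc: "\<phi> a \<in> carrier L" if "a \<in> A" for a using subsp_closed[OF s(2) D(1)[OF that]] .
  have test: "y \<in> centralizer A' B' \<longleftrightarrow> (\<forall>a\<in>A. y \<otimes> \<phi> a \<in> B')" if y: "y \<in> carrier L" for y
  proof
    assume "y \<in> centralizer A' B'"
    then show "\<forall>a\<in>A. y \<otimes> \<phi> a \<in> B'" using D(1) by (auto simp: centralizer_def)
  next
    assume *: "\<forall>a\<in>A. y \<otimes> \<phi> a \<in> B'"
    have "y \<otimes> b \<in> B'" if b: "b \<in> A'" for b
    proof -
      obtain a where a: "a \<in> A" "eqm B' (\<phi> a) b" using D(11)[OF b] by blast
      have "eqm B' (y \<otimes> \<phi> a) (y \<otimes> b)" by (rule eqm_bracket[OF B' eqm_refl[OF s(3) y] a(2)])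
      then show ?thesis using eqm_mem[OF s(3) subset_refl] * a(1) by blast
    qed
    then show "y \<in> centralizer A' B'" using y by (simp add: centralizer_def)
  qed
  have "conj_map \<delta> x \<otimes> \<phi> a \<in> B' \<longleftrightarrow> x \<otimes> a \<in> B" if a: "a \<in> A" for a
    using eqm_mem[OF s(3) subset_refl c(5)[OF x a]] D(10)[OF idl_left[OF A x a]] by blast
  then show "conj_map \<delta> x \<in> centralizer A' B' \<longleftrightarrow> x \<in> centralizer A B"
    unfolding test[OF c(1)[OF x]] using x by (auto simp: centralizer_def)
  assume xA: "x \<in> A"
  have cl: "conj_map \<delta> x \<in> carrier L" "\<phi> x \<in> carrier L" using c(1)[OF x] pc[OF xA] by auto
  have "(conj_map \<delta> x \<ominus> \<phi> x) \<otimes> \<phi> a \<in> B'" if a: "a \<in> A" for a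
  proof -
    have "eqm B' (conj_map \<delta> x \<otimes> \<phi> a) (\<phi> x \<otimes> \<phi> a)"
      by (rule eqm_trans[OF s(3) eqm_sym[OF s(3) c(5)[OF x a]] D(7)[OF xA a]])
    then show ?thesis using cl pc[OF a] by (simp add: eqm_def bracket_minus_left)
  qed
  then have "conj_map \<delta> x \<ominus> \<phi> x \<in> centralizer A' B'" using test cl by simp
  then show "eqm (centralizer A' B') (conj_map \<delta> x) (\<phi> x)" using cl by (simp add: eqm_def)
qed

lemma equiv_complemented_below:
  assumes d: "equiv_data \<phi> \<delta> A B A' B'" and ch: "chief A B" and ch': "chief A' B'"
    and na': "\<not> abelian_factor A' B'" and AZ: "A \<subseteq> centralizer A' B'"
  shows "complemented A B"
proof -
  note D = equiv_dataD[OF d]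
  note i = chief_idl[OF ch] and i' = chief_idl[OF ch']
  note s = chief_subsp[OF ch] and s' = chief_subsp[OF ch']
  note Z = centralizer_props[OF ch' na']
  note sZ = idl_subsp[OF Z(1)]
  note cm = conj_map[OF d i(1) i'(1,2)]
  have dc: "\<delta> x \<in> carrier L" if "x \<in> carrier L" for x using subsp_closed[OF s'(1) D(2)[OF that]] .
  have pc: "\<phi> a \<in> carrier L" if "a \<in> A" for a using subsp_closed[OF s'(1) D(1)[OF that]] .
  have Ac: "a \<in> carrier L" if "a \<in> A" for a using subsp_closed[OF s(1) that] .
  \<comment> \<open>a + \<delta> a and \<phi> a agree modulo the centralizer, and a itself lies in
    it by assumption. So \<delta> a - \<phi> a lies in A' and in the centralizer, which meet in
    B'.\<close>
  have eq: "eqm B' (\<delta> a) (\<phi> a)" if a: "a \<in> A" for a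
  proof -
    have "conj_map \<delta> a \<ominus> \<phi> a \<in> centralizer A' B'"
      using conj_map_ideal(2)[OF d i(1) i'(1,2) _ Ac[OF a] a] i(3) by (auto simp: eqm_def)
    moreover have "conj_map \<delta> a \<ominus> \<phi> a = a \<oplus> (\<delta> a \<ominus> \<phi> a)"
      using Ac[OF a] dc pc[OF a] by (simp add: conj_map_def lin_simps)
    moreover have "a \<in> centralizer A' B'" using AZ a by blast
    ultimately have "\<delta> a \<ominus> \<phi> a \<in> centralizer A' B'"
      using subsp_add_cancel[OF sZ] Ac[OF a] dc pc[OF a] by (metis M.minus_closed)
    moreover have "\<delta> a \<ominus> \<phi> a \<in> A'" using subsp_minus[OF s'(1)] D(1,2) a Ac[OF a] by blast
    ultimately show ?thesis using Z(3) dc[OF Ac[OF a]] pc[OF a] by (auto simp: eqm_def)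
  qed
  define M where "M = {x \<in> carrier L. \<delta> x \<in> B'}"
  note mem = eqm_mem[OF s'(2) subset_refl]
  have "\<zero> \<in> M"
    using mem[OF D(6)[OF K_closed(1) M.zero_closed]] dc[OF M.zero_closed] subsp_zero[OF s'(2)]
    by (simp add: M_def)
  then have sM: "subsp M"
    using mem[OF D(5)] mem[OF D(6)] subsp_add[OF s'(2)] subsp_smult[OF s'(2)]
    by (intro subspI) (auto simp: M_def)
  have alg: "subalg M"
  proof (rule subalgI[OF sM])
    fix x y assume xy: "x \<in> M" "y \<in> M"
    then have xc: "x \<in> carrier L" "y \<in> carrier L" "\<delta> x \<in> B'" "\<delta> y \<in> B'" by (auto simp: M_def)
    have "(x \<otimes> \<delta> y \<ominus> y \<otimes> \<delta> x) \<oplus> \<delta> x \<otimes> \<delta> y \<in> B'"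
      using xc dc idl_left[OF i'(2)] by (intro subsp_add[OF s'(2)] subsp_minus[OF s'(2)]) auto
    then show "x \<otimes> y \<in> M" using mem[OF D(8)[OF xc(1,2)]] xc by (simp add: M_def)
  qed
  have "x \<in> A \<boxplus> M" if x: "x \<in> carrier L" for x
  proof -
    \<comment> \<open>Since \<phi> is onto modulo B' and agrees with \<delta> on A, some a in A has
      the same \<delta>-value as x modulo B'; x - a is then in the kernel M.\<close>
    obtain a where a: "a \<in> A" "eqm B' (\<phi> a) (\<delta> x)" using D(11)[OF D(2)[OF x]] by blast
    note ac = Ac[OF a(1)]
    define y where "y = x \<ominus> a"
    have y: "y \<in> carrier L" "x = a \<oplus> y" using x ac by (simp_all add: y_def lin_simps)
    have "eqm B' (\<delta> a) (\<delta> x)" using eqm_trans[OF s'(2) eq[OF a(1)] a(2)] .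
    moreover have "eqm B' (\<delta> x) (\<delta> a \<oplus> \<delta> y)" using D(5)[OF ac y(1)] y(2) by simp
    ultimately have "eqm B' (\<delta> a) (\<delta> a \<oplus> \<delta> y)" using eqm_trans[OF s'(2)] by blast
    then have "\<delta> a \<ominus> (\<delta> a \<oplus> \<delta> y) \<in> B'" by (simp add: eqm_def)
    moreover have "\<delta> a \<ominus> (\<delta> a \<oplus> \<delta> y) = \<ominus> \<delta> y" using dc[OF ac] dc[OF y(1)] by (simp add: lin_simps)
    ultimately have "\<delta> y \<in> B'" using subsp_neg[OF s'(2), of "\<ominus> \<delta> y"] dc[OF y(1)] by simp
    then have "y \<in> M" using y(1) by (simp add: M_def)
    then show ?thesis using a(1) y(2) sumI by blast
  qed
  then have "A \<boxplus> M = carrier L" using subsp_subset[OF subsp_sum[OF s(1) sM]] by blast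
  moreover have "A \<inter> M = B"
    using mem[OF eq] D(10) Ac i(3) by (auto simp: M_def)
  ultimately show ?thesis using alg by (auto simp: complemented_def compl_def)
qed

text \<open>Modulo the centralizers Z and Z', the map x \<mapsto> x + \<delta> x embeds L/Z into
  L/Z' and takes the image of A onto that of A'. The preimage of a complement is therefore a
  complement.\<close>

lemma equiv_center_complemented:
  assumes d: "equiv_data \<phi> \<delta> A B A' B'" and ch: "chief A B" and ch': "chief A' B'"
    and na: "\<not> abelian_factor A B" and na': "\<not> abelian_factor A' B'"
    and cZ: "complemented (centralizer A' B' \<boxplus> A') (centralizer A' B')"
  shows "complemented (centralizer A B \<boxplus> A) (centralizer A B)"
proof -
  let ?Z = "centralizer A B" and ?Z' = "centralizer A' B'"
  note D = equiv_dataD[OF d]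
  note i = chief_idl[OF ch] and i' = chief_idl[OF ch']
  note s = chief_subsp[OF ch] and s' = chief_subsp[OF ch']
  note Z = centralizer_props[OF ch na] and Z' = centralizer_props[OF ch' na']
  note sZ = idl_subsp[OF Z(1)] and sZ' = idl_subsp[OF Z'(1)]
  note cm = conj_map[OF d i(1) i'(1,2)]
  have BA: "B \<subseteq> A" using i(3) by blast
  note ci = conj_map_ideal[OF d i(1) i'(1,2) BA]
  have Ac: "a \<in> carrier L" if "a \<in> A" for a using subsp_closed[OF s(1) that] .
  obtain M' where M': "subalg M'" "(?Z' \<boxplus> A') \<boxplus> M' = carrier L" "(?Z' \<boxplus> A') \<inter> M' = ?Z'"
    using cZ by (auto simp: complemented_def compl_def)
  have sM': "subsp M'" using M'(1) subalg_subsp by blast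
  have Z'M': "?Z' \<subseteq> M'" using M'(3) by blast
  have B'M': "B' \<subseteq> M'" using Z'M' Z'(2) by blast
  note mem = eqm_mem[OF sM' B'M']
  define M where "M = {x \<in> carrier L. conj_map \<delta> x \<in> M'}"
  have ZM: "?Z \<subseteq> M" using ci(1) Z'M' subsp_closed[OF sZ] unfolding M_def by blast
  have sM: "subsp M"
    using mem[OF cm(2)] mem[OF cm(3)] subsp_add[OF sM'] subsp_smult[OF sM'] subsetD[OF ZM subsp_zero[OF sZ]]
    by (intro subspI) (auto simp: M_def)
  have alg: "subalg M"
    using mem[OF cm(4)] subalg_bracket[OF M'(1)] by (intro subalgI[OF sM]) (auto simp: M_def)
  have AM: "conj_map \<delta> a \<in> M' \<longleftrightarrow> \<phi> a \<in> M'" if a: "a \<in> A" for a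
    using eqm_mem[OF sM' Z'M' ci(2)[OF Ac[OF a] a]] .
  note sI = subsp_sum[OF sZ s(1)]
  have "x \<in> (?Z \<boxplus> A) \<boxplus> M" if x: "x \<in> carrier L" for x
  proof -
    have "conj_map \<delta> x \<in> (?Z' \<boxplus> A') \<boxplus> M'" using cm(1)[OF x] M'(2) by simp
    then obtain u m where u: "u \<in> ?Z' \<boxplus> A'" "m \<in> M'" "conj_map \<delta> x = u \<oplus> m"
      unfolding mem_sum[of _ "?Z' \<boxplus> A'"] by blast
    obtain z b where "z \<in> ?Z'" "b \<in> A'" "u = z \<oplus> b" using u(1) unfolding mem_sum by blast
    then have zbm: "z \<in> ?Z'" "b \<in> A'" "m \<in> M'" "conj_map \<delta> x = (z \<oplus> b) \<oplus> m" using u by auto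
    note zc = subsp_closed[OF sZ' zbm(1)] subsp_closed[OF s'(1) zbm(2)] subsp_closed[OF sM' zbm(3)]
    obtain a where a: "a \<in> A" "eqm B' (\<phi> a) b" using D(11)[OF zbm(2)] by blast
    note ac = Ac[OF a(1)]
    define y where "y = x \<ominus> a"
    have y: "y \<in> carrier L" "x = a \<oplus> y" using x ac by (simp_all add: y_def lin_simps)
    have "eqm ?Z' (conj_map \<delta> a) b"
      using eqm_trans[OF sZ' ci(2)[OF ac a(1)] eqm_mono[OF Z'(2) a(2)]] .
    then have "eqm M' (conj_map \<delta> a) b" using eqm_mono[OF Z'M'] by blast
    moreover have "eqm M' (conj_map \<delta> x) b"
    proof -
      have "conj_map \<delta> x \<ominus> b = z \<oplus> m" using zbm(4) zc by (simp add: lin_simps)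
      then show ?thesis using zbm zc Z'M' subsp_add[OF sM'] by (auto simp: eqm_def)
    qed
    moreover have "eqm M' (conj_map \<delta> x) (conj_map \<delta> a \<oplus> conj_map \<delta> y)"
      using eqm_mono[OF B'M' cm(2)[OF ac y(1)]] y(2) by simp
    ultimately have "eqm M' (conj_map \<delta> a \<oplus> conj_map \<delta> y) (conj_map \<delta> a)"
      using eqm_trans[OF sM'] eqm_sym[OF sM'] by blast
    then have "(conj_map \<delta> a \<oplus> conj_map \<delta> y) \<ominus> conj_map \<delta> a \<in> M'" by (simp add: eqm_def)
    moreover have "(conj_map \<delta> a \<oplus> conj_map \<delta> y) \<ominus> conj_map \<delta> a = conj_map \<delta> y"
      using cm(1)[OF ac] cm(1)[OF y(1)] by (simp add: lin_simps)
    ultimately have "y \<in> M" using y(1) by (simp add: M_def)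
    moreover have "a \<in> ?Z \<boxplus> A" using sum_upper2[OF sZ s(1)] a(1) by blast
    ultimately show ?thesis using y(2) sumI by blast
  qed
  then have "(?Z \<boxplus> A) \<boxplus> M = carrier L" using subsp_subset[OF subsp_sum[OF sI sM]] by blast
  moreover have "(?Z \<boxplus> A) \<inter> M = ?Z"
  proof
    show "?Z \<subseteq> (?Z \<boxplus> A) \<inter> M" using sum_upper1[OF sZ s(1)] ZM by blast
    have "A \<inter> M \<subseteq> ?Z"
    proof
      fix a assume a: "a \<in> A \<inter> M"
      then have "\<phi> a \<in> M'" using AM by (auto simp: M_def)
      moreover have "\<phi> a \<in> ?Z' \<boxplus> A'" using D(1) a sum_upper2[OF sZ' s'(1)] by blast
      ultimately have "\<phi> a \<in> B'" using M'(3) Z'(3) D(1) a by blast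
      then show "a \<in> ?Z" using D(10) a Z(2) by blast
    qed
    then show "(?Z \<boxplus> A) \<inter> M \<subseteq> ?Z"
      unfolding modular[OF sZ s(1) sM ZM] by (intro sum_least[OF sZ]) auto
  qed
  ultimately show ?thesis using alg by (auto simp: complemented_def compl_def)
qed

text \<open>In L = A + M, the summand M normalizes both M and the centralizer, and A sends the
  centralizer into B, which lies in M.\<close>

lemma idl_complement_Int_centralizer:
  assumes ch: "chief A B" and na: "\<not> abelian_factor A B" and M: "compl A B M"
  shows "idl (M \<inter> centralizer A B)"
proof -
  let ?Z = "centralizer A B"
  note s = chief_subsp[OF ch]
  note Z = centralizer_props[OF ch na]
  have M': "subalg M" "A \<boxplus> M = carrier L" "A \<inter> M = B" using M by (auto simp: compl_def)
  note sM = subalg_subsp[OF M'(1)]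
  note sN = subsp_Int[OF sM idl_subsp[OF Z(1)]]
  show ?thesis
  proof (rule idlI[OF sN])
    fix x t assume x: "x \<in> carrier L" and t: "t \<in> M \<inter> ?Z"
    obtain a m where xw: "a \<in> A" "m \<in> M" "x = a \<oplus> m" using x unfolding M'(2)[symmetric] mem_sum by blast
    note cl = subsp_closed[OF s(1) xw(1)] subsp_closed[OF sM xw(2)] subsp_closed[OF sN t]
    have "t \<otimes> a \<in> B" using t xw by (simp add: centralizer_def)
    then have "a \<otimes> t \<in> M" using bracket_anti[OF cl(1,3)] subsp_neg[OF s(2)] M'(3) by auto
    moreover have "m \<otimes> t \<in> M" using subalg_bracket[OF M'(1) xw(2)] t by simp
    moreover have "x \<otimes> t = a \<otimes> t \<oplus> m \<otimes> t" using xw cl by (simp add: bracket_add_left)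
    ultimately have "x \<otimes> t \<in> M" using subsp_add[OF sM] by simp
    then show "x \<otimes> t \<in> M \<inter> ?Z" using idl_left[OF Z(1) x] t by simp
  qed
qed

text \<open>A maximal complement that does not contain the centralizer gives a primitive quotient with
  two minimal ideals, and the diagonal position of the complement yields an equivalence.\<close>

lemma maximal_complement_equiv:
  assumes ch: "chief A B" and na: "\<not> abelian_factor A B" and M: "compl A B M"
    and max: "maximal_subalgebra K L M" and ZM: "\<not> centralizer A B \<subseteq> M"
  shows "\<exists>\<phi> \<delta> N. equiv_data \<phi> \<delta> A B (centralizer A B) N \<and> chief (centralizer A B) N \<and>
    \<not> abelian_factor (centralizer A B) N \<and> A \<subseteq> centralizer (centralizer A B) N"
proof -
  let ?Z = "centralizer A B"
  define N where "N = M \<inter> ?Z"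
  note i = chief_idl[OF ch] and s = chief_subsp[OF ch]
  note Z = centralizer_props[OF ch na]
  note sZ = idl_subsp[OF Z(1)]
  have M': "subalg M" "A \<boxplus> M = carrier L" "A \<inter> M = B" using M by (auto simp: compl_def)
  have sM: "subsp M" using M'(1) subalg_subsp by blast
  have sN: "subsp N" unfolding N_def using subsp_Int[OF sM sZ] .
  have Ac: "a \<in> carrier L" if "a \<in> A" for a using subsp_closed[OF s(1) that] .
  have Zc: "a \<in> carrier L" if "a \<in> ?Z" for a using subsp_closed[OF sZ that] .
  have BN: "B \<subseteq> N" using M'(3) Z(2) by (auto simp: N_def)
  have ZA: "z \<otimes> a \<in> B" "a \<otimes> z \<in> B" if "z \<in> ?Z" "a \<in> A" for z a
  proof -
    show 1: "z \<otimes> a \<in> B" using that by (simp add: centralizer_def)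
    show "a \<otimes> z \<in> B" using bracket_anti[OF Ac[OF that(2)] Zc[OF that(1)]] subsp_neg[OF s(2) 1] by simp
  qed
  have iN: "idl N" unfolding N_def by (rule idl_complement_Int_centralizer[OF ch na M])
  have ZML: "?Z \<boxplus> M = carrier L" by (rule maximal_sum_ideal[OF max Z(1) ZM])
  \<comment> \<open>As L = Z + M, every x can be moved into M by adding an element of Z, which is
    unique modulo N = M \<inter> Z. Each rule for \<delta> thus follows by checking that the
    proposed value moves its argument into M.\<close>
  define \<delta> where "\<delta> x = (SOME z. z \<in> ?Z \<and> x \<oplus> z \<in> M)" for x
  have ex: "\<exists>z. z \<in> ?Z \<and> x \<oplus> z \<in> M" if x: "x \<in> carrier L" for x
  proof -
    obtain z m where zm: "z \<in> ?Z" "m \<in> M" "x = z \<oplus> m" using x unfolding ZML[symmetric] mem_sum by blast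
    have "x \<oplus> (\<ominus> z) = m" using zm Zc[OF zm(1)] subsp_closed[OF sM zm(2)] by (simp add: lin_simps)
    then show ?thesis using zm subsp_neg[OF sZ zm(1)] by metis
  qed
  have dl: "\<delta> x \<in> ?Z" "x \<oplus> \<delta> x \<in> M" if "x \<in> carrier L" for x
    using someI_ex[OF ex[OF that]] by (simp_all add: \<delta>_def)
  have char: "eqm N (\<delta> x) z" if x: "x \<in> carrier L" and z: "z \<in> ?Z" "x \<oplus> z \<in> M" for x z
  proof -
    have cl: "\<delta> x \<in> carrier L" "z \<in> carrier L" using dl(1)[OF x] z Zc by auto
    have "\<delta> x \<ominus> z = (x \<oplus> \<delta> x) \<ominus> (x \<oplus> z)" using x cl by (simp add: lin_simps)
    then have "\<delta> x \<ominus> z \<in> M" using subsp_minus[OF sM] dl(2)[OF x] z by simp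
    then show ?thesis using cl subsp_minus[OF sZ dl(1)[OF x] z(1)] by (simp add: eqm_def N_def)
  qed
  have lin: "linear_mod (carrier L) ?Z N \<delta>" unfolding linear_mod_def
  proof (intro conjI ballI)
    fix x y assume x: "x \<in> carrier L" and y: "y \<in> carrier L"
    have "(x \<oplus> y) \<oplus> (\<delta> x \<oplus> \<delta> y) = (x \<oplus> \<delta> x) \<oplus> (y \<oplus> \<delta> y)"
      using x y dl(1) Zc by (simp add: M.a_ac)
    then have "(x \<oplus> y) \<oplus> (\<delta> x \<oplus> \<delta> y) \<in> M" using subsp_add[OF sM] dl(2) x y by simp
    then show "eqm N (\<delta> (x \<oplus> y)) (\<delta> x \<oplus> \<delta> y)" using x y subsp_add[OF sZ] dl(1) by (intro char) auto
  next
    fix k x assume k: "k \<in> carrier K" and x: "x \<in> carrier L"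
    have "k \<odot> x \<oplus> k \<odot> \<delta> x = k \<odot> (x \<oplus> \<delta> x)" using k x dl(1) Zc by (simp add: smult_r_distr)
    then have "k \<odot> x \<oplus> k \<odot> \<delta> x \<in> M" using subsp_smult[OF sM k] dl(2) x by simp
    then show "eqm N (\<delta> (k \<odot> x)) (k \<odot> \<delta> x)" using k x subsp_smult[OF sZ k] dl(1) by (intro char) auto
  qed (use dl(1) in auto)
  have dc: "\<delta> x \<in> carrier L" if "x \<in> carrier L" for x using Zc dl(1)[OF that] .
  have coc: "eqm N (\<delta> (x \<otimes> y)) ((x \<otimes> \<delta> y \<ominus> y \<otimes> \<delta> x) \<oplus> \<delta> x \<otimes> \<delta> y)"
    if x: "x \<in> carrier L" and y: "y \<in> carrier L" for x y
  proof (rule char)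
    show "x \<otimes> \<delta> y \<ominus> y \<otimes> \<delta> x \<oplus> \<delta> x \<otimes> \<delta> y \<in> ?Z"
      using x y dl(1) dc idl_left[OF Z(1)] by (intro subsp_add[OF sZ] subsp_minus[OF sZ]) auto
    have "y \<otimes> \<delta> x = \<ominus> (\<delta> x \<otimes> y)" using bracket_anti[OF y dc[OF x]] .
    then have "x \<otimes> y \<oplus> ((x \<otimes> \<delta> y \<ominus> y \<otimes> \<delta> x) \<oplus> \<delta> x \<otimes> \<delta> y) = (x \<oplus> \<delta> x) \<otimes> (y \<oplus> \<delta> y)"
      using x y dc by (simp add: bracket_add_left bracket_add_right M.minus_eq M.a_ac)
    then show "x \<otimes> y \<oplus> ((x \<otimes> \<delta> y \<ominus> y \<otimes> \<delta> x) \<oplus> \<delta> x \<otimes> \<delta> y) \<in> M"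
      using subalg_bracket[OF M'(1)] dl(2) x y by simp
  qed (use x y in auto)
  \<comment> \<open>For a in A the mixed term a \<otimes> \<delta> x lies in B \<subseteq> N,
    because Z centralizes A/B. Dropping it from the crossed rule gives the compatibility needed for
    \<delta> to serve as \<phi> as well.\<close>
  have comp: "eqm N (\<delta> (x \<otimes> a)) (x \<otimes> \<delta> a \<oplus> \<delta> x \<otimes> \<delta> a)" if x: "x \<in> carrier L" and a: "a \<in> A" for x a
  proof -
    note ac = Ac[OF a]
    have "eqm N (a \<otimes> \<delta> x) \<zero>" unfolding eqm_zero[OF sN] using ZA(2)[OF dl(1)[OF x] a] BN by blast
    then have "eqm N (x \<otimes> \<delta> a \<ominus> a \<otimes> \<delta> x \<oplus> \<delta> x \<otimes> \<delta> a) (x \<otimes> \<delta> a \<ominus> \<zero> \<oplus> \<delta> x \<otimes> \<delta> a)"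
      using x ac dc by (intro eqm_add[OF sN] eqm_minus[OF sN] eqm_refl[OF sN]) auto
    then show ?thesis using eqm_trans[OF sN coc[OF x ac]] x ac dc by (simp add: M.minus_eq)
  qed
  have hom: "eqm N (\<delta> (a \<otimes> b)) (\<delta> a \<otimes> \<delta> b)" if a: "a \<in> A" and b: "b \<in> A" for a b
  proof -
    note ac = Ac[OF a] Ac[OF b]
    have "eqm N (a \<otimes> \<delta> b) \<zero>" unfolding eqm_zero[OF sN] using ZA(2)[OF dl(1)[OF ac(2)] a] BN by blast
    then have "eqm N (a \<otimes> \<delta> b \<oplus> \<delta> a \<otimes> \<delta> b) (\<zero> \<oplus> \<delta> a \<otimes> \<delta> b)"
      using ac dc by (intro eqm_add[OF sN] eqm_refl[OF sN]) auto
    then show ?thesis using eqm_trans[OF sN comp[OF ac(1) b]] ac dc by simp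
  qed
  have ker: "\<delta> a \<in> N \<longleftrightarrow> a \<in> B" if a: "a \<in> A" for a
  proof
    note ac = Ac[OF a]
    assume "\<delta> a \<in> N"
    then have "a \<in> M" using subsp_add_cancel2[OF sM _ ac dl(2)[OF ac]] by (auto simp: N_def)
    then show "a \<in> B" using a M'(3) by blast
  next
    assume "a \<in> B"
    then have "eqm N (\<delta> a) \<zero>" using Ac[OF a] M'(3) subsp_zero[OF sZ] by (intro char) auto
    then show "\<delta> a \<in> N" using eqm_zero[OF sN] by blast
  qed
  have surj: "\<exists>a\<in>A. eqm N (\<delta> a) z" if z: "z \<in> ?Z" for z
  proof -
    obtain a m where am: "a \<in> A" "m \<in> M" "z = a \<oplus> m"
      using Zc[OF z] unfolding M'(2)[symmetric] mem_sum by blast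
    have "\<ominus> a \<oplus> z = m" using am Ac[OF am(1)] subsp_closed[OF sM am(2)] by (simp add: lin_simps)
    then have "eqm N (\<delta> (\<ominus> a)) z" using am Ac z by (intro char) auto
    then show ?thesis using am subsp_neg[OF s(1)] by blast
  qed
  have lin': "linear_mod A ?Z N \<delta>" using lin Ac by (simp add: linear_mod_def)
  have d: "equiv_data \<delta> \<delta> A B ?Z N"
    unfolding equiv_data_def using lin lin' coc comp hom ker surj by blast
  have AC: "A \<subseteq> centralizer ?Z N" using ZA(2) BN Ac by (auto simp: centralizer_def)
  note D = equiv_dataD[OF d]
  have chZ: "chief ?Z N" unfolding chief_def
  proof (intro conjI allI impI)
    show "N \<subset> ?Z" using ZM by (auto simp: N_def)
  next
    fix J assume J: "idl J \<and> N \<subseteq> J \<and> J \<subseteq> ?Z"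
    then have iJ: "idl J" and NJ: "N \<subseteq> J" and JZ: "J \<subseteq> ?Z" by auto
    note sJ = idl_subsp[OF iJ]
    note mem = eqm_mem[OF sJ NJ]
    \<comment> \<open>Ideals between N and Z are pulled back along \<delta> to ideals between B and
      A, so minimality passes from A/B to Z/N.\<close>
    define P where "P = {a \<in> A. \<delta> a \<in> J}"
    have BP: "B \<subseteq> P" using i(3) ker NJ by (auto simp: P_def)
    have sP: "subsp P"
      using mem[OF D(3)] mem[OF D(4)] subsp_add[OF sJ] subsp_smult[OF sJ] subsetD[OF BP subsp_zero[OF s(2)]]
        subsp_add[OF s(1)] subsp_smult[OF s(1)] Ac
      by (intro subspI) (auto simp: P_def)
    have "idl P"
    proof (rule idlI[OF sP])
      fix x a assume x: "x \<in> carrier L" and a: "a \<in> P"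
      then have a': "a \<in> A" "\<delta> a \<in> J" by (auto simp: P_def)
      have "x \<otimes> \<delta> a \<oplus> \<delta> x \<otimes> \<delta> a \<in> J"
        using subsp_add[OF sJ] idl_left[OF iJ x a'(2)] idl_left[OF iJ dc[OF x] a'(2)] by blast
      then show "x \<otimes> a \<in> P" using mem[OF D(9)[OF x a'(1)]] idl_left[OF i(1) x a'(1)] by (simp add: P_def)
    qed
    then have "P = B \<or> P = A" by (rule chiefD[OF ch _ BP]) (auto simp: P_def)
    then show "J = N \<or> J = ?Z"
    proof
      assume P: "P = B"
      have "J \<subseteq> N"
      proof
        fix z assume z: "z \<in> J"
        then obtain a where a: "a \<in> A" "eqm N (\<delta> a) z" using D(11) JZ by blast
        then have "a \<in> P" using mem z by (auto simp: P_def)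
        then have "\<delta> a \<in> N" using P ker a by blast
        then show "z \<in> N" using eqm_mem[OF sN subset_refl a(2)] by blast
      qed
      then show ?thesis using NJ by blast
    next
      assume P: "P = A"
      have "?Z \<subseteq> J"
      proof
        fix z assume z: "z \<in> ?Z"
        then obtain a where a: "a \<in> A" "eqm N (\<delta> a) z" using D(11) by blast
        then show "z \<in> J" using mem[OF a(2)] P by (auto simp: P_def)
      qed
      then show ?thesis using JZ by blast
    qed
  qed (use Z(1) iN in auto)
  have "\<not> abelian_factor ?Z N"
  proof
    assume ab: "abelian_factor ?Z N"
    have "a \<otimes> b \<in> B" if ab': "a \<in> A" "b \<in> A" for a b
    proof -
      have "\<delta> a \<otimes> \<delta> b \<in> N" using ab D(1) ab' by (auto simp: abelian_factor_def)
      then have "\<delta> (a \<otimes> b) \<in> N" using eqm_mem[OF sN subset_refl D(7)[OF ab']] by blast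
      then show ?thesis using ker idl_left[OF i(1) Ac[OF ab'(1)] ab'(2)] by blast
    qed
    then show False using na by (auto simp: abelian_factor_def)
  qed
  then show ?thesis using d chZ AC by blast
qed

end

section \<open>Quotients\<close>

context lie_alg begin

lemma coset_mem: "x \<in> carrier L \<Longrightarrow> subsp B \<Longrightarrow> y \<in> B +> x \<longleftrightarrow> eqm B y x"
proof -
  assume x: "x \<in> carrier L" and B: "subsp B"
  have "\<exists>b\<in>B. y = b \<oplus> x" if "y \<in> carrier L" "y \<ominus> x \<in> B"
    using that x by (intro bexI[of _ "y \<ominus> x"]) (simp_all add: lin_simps)
  moreover have "eqm B (b \<oplus> x) x" if "b \<in> B" for b
    using that x subsp_closed[OF B that] by (simp add: eqm_def lin_simps)
  ultimately show ?thesis by (auto simp: a_r_coset_def' eqm_def)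
qed

lemma coset_eq:
  assumes x: "x \<in> carrier L" and y: "y \<in> carrier L" and B: "subsp B"
  shows "B +> x = B +> y \<longleftrightarrow> eqm B x y"
proof
  assume "B +> x = B +> y"
  then show "eqm B x y" using coset_mem[OF x B] coset_mem[OF y B] eqm_refl[OF B x] by blast
next
  assume "eqm B x y"
  then show "B +> x = B +> y"
    using coset_mem[OF x B] coset_mem[OF y B] eqm_trans[OF B] eqm_sym[OF B] by blast
qed

lemma coset_self: "x \<in> carrier L \<Longrightarrow> subsp B \<Longrightarrow> x \<in> B +> x"
  using coset_mem eqm_refl by blast

lemma coset_zero: "subsp B \<Longrightarrow> B +> \<zero> = B"
  using coset_mem[OF M.zero_closed, of B] eqm_zero[of B] by blast

lemma coset_eq_zero: "subsp B \<Longrightarrow> x \<in> carrier L \<Longrightarrow> B +> x = B \<longleftrightarrow> x \<in> B"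
  using coset_eq[of x \<zero> B] eqm_zero[of B x] coset_zero[of B] by simp

definition coset_scale :: "'a set \<Rightarrow> 'k \<Rightarrow> 'a set \<Rightarrow> 'a set" where
  "coset_scale B k S = (\<Union>x\<in>S. B +> (k \<odot> x))"

lemma quot_simps:
  "carrier (lie_quot L B) = (\<lambda>x. B +> x) ` carrier L"
  "add (lie_quot L B) = set_add L"
  "monoid.mult (lie_quot L B) = rcoset_mult L B"
  "zero (lie_quot L B) = B"
  "smult (lie_quot L B) = coset_scale B"
  unfolding lie_quot_def by (auto simp: coset_scale_def fun_eq_iff ring.defs module.defs FactRing_def A_RCOSETS_def')

text \<open>The operations of a quotient record act on cosets without consulting the carrier of L,
  so restricting L to A before dividing by B changes only the carrier.\<close>

lemma factor_eq: "factor L A B = (lie_quot L B)\<lparr>carrier := (\<lambda>x. B +> x) ` A\<rparr>"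
  unfolding factor_def lie_quot_def
  by (auto simp: ring.defs module.defs FactRing_def A_RCOSETS_def' a_r_coset_def' rcoset_mult_def
      set_add_def' fun_eq_iff)

lemma factor_simps:
  "carrier (factor L A B) = (\<lambda>x. B +> x) ` A"
  "add (factor L A B) = set_add L"
  "monoid.mult (factor L A B) = rcoset_mult L B"
  "zero (factor L A B) = B"
  "smult (factor L A B) = coset_scale B"
  by (simp_all add: factor_eq quot_simps)

lemma coset_add:
  assumes B: "subsp B" and x: "x \<in> carrier L" and y: "y \<in> carrier L"
  shows "(B +> x) \<boxplus> (B +> y) = B +> (x \<oplus> y)"
proof
  show "(B +> x) \<boxplus> (B +> y) \<subseteq> B +> (x \<oplus> y)"
    using coset_mem[OF _ B] eqm_add[OF B] x y by (auto simp: mem_sum)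
  show "B +> (x \<oplus> y) \<subseteq> (B +> x) \<boxplus> (B +> y)"
  proof
    fix z assume "z \<in> B +> (x \<oplus> y)"
    then have z: "eqm B z (x \<oplus> y)" using coset_mem[OF _ B] x y by simp
    then have zc: "z \<in> carrier L" by (simp add: eqm_def)
    have "z = (z \<ominus> y) \<oplus> y" using zc y by (simp add: lin_simps)
    moreover have "eqm B (z \<ominus> y) x"
    proof -
      have "(z \<ominus> y) \<ominus> x = z \<ominus> (x \<oplus> y)" using zc x y by (simp add: lin_simps)
      then show ?thesis using z x y by (simp add: eqm_def)
    qed
    ultimately show "z \<in> (B +> x) \<boxplus> (B +> y)"
      using coset_mem[OF x B] coset_self[OF y B] sumI by metis
  qed
qed

lemma coset_bracket:
  assumes B: "idl B" and x: "x \<in> carrier L" and y: "y \<in> carrier L"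
  shows "rcoset_mult L B (B +> x) (B +> y) = B +> (x \<otimes> y)"
proof -
  note s = idl_subsp[OF B]
  have "B +> (a \<otimes> b) = B +> (x \<otimes> y)" if "a \<in> B +> x" "b \<in> B +> y" for a b
  proof -
    have ab: "eqm B a x" "eqm B b y" using that coset_mem s x y by auto
    have "eqm B (a \<otimes> b) (x \<otimes> y)" by (rule eqm_bracket[OF B ab])
    then show ?thesis using coset_eq[OF _ _ s] eqm_closed by blast
  qed
  then show ?thesis unfolding rcoset_mult_def using coset_self[OF x s] coset_self[OF y s] by blast
qed

text \<open>If f respects congruence modulo B, all representatives give the same coset and the union
  collapses. Scalar multiplication and the action of L on a factor both have this shape.\<close>

lemma coset_map:
  assumes B: "subsp B" and x: "x \<in> carrier L"
    and f: "\<And>a. eqm B a x \<Longrightarrow> eqm B (f a) (f x)"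
  shows "(\<Union>a\<in>B +> x. B +> f a) = B +> f x"
proof -
  have "B +> f a = B +> f x" if "a \<in> B +> x" for a
    using f[of a] that coset_mem[OF x B] coset_eq[OF _ _ B] eqm_closed by blast
  then show ?thesis using coset_self[OF x B] by blast
qed

lemma coset_smult:
  assumes "subsp B" "x \<in> carrier L" "k \<in> carrier K"
  shows "coset_scale B k (B +> x) = B +> (k \<odot> x)"
  unfolding coset_scale_def by (rule coset_map[OF assms(1,2)]) (rule eqm_smult[OF assms(1) _ assms(3)])

lemma coset_action:
  assumes B: "idl B" and a: "a \<in> carrier L" and x: "x \<in> carrier L"
  shows "factor_action L B x (B +> a) = B +> (x \<otimes> a)"
  unfolding factor_action_def
  by (rule coset_map[OF idl_subsp[OF B] a]) (rule eqm_bracket[OF B eqm_refl[OF idl_subsp[OF B] x]])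

lemma field_K: "field K"
  using lie_algebra.axioms(1)[OF is_lie_algebra] .

lemma lie_algebra_quot:
  assumes B: "idl B" shows "lie_algebra K (lie_quot L B)"
proof -
  note s = idl_subsp[OF B]
  note op = coset_add[OF s] coset_bracket[OF B] coset_smult[OF s]
  have ab: "abelian_group (lie_quot L B)"
  proof (rule abelian_groupI)
    fix x assume "x \<in> carrier (lie_quot L B)"
    then obtain a where a: "a \<in> carrier L" "x = B +> a" by (auto simp: quot_simps)
    then have "(B +> (\<ominus> a)) \<boxplus> x = B" using op(1)[of "\<ominus> a" a] coset_zero[OF s] by (simp add: M.l_neg)
    then show "\<exists>y\<in>carrier (lie_quot L B). y \<oplus>\<^bsub>lie_quot L B\<^esub> x = \<zero>\<^bsub>lie_quot L B\<^esub>"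
      using a by (auto simp: quot_simps)
    show "\<zero>\<^bsub>lie_quot L B\<^esub> \<oplus>\<^bsub>lie_quot L B\<^esub> x = x"
      using op(1)[OF M.zero_closed a(1)] a coset_zero[OF s] by (simp add: quot_simps)
  qed (use coset_zero[OF s] in \<open>auto simp: quot_simps op M.a_ac image_iff intro: bexI[of _ \<zero>]\<close>)
  have mod: "module K (lie_quot L B)"
  proof (rule moduleI)
    show "cring K" using field_K by (simp add: field_def domain_def)
  qed (use ab in \<open>auto simp: quot_simps op smult_l_distr smult_r_distr smult_assoc1\<close>)
  show ?thesis
  proof (intro lie_algebra.intro field_K mod lie_algebra_axioms.intro)
    fix x y assume "x \<in> carrier (lie_quot L B)" "y \<in> carrier (lie_quot L B)"
    then obtain a b where *: "a \<in> carrier L" "x = B +> a" "b \<in> carrier L" "y = B +> b"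
      by (auto simp: quot_simps)
    then show "x \<otimes>\<^bsub>lie_quot L B\<^esub> y \<in> carrier (lie_quot L B)" by (simp add: quot_simps op)
    show "x \<otimes>\<^bsub>lie_quot L B\<^esub> x = \<zero>\<^bsub>lie_quot L B\<^esub>"
      using * coset_zero[OF s] by (simp add: quot_simps op bracket_self)
    fix k assume k: "k \<in> carrier K"
    show "(k \<odot>\<^bsub>lie_quot L B\<^esub> x) \<otimes>\<^bsub>lie_quot L B\<^esub> y = k \<odot>\<^bsub>lie_quot L B\<^esub> (x \<otimes>\<^bsub>lie_quot L B\<^esub> y)"
      using * k by (simp add: quot_simps op bracket_smult_left)
    show "x \<otimes>\<^bsub>lie_quot L B\<^esub> (k \<odot>\<^bsub>lie_quot L B\<^esub> y) = k \<odot>\<^bsub>lie_quot L B\<^esub> (x \<otimes>\<^bsub>lie_quot L B\<^esub> y)"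
      using * k by (simp add: quot_simps op bracket_smult_right)
  next
    fix x y z assume "x \<in> carrier (lie_quot L B)" "y \<in> carrier (lie_quot L B)" "z \<in> carrier (lie_quot L B)"
    then obtain a b c where *: "a \<in> carrier L" "x = B +> a" "b \<in> carrier L" "y = B +> b"
      "c \<in> carrier L" "z = B +> c" by (auto simp: quot_simps)
    then show "x \<otimes>\<^bsub>lie_quot L B\<^esub> (y \<otimes>\<^bsub>lie_quot L B\<^esub> z) \<oplus>\<^bsub>lie_quot L B\<^esub> y \<otimes>\<^bsub>lie_quot L B\<^esub> (z \<otimes>\<^bsub>lie_quot L B\<^esub> x) \<oplus>\<^bsub>lie_quot L B\<^esub>
        z \<otimes>\<^bsub>lie_quot L B\<^esub> (x \<otimes>\<^bsub>lie_quot L B\<^esub> y) = \<zero>\<^bsub>lie_quot L B\<^esub>"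
      using jacobi[of a b c] coset_zero[OF s] by (simp add: quot_simps op)
    show "(x \<oplus>\<^bsub>lie_quot L B\<^esub> y) \<otimes>\<^bsub>lie_quot L B\<^esub> z = (x \<otimes>\<^bsub>lie_quot L B\<^esub> z) \<oplus>\<^bsub>lie_quot L B\<^esub> (y \<otimes>\<^bsub>lie_quot L B\<^esub> z)"
      using * by (simp add: quot_simps op bracket_add_left)
    show "x \<otimes>\<^bsub>lie_quot L B\<^esub> (y \<oplus>\<^bsub>lie_quot L B\<^esub> z) = (x \<otimes>\<^bsub>lie_quot L B\<^esub> y) \<oplus>\<^bsub>lie_quot L B\<^esub> (x \<otimes>\<^bsub>lie_quot L B\<^esub> z)"
      using * by (simp add: quot_simps op bracket_add_right)
  qed
qed

lemma lie_algebra_restrict: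
  assumes H: "subalg H" shows "lie_algebra K (L\<lparr>carrier := H\<rparr>)"
proof -
  note s = subalg_subsp[OF H]
  have "module K (L\<lparr>carrier := H\<rparr>)"
    using submodule.submodule_is_module[OF s] is_lie_algebra lie_algebra.axioms(2) by blast
  then show ?thesis
    using subalg_bracket[OF H] subsp_closed[OF s]
    by (intro lie_algebra.intro field_K lie_algebra_axioms.intro)
      (auto simp: bracket_add_left bracket_add_right bracket_smult_left bracket_smult_right bracket_self jacobi)
qed

section \<open>The correspondence between L/B and the subspaces of L above B\<close>

definition preim :: "'a set \<Rightarrow> 'a set set \<Rightarrow> 'a set" where
  "preim B J = {x \<in> carrier L. B +> x \<in> J}"

abbreviation coset_image :: "'a set \<Rightarrow> 'a set \<Rightarrow> 'a set set" where
  "coset_image B A \<equiv> (\<lambda>x. B +> x) ` A"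

lemma image_subset_iff_quot:
  assumes B: "subsp B" and A: "subsp A" "B \<subseteq> A" and C: "C \<subseteq> carrier L"
  shows "coset_image B C \<subseteq> coset_image B A \<longleftrightarrow> C \<subseteq> A"
proof
  assume *: "coset_image B C \<subseteq> coset_image B A"
  show "C \<subseteq> A"
  proof
    fix x assume x: "x \<in> C"
    then obtain a where a: "a \<in> A" "B +> x = B +> a" using * by blast
    have "eqm B x a" using coset_eq[of x a B] a x C B subsp_closed[OF A(1) a(1)] by blast
    then show "x \<in> A" using eqm_mem[OF A] a(1) by blast
  qed
qed blast

lemma coset_image_mem:
  assumes "subsp B" "subsp A" "B \<subseteq> A" "x \<in> carrier L"
  shows "B +> x \<in> coset_image B A \<longleftrightarrow> x \<in> A"
  using image_subset_iff_quot[OF assms(1-3), of "{x}"] assms(4) by simp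

lemma image_preim: "J \<subseteq> carrier (lie_quot L B) \<Longrightarrow> coset_image B (preim B J) = J"
  by (auto simp: preim_def quot_simps)

lemma subsp_quot_image:
  assumes B: "idl B" and A: "subsp A" shows "submodule (coset_image B A) K (lie_quot L B)"
proof -
  interpret Q: lie_alg "lie_quot L B" K using lie_algebra_quot[OF B] by (simp add: lie_alg_def)
  note s = idl_subsp[OF B]
  note cl = subsp_closed[OF A]
  note op = coset_add[OF s] coset_smult[OF s]
  show ?thesis
  proof (rule Q.subspI)
    show "\<zero>\<^bsub>lie_quot L B\<^esub> \<in> coset_image B A"
      using coset_zero[OF s] subsp_zero[OF A] by (auto simp: quot_simps image_iff intro: bexI[of _ \<zero>])
  qed (use cl subsp_add[OF A] subsp_smult[OF A] in \<open>auto simp: quot_simps op\<close>)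
qed

lemma subalg_quot_image:
  assumes B: "idl B" and A: "subalg A" shows "lie_subalgebra K (lie_quot L B) (coset_image B A)"
  using subsp_quot_image[OF B subalg_subsp[OF A]] subsp_closed[OF subalg_subsp[OF A]] subalg_bracket[OF A]
  by (auto simp: lie_subalgebra_def quot_simps coset_bracket[OF B])

lemma idl_quot_image:
  assumes B: "idl B" and A: "idl A" shows "lie_ideal K (lie_quot L B) (coset_image B A)"
  using subsp_quot_image[OF B idl_subsp[OF A]] subsp_closed[OF idl_subsp[OF A]] idl_left[OF A]
  by (auto simp: lie_ideal_def quot_simps coset_bracket[OF B])

lemma subsp_preim:
  assumes B: "idl B" and J: "submodule J K (lie_quot L B)"
  shows "subsp (preim B J)" "B \<subseteq> preim B J" "J \<subseteq> carrier (lie_quot L B)"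
proof -
  interpret Q: lie_alg "lie_quot L B" K using lie_algebra_quot[OF B] by (simp add: lie_alg_def)
  note s = idl_subsp[OF B]
  have BJ: "B \<in> J" using Q.subsp_zero[OF J] by (simp add: quot_simps)
  show "B \<subseteq> preim B J" 
  proof
    fix x assume x: "x \<in> B"
    then have "B +> x = B" using coset_eq_zero[OF s subsp_closed[OF s x]] by simp
    then show "x \<in> preim B J" using BJ subsp_closed[OF s x] by (simp add: preim_def)
  qed
  have "B +> (x \<oplus> y) \<in> J" if "x \<in> carrier L" "y \<in> carrier L" "B +> x \<in> J" "B +> y \<in> J" for x y
    using Q.subsp_add[OF J that(3,4)] that coset_add[OF s] by (simp add: quot_simps)
  moreover have "B +> (k \<odot> x) \<in> J" if "x \<in> carrier L" "k \<in> carrier K" "B +> x \<in> J" for x k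
    using Q.subsp_smult[OF J that(2,3)] that coset_smult[OF s] by (simp add: quot_simps)
  ultimately show "subsp (preim B J)"
    using coset_zero[OF s] BJ by (intro subspI) (auto simp: preim_def)
  show "J \<subseteq> carrier (lie_quot L B)" using Q.subsp_subset[OF J] .
qed

lemma subalg_preim:
  assumes B: "idl B" and J: "lie_subalgebra K (lie_quot L B) J"
  shows "subalg (preim B J)"
proof (rule subalgI)
  have sJ: "submodule J K (lie_quot L B)" using J by (simp add: lie_subalgebra_def)
  show "subsp (preim B J)" using subsp_preim[OF B sJ] by blast
  fix x y assume "x \<in> preim B J" "y \<in> preim B J"
  then have *: "x \<in> carrier L" "y \<in> carrier L" "B +> x \<in> J" "B +> y \<in> J" by (auto simp: preim_def)
  then have "rcoset_mult L B (B +> x) (B +> y) \<in> J" using J by (simp add: lie_subalgebra_def quot_simps)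
  then show "x \<otimes> y \<in> preim B J" using * coset_bracket[OF B] by (simp add: preim_def)
qed

lemma idl_preim:
  assumes B: "idl B" and J: "lie_ideal K (lie_quot L B) J"
  shows "idl (preim B J)"
proof (rule idlI)
  have sJ: "submodule J K (lie_quot L B)" using J by (simp add: lie_ideal_def)
  show "subsp (preim B J)" using subsp_preim[OF B sJ] by blast
  fix x y assume "x \<in> carrier L" "y \<in> preim B J"
  then have *: "x \<in> carrier L" "y \<in> carrier L" "B +> y \<in> J" by (auto simp: preim_def)
  then have "rcoset_mult L B (B +> x) (B +> y) \<in> J" using J by (simp add: lie_ideal_def quot_simps)
  then show "x \<otimes> y \<in> preim B J" using * coset_bracket[OF B] by (simp add: preim_def)
qed

lemma quot_ideal_cases:
  assumes B: "idl B" and J: "lie_ideal K (lie_quot L B) J"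
  obtains A where "idl A" "B \<subseteq> A" "J = coset_image B A"
proof
  have sJ: "submodule J K (lie_quot L B)" using J by (simp add: lie_ideal_def)
  show "idl (preim B J)" using idl_preim[OF assms] .
  show "B \<subseteq> preim B J" "J = coset_image B (preim B J)"
    using subsp_preim[OF B sJ] image_preim by auto
qed

lemma quot_subalgebra_cases:
  assumes B: "idl B" and J: "lie_subalgebra K (lie_quot L B) J"
  obtains A where "subalg A" "B \<subseteq> A" "J = coset_image B A"
proof
  have sJ: "submodule J K (lie_quot L B)" using J by (simp add: lie_subalgebra_def)
  show "subalg (preim B J)" using subalg_preim[OF assms] .
  show "B \<subseteq> preim B J" "J = coset_image B (preim B J)"
    using subsp_preim[OF B sJ] image_preim by auto
qed

lemma coset_image_eq_iff:
  assumes "subsp B" "subsp A" "B \<subseteq> A" "subsp C" "B \<subseteq> C"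
  shows "coset_image B A = coset_image B C \<longleftrightarrow> A = C"
  unfolding set_eq_subset image_subset_iff_quot[OF assms(1-3) subsp_subset[OF assms(4)]]
    image_subset_iff_quot[OF assms(1,4,5) subsp_subset[OF assms(2)]] ..

lemma coset_image_self: "subsp B \<Longrightarrow> coset_image B B = {B}"
  using coset_eq_zero[of B] subsp_closed[of B] subsp_zero[of B] by blast

lemma minimal_ideal_quot_iff:
  assumes A: "idl A" and B: "idl B" and BA: "B \<subseteq> A"
  shows "minimal_ideal K (lie_quot L B) (coset_image B A) \<longleftrightarrow> chief A B"
proof -
  note s = idl_subsp[OF A] idl_subsp[OF B]
  have z: "coset_image B C = {B} \<longleftrightarrow> C = B" if "idl C" "B \<subseteq> C" for C
    using coset_image_eq_iff[OF s(2) idl_subsp[OF that(1)] that(2) s(2) subset_refl] coset_image_self[OF s(2)] by simp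
  have e: "coset_image B C = coset_image B A \<longleftrightarrow> C = A" if "idl C" "B \<subseteq> C" for C
    using coset_image_eq_iff[OF s(2) idl_subsp[OF that(1)] that(2) s(1) BA] .
  have l: "coset_image B C \<subseteq> coset_image B A \<longleftrightarrow> C \<subseteq> A" if "idl C" for C
    using image_subset_iff_quot[OF s(2,1) BA subsp_subset[OF idl_subsp[OF that]]] .
  have i: "lie_ideal K (lie_quot L B) (coset_image B C)" if "idl C" for C
    using idl_quot_image[OF B that] .
  show ?thesis
  proof
    assume m: "minimal_ideal K (lie_quot L B) (coset_image B A)"
    have "A \<noteq> B" using m z[OF A BA] by (auto simp: minimal_ideal_def quot_simps)
    moreover have "J = B \<or> J = A" if J: "idl J" "B \<subseteq> J" "J \<subseteq> A" for J
    proof -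
      have "coset_image B J = {B} \<or> coset_image B J = coset_image B A"
        using m i[OF J(1)] l[OF J(1)] J(3) by (simp add: minimal_ideal_def quot_simps)
      then show ?thesis using z[OF J(1,2)] e[OF J(1,2)] by simp
    qed
    ultimately show "chief A B" using A B BA by (auto simp: chief_def)
  next
    assume ch: "chief A B"
    have "J = {B} \<or> J = coset_image B A"
      if J: "lie_ideal K (lie_quot L B) J" "J \<subseteq> coset_image B A" for J
    proof -
      obtain C where C: "idl C" "B \<subseteq> C" "J = coset_image B C" by (rule quot_ideal_cases[OF B J(1)])
      then have "C \<subseteq> A" using J(2) l[OF C(1)] by simp
      then show ?thesis using chiefD[OF ch C(1,2)] z[OF C(1,2)] C(3) by auto
    qed
    moreover have "coset_image B A \<noteq> {B}" using z[OF A BA] chief_idl(3)[OF ch] by auto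
    ultimately show "minimal_ideal K (lie_quot L B) (coset_image B A)"
      using i[OF A] by (simp add: minimal_ideal_def quot_simps)
  qed
qed

lemma chief_factor_iff: "chief_factor K L A B \<longleftrightarrow> chief A B"
proof
  assume "chief_factor K L A B"
  then show "chief A B"
    using minimal_ideal_quot_iff[of A B] by (auto simp: chief_factor_def factor_simps)
next
  assume ch: "chief A B"
  then show "chief_factor K L A B"
    using minimal_ideal_quot_iff[of A B] chief_idl[OF ch] by (auto simp: chief_factor_def factor_simps)
qed

lemma maximal_subalgebra_quot_iff:
  assumes B: "idl B" and M: "subalg M" "B \<subseteq> M"
  shows "maximal_subalgebra K (lie_quot L B) (coset_image B M) \<longleftrightarrow> maximal_subalgebra K L M"
proof -
  note s = idl_subsp[OF B] subalg_subsp[OF M(1)]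
  have BL: "B \<subseteq> carrier L" using subsp_subset[OF s(1)] .
  have l: "coset_image B M \<subseteq> coset_image B C \<longleftrightarrow> M \<subseteq> C" if "subalg C" "B \<subseteq> C" for C
    using image_subset_iff_quot[OF s(1) subalg_subsp[OF that(1)] that(2) subsp_subset[OF s(2)]] .
  have e: "coset_image B C = coset_image B D \<longleftrightarrow> C = D" if "subalg C" "B \<subseteq> C" "subalg D" "B \<subseteq> D" for C D
    using coset_image_eq_iff[OF s(1) subalg_subsp[OF that(1)] that(2) subalg_subsp[OF that(3)] that(4)] .
  have c: "coset_image B C = coset_image B (carrier L) \<longleftrightarrow> C = carrier L" if "subalg C" "B \<subseteq> C" for C
    using e[OF that idl_subalg[OF idl_carrier] BL] .
  show ?thesis
  proof
    assume m: "maximal_subalgebra K (lie_quot L B) (coset_image B M)"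
    have "M \<noteq> carrier L" using m by (auto simp: maximal_subalgebra_def quot_simps)
    moreover have "H = M \<or> H = carrier L" if H: "subalg H" "M \<subseteq> H" for H
    proof -
      have BH: "B \<subseteq> H" using M(2) H(2) by blast
      have "coset_image B H = coset_image B M \<or> coset_image B H = coset_image B (carrier L)"
        using m subalg_quot_image[OF B H(1)] l[OF H(1) BH] H(2) by (simp add: maximal_subalgebra_def quot_simps)
      then show ?thesis using e[OF H(1) BH M] c[OF H(1) BH] by simp
    qed
    ultimately show "maximal_subalgebra K L M" using M by (simp add: maximal_subalgebra_def)
  next
    assume m: "maximal_subalgebra K L M"
    have "J = coset_image B M \<or> J = coset_image B (carrier L)"
      if J: "lie_subalgebra K (lie_quot L B) J" "coset_image B M \<subseteq> J" for J
    proof -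
      obtain C where C: "subalg C" "B \<subseteq> C" "J = coset_image B C" by (rule quot_subalgebra_cases[OF B J(1)])
      then have "M \<subseteq> C" using J(2) l[OF C(1,2)] by simp
      then have "C = M \<or> C = carrier L" using m C(1) by (simp add: maximal_subalgebra_def)
      then show ?thesis using C(3) by auto
    qed
    moreover have "coset_image B M \<noteq> coset_image B (carrier L)"
      using c[OF M] m by (simp add: maximal_subalgebra_def)
    ultimately show "maximal_subalgebra K (lie_quot L B) (coset_image B M)"
      using subalg_quot_image[OF B M(1)] by (simp add: maximal_subalgebra_def quot_simps)
  qed
qed

end

context fd_lie_alg begin

text \<open>The greatest ideal in the definition exists: among the ideals above B contained in all
  maximal subalgebras above B, a maximal one H absorbs every other, since the sum of two of them is
  again one. The correspondence identifies H/B with the Frattini ideal of L/B.\<close>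

lemma frattini_factor_iff:
  "frattini_factor K L A B \<longleftrightarrow> chief A B \<and> (\<forall>M. maximal_subalgebra K L M \<and> B \<subseteq> M \<longrightarrow> A \<subseteq> M)"
proof (cases "chief A B")
  case ch: True
  note i = chief_idl[OF ch] and s = chief_subsp[OF ch]
  have BA: "B \<subseteq> A" using i(3) by blast
  define P where "P H \<longleftrightarrow> idl H \<and> B \<subseteq> H \<and> (\<forall>M. maximal_subalgebra K L M \<and> B \<subseteq> M \<longrightarrow> H \<subseteq> M)" for H
  have PB: "P B" using i by (simp add: P_def)
  obtain H where H: "P H" "B \<subseteq> H" and max: "\<And>H'. P H' \<Longrightarrow> H \<subseteq> H' \<Longrightarrow> H' = H"
    by (rule ex_maximal_subsp[of P B]) (use PB in \<open>auto simp: P_def lie_ideal_def\<close>)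
  have sH: "subsp H" using H(1) idl_subsp by (simp add: P_def)
  have great: "J \<subseteq> H" if J: "P J" for J
  proof -
    have sJ: "subsp J" using J idl_subsp by (simp add: P_def)
    have "P (J \<boxplus> H)" unfolding P_def
    proof (intro conjI allI impI)
      show "idl (J \<boxplus> H)" using J H idl_sum by (simp add: P_def)
      show "B \<subseteq> J \<boxplus> H" using H(2) sum_upper2[OF sJ sH] by blast
      fix M assume M: "maximal_subalgebra K L M \<and> B \<subseteq> M"
      then have "subsp M" by (simp add: maximal_subalgebra_def lie_subalgebra_def)
      then show "J \<boxplus> H \<subseteq> M" using M J H(1) by (intro sum_least) (auto simp: P_def)
    qed
    then have "J \<boxplus> H = H" using max sum_upper2[OF sJ sH] by blast
    then show ?thesis using sum_upper1[OF sJ sH] by simp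
  qed
  have Q: "lie_ideal K (lie_quot L B) (coset_image B J) \<and>
      (\<forall>N. maximal_subalgebra K (lie_quot L B) N \<longrightarrow> coset_image B J \<subseteq> N) \<longleftrightarrow> P J"
    if J: "idl J" "B \<subseteq> J" for J
  proof
    assume *: "lie_ideal K (lie_quot L B) (coset_image B J) \<and>
      (\<forall>N. maximal_subalgebra K (lie_quot L B) N \<longrightarrow> coset_image B J \<subseteq> N)"
    have "J \<subseteq> M" if M: "maximal_subalgebra K L M" "B \<subseteq> M" for M
    proof -
      have sM: "subalg M" using M by (simp add: maximal_subalgebra_def)
      have "coset_image B J \<subseteq> coset_image B M"
        using * maximal_subalgebra_quot_iff[OF i(2) sM M(2)] M(1) by simp
      then show ?thesis
        using image_subset_iff_quot[OF s(2) subalg_subsp[OF sM] M(2) subsp_subset[OF idl_subsp[OF J(1)]]] by simp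
    qed
    then show "P J" using J by (simp add: P_def)
  next
    assume PJ: "P J"
    have "coset_image B J \<subseteq> N" if N: "maximal_subalgebra K (lie_quot L B) N" for N
    proof -
      have "lie_subalgebra K (lie_quot L B) N" using N by (simp add: maximal_subalgebra_def)
      then obtain M where M: "subalg M" "B \<subseteq> M" "N = coset_image B M" by (rule quot_subalgebra_cases[OF i(2)])
      then have "J \<subseteq> M" using PJ N maximal_subalgebra_quot_iff[OF i(2) M(1,2)] by (simp add: P_def)
      then show ?thesis using M(3) by blast
    qed
    then show "lie_ideal K (lie_quot L B) (coset_image B J) \<and>
      (\<forall>N. maximal_subalgebra K (lie_quot L B) N \<longrightarrow> coset_image B J \<subseteq> N)"
      using idl_quot_image[OF i(2) J(1)] by blast
  qed
  have "frattini_ideal K (lie_quot L B) = coset_image B H"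
    unfolding frattini_ideal_def
  proof (rule Greatest_equality)
    show "lie_ideal K (lie_quot L B) (coset_image B H) \<and>
      (\<forall>N. maximal_subalgebra K (lie_quot L B) N \<longrightarrow> coset_image B H \<subseteq> N)"
      using Q H by (simp add: P_def)
  next
    fix N assume N: "lie_ideal K (lie_quot L B) N \<and>
      (\<forall>M. maximal_subalgebra K (lie_quot L B) M \<longrightarrow> N \<subseteq> M)"
    obtain J where J: "idl J" "B \<subseteq> J" "N = coset_image B J"
      using N by (blast elim: quot_ideal_cases[OF i(2)])
    then have "P J" using N Q[OF J(1,2)] by simp
    then show "N \<subseteq> coset_image B H" using great J(3) by blast
  qed
  then have "frattini_factor K L A B \<longleftrightarrow> coset_image B A \<subseteq> coset_image B H"
    using ch by (simp add: frattini_factor_def chief_factor_iff factor_simps)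
  also have "\<dots> \<longleftrightarrow> A \<subseteq> H" using image_subset_iff_quot[OF s(2) sH H(2) subsp_subset[OF s(1)]] .
  also have "\<dots> \<longleftrightarrow> P A"
  proof
    assume "A \<subseteq> H"
    then show "P A" using H(1) i(1) BA unfolding P_def by (meson subset_trans)
  qed (rule great)
  finally show ?thesis using ch i(1) BA by (simp add: P_def)
qed (simp add: frattini_factor_def chief_factor_iff)

text \<open>Every ideal properly above Z contains I by \<open>nonabelian_center_not_le\<close>. So
  I/Z is the only minimal ideal of L/Z, and a maximal supplement of I/Z, which exists because the
  factor is nonabelian, contains no ideal properly above Z.\<close>

lemma primitive_center:
  assumes n: "nonabelian_center I Z"
  shows "primitive_type2 K (lie_quot L Z)" "socle K (lie_quot L Z) = carrier (factor L I Z)"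
proof -
  have ch: "chief I Z" and na: "\<not> abelian_factor I Z" using n by (auto simp: nonabelian_center_def)
  note i = chief_idl[OF ch] and s = chief_subsp[OF ch]
  have ZI: "Z \<subseteq> I" using i(3) by blast
  have min: "minimal_ideal K (lie_quot L Z) S \<longleftrightarrow> S = coset_image Z I" for S
  proof
    assume m: "minimal_ideal K (lie_quot L Z) S"
    then have "lie_ideal K (lie_quot L Z) S" by (simp add: minimal_ideal_def)
    then obtain J where J: "idl J" "Z \<subseteq> J" "S = coset_image Z J" by (rule quot_ideal_cases[OF i(2)])
    then have "chief J Z" using m minimal_ideal_quot_iff[OF J(1) i(2) J(2)] by simp
    then show "S = coset_image Z I" using nonabelian_center_unique[OF n] J(3) by simp
  qed (use minimal_ideal_quot_iff[OF i(1,2) ZI] ch in simp)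
  obtain M where M: "maximal_subalgebra K L M" "Z \<subseteq> M" "I \<boxplus> M = carrier L"
    by (rule nonabelian_max_supplemented[OF ch na])
  have sM: "subalg M" "M \<noteq> carrier L" using M(1) by (simp_all add: maximal_subalgebra_def)
  have IM: "\<not> I \<subseteq> M"
  proof
    assume "I \<subseteq> M"
    then have "carrier L \<subseteq> M" using sum_least[OF subalg_subsp[OF sM(1)] _ subset_refl, of I] M(3) by simp
    then show False using sM(2) subsp_subset[OF subalg_subsp[OF sM(1)]] by simp
  qed
  have "H = {Z}" if H: "lie_ideal K (lie_quot L Z) H" "H \<subseteq> coset_image Z M" for H
  proof -
    obtain J where J: "idl J" "Z \<subseteq> J" "H = coset_image Z J" by (rule quot_ideal_cases[OF i(2) H(1)])
    have JM: "J \<subseteq> M"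
      using image_subset_iff_quot[OF s(2) subalg_subsp[OF sM(1)] M(2) subsp_subset[OF idl_subsp[OF J(1)]]] H(2) J(3)
      by simp
    have "J \<subseteq> Z"
    proof (rule ccontr)
      assume "\<not> J \<subseteq> Z"
      then have "\<not> J \<inter> I \<subseteq> Z" by (rule nonabelian_center_not_le[OF n J(1)])
      moreover have "J \<inter> I = Z \<or> J \<inter> I = I"
        by (rule chiefD[OF ch idl_Int[OF J(1) i(1)]]) (use J(2) ZI in auto)
      ultimately show False using JM IM by blast
    qed
    then have "J = Z" using J(2) by blast
    then show ?thesis using J(3) coset_image_self[OF s(2)] by simp
  qed
  moreover have "maximal_subalgebra K (lie_quot L Z) (coset_image Z M)"
    using maximal_subalgebra_quot_iff[OF i(2) sM(1) M(2)] M(1) by simp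
  ultimately have "primitive K (lie_quot L Z)" unfolding primitive_def by (auto simp: quot_simps)
  moreover have "nonabelian_on (lie_quot L Z) (coset_image Z I)"
  proof -
    obtain x y where xy: "x \<in> I" "y \<in> I" "x \<otimes> y \<notin> Z" using na by (auto simp: abelian_factor_def)
    note cl = subsp_closed[OF s(1) xy(1)] subsp_closed[OF s(1) xy(2)]
    have "rcoset_mult L Z (Z +> x) (Z +> y) \<noteq> Z"
      using xy cl coset_bracket[OF i(2)] coset_eq_zero[OF s(2)] by simp
    then show ?thesis using xy unfolding nonabelian_on_def by (auto simp: quot_simps)
  qed
  ultimately show "primitive_type2 K (lie_quot L Z)" by (auto simp: primitive_type2_def min)
  show "socle K (lie_quot L Z) = carrier (factor L I Z)"
    using subsp_quot_image[OF i(2) s(1)] by (auto simp: socle_def min factor_simps)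
qed

end

section \<open>The defined notions in terms of ideals and complements in L\<close>

context lie_alg begin

lemma nonabelian_on_iff:
  assumes A: "idl A" and B: "idl B"
  shows "nonabelian_on (factor L A B) (carrier (factor L A B)) \<longleftrightarrow> \<not> abelian_factor A B"
proof -
  note cl = subsp_closed[OF idl_subsp[OF A]]
  show ?thesis unfolding nonabelian_on_def abelian_factor_def
    using cl by (auto simp: factor_simps coset_bracket[OF B] coset_eq_zero[OF idl_subsp[OF B]])
qed

lemma complement_iff: "chief A B \<Longrightarrow> complement K L A B M \<longleftrightarrow> compl A B M"
  by (auto simp: complement_def supplement_def compl_def)

lemma c_factor_iff: "c_factor K L A B \<longleftrightarrow> chief A B \<and> complemented A B"
  by (auto simp: c_factor_def chief_factor_iff complemented_def complement_iff)

lemma c'_factor_iff: "c'_factor K L A B \<longleftrightarrow> chief A B \<and> \<not> complemented A B"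
  by (auto simp: c'_factor_def chief_factor_iff complemented_def complement_iff)

lemma m'_factor_iff:
  "m'_factor K L A B \<longleftrightarrow> chief A B \<and> \<not> (\<exists>M. compl A B M \<and> maximal_subalgebra K L M)"
  by (auto simp: m'_factor_def chief_factor_iff complement_iff)

lemma max_supplemented_iff:
  "max_supplemented K L A B \<longleftrightarrow>
    chief A B \<and> (\<exists>M. maximal_subalgebra K L M \<and> A \<boxplus> M = carrier L \<and> B \<subseteq> M)"
proof -
  have "supplement K L A B M \<and> maximal_subalgebra K L M \<longleftrightarrow>
      maximal_subalgebra K L M \<and> A \<boxplus> M = carrier L \<and> B \<subseteq> M" if "chief A B" for M
    using chief_idl(3)[OF that] unfolding supplement_def maximal_subalgebra_def by blast
  then show ?thesis unfolding max_supplemented_def chief_factor_iff by blast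
qed

lemma chief_series_iff: "chief_series K L n X \<longleftrightarrow> chief_chain n X {\<zero>} (carrier L)"
  by (simp add: chief_series_def chief_chain_def chief_factor_iff)

lemma subalg_factor_image:
  assumes A: "subalg A" and B: "idl B" shows "lie_algebra K (factor L A B)"
proof -
  interpret Q: lie_alg "lie_quot L B" K using lie_algebra_quot[OF B] by (simp add: lie_alg_def)
  show ?thesis unfolding factor_eq using Q.lie_algebra_restrict[OF subalg_quot_image[OF B A]] .
qed

text \<open>Characterizes a difference through addition alone; for quotient records, addition of
  cosets is computed more directly than negation.\<close>

lemma a_minus_abelian_group:
  fixes G :: "('k, 'b, 'n) module_scheme"
  assumes "abelian_group G" "x \<in> carrier G" "y \<in> carrier G" "z \<in> carrier G" "z \<oplus>\<^bsub>G\<^esub> y = x"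
  shows "x \<ominus>\<^bsub>G\<^esub> y = z"
proof -
  interpret G: abelian_group G by fact
  show ?thesis using assms(2-) by (auto simp: G.minus_eq G.a_assoc G.r_neg)
qed

lemma factor_minus:
  assumes A: "subalg A" and B: "idl B" and x: "x \<in> A" and y: "y \<in> A"
  shows "(B +> x) \<ominus>\<^bsub>factor L A B\<^esub> (B +> y) = B +> (x \<ominus> y)"
proof (rule a_minus_abelian_group)
  note s = subalg_subsp[OF A] idl_subsp[OF B]
  note cl = subsp_closed[OF s(1) x] subsp_closed[OF s(1) y]
  show "abelian_group (factor L A B)"
    using subalg_factor_image[OF A B] lie_algebra.axioms(2) module.axioms(2) by blast
  show "(B +> (x \<ominus> y)) \<oplus>\<^bsub>factor L A B\<^esub> (B +> y) = B +> x"
    using cl coset_add[OF s(2)] by (simp add: factor_simps lin_simps)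
qed (use x y subsp_minus[OF subalg_subsp[OF A] x y] in \<open>auto simp: factor_simps\<close>)

lemma L_algebra_factor:
  assumes A: "idl A" and B: "idl B"
  shows "L_algebra K L (factor L A B) (factor_action L B)"
proof -
  note s = idl_subsp[OF A] idl_subsp[OF B]
  note cl = subsp_closed[OF s(1)]
  note op = coset_add[OF s(2)] coset_bracket[OF B] coset_smult[OF s(2)] coset_action[OF B]
    factor_minus[OF idl_subalg[OF A] B]
  have "derivation K (factor L A B) (factor_action L B x)" if x: "x \<in> carrier L" for x
    unfolding derivation_def linear_map_def
    using x cl idl_left[OF A x]
    by (auto simp: factor_simps op bracket_add_right bracket_smult_right jacobi_left[OF x])
  moreover have "factor_action L B (x \<otimes> y) a =
      factor_action L B x (factor_action L B y a) \<ominus>\<^bsub>factor L A B\<^esub> factor_action L B y (factor_action L B x a)"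
    if x: "x \<in> carrier L" and y: "y \<in> carrier L" and a: "a \<in> carrier (factor L A B)" for x y a
  proof -
    obtain b where b: "b \<in> A" "a = B +> b" using a by (auto simp: factor_simps)
    have "x \<otimes> (y \<otimes> b) \<in> A" "y \<otimes> (x \<otimes> b) \<in> A" using idl_left[OF A] x y b(1) by simp_all
    then show ?thesis using x y b cl by (simp add: op jacobi_comm)
  qed
  ultimately show ?thesis unfolding L_algebra_def
    using subalg_factor_image[OF idl_subalg[OF A] B] cl
    by (auto simp: factor_simps op bracket_add_left bracket_smult_left)
qed

text \<open>A subspace of A/B that is stable under the action pulls back to an ideal of L between B
  and A.\<close>

lemma irreducible_factor:
  assumes ch: "chief A B"
  shows "irreducible_L_algebra K L (factor L A B) (factor_action L B)"
proof -
  note i = chief_idl[OF ch] and s = chief_subsp[OF ch]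
  have BA: "B \<subseteq> A" using i(3) by blast
  interpret Q: lie_alg "lie_quot L B" K using lie_algebra_quot[OF i(2)] by (simp add: lie_alg_def)
  interpret F: lie_alg "factor L A B" K
    using subalg_factor_image[OF idl_subalg[OF i(1)] i(2)] by (simp add: lie_alg_def)
  have "H = {B} \<or> H = coset_image B A"
    if H: "submodule H K (factor L A B)" "\<forall>x\<in>carrier L. \<forall>a\<in>H. factor_action L B x a \<in> H" for H
  proof -
    have HA: "H \<subseteq> coset_image B A" using F.subsp_subset[OF H(1)] by (simp add: factor_simps)
    have HL: "H \<subseteq> coset_image B (carrier L)" using HA subsp_subset[OF s(1)] by blast
    have H': "submodule H K (lie_quot L B)"
      using F.subsp_zero[OF H(1)] F.subsp_add[OF H(1)] F.subsp_smult[OF H(1)] subsetD[OF HL]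
      by (intro Q.subspI) (auto simp: factor_simps quot_simps)
    note P = subsp_preim[OF i(2) H']
    have PA: "preim B H \<subseteq> A" using HA coset_image_mem[OF s(2,1) BA] by (auto simp: preim_def)
    have "idl (preim B H)"
    proof (rule idlI[OF P(1)])
      fix x y assume x: "x \<in> carrier L" and "y \<in> preim B H"
      then have y: "y \<in> carrier L" "B +> y \<in> H" by (auto simp: preim_def)
      then have "B +> (x \<otimes> y) \<in> H" using H(2) x coset_action[OF i(2) y(1) x] by metis
      then show "x \<otimes> y \<in> preim B H" using x y by (simp add: preim_def)
    qed
    then have "preim B H = B \<or> preim B H = A" by (rule chiefD[OF ch _ P(2) PA])
    then show ?thesis using image_preim[OF P(3)] coset_image_self[OF s(2)] by auto
  qed
  moreover have "coset_image B A \<noteq> {B}"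
    using coset_image_eq_iff[OF s(2,1) BA s(2) subset_refl] coset_image_self[OF s(2)] i(3) by auto
  ultimately show ?thesis
    unfolding irreducible_L_algebra_def using L_algebra_factor[OF i(1,2)] by (auto simp: factor_simps)
qed

end

section \<open>\<open>L\<close>-equivalence of chief factors\<close>

lemma lie_iso_inverse:
  assumes f: "lie_iso K A B f"
    and add: "\<And>x y. x \<in> carrier A \<Longrightarrow> y \<in> carrier A \<Longrightarrow> x \<oplus>\<^bsub>A\<^esub> y \<in> carrier A"
    and smult: "\<And>k x. k \<in> carrier K \<Longrightarrow> x \<in> carrier A \<Longrightarrow> k \<odot>\<^bsub>A\<^esub> x \<in> carrier A"
    and mult: "\<And>x y. x \<in> carrier A \<Longrightarrow> y \<in> carrier A \<Longrightarrow> x \<otimes>\<^bsub>A\<^esub> y \<in> carrier A"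
  shows "lie_iso K B A (inv_into (carrier A) f)"
proof -
  let ?g = "inv_into (carrier A) f"
  have bij: "bij_betw f (carrier A) (carrier B)" using f by (simp add: lie_iso_def)
  have g: "?g y \<in> carrier A" "f (?g y) = y" if "y \<in> carrier B" for y
    using that bij inv_into_into[of y f "carrier A"] f_inv_into_f[of y f "carrier A"]
    by (simp_all add: bij_betw_def)
  have eq: "?g y = x" if "x \<in> carrier A" "f x = y" for x y
    using that bij inv_into_f_f[of f "carrier A" x] by (auto simp: bij_betw_def)
  show ?thesis unfolding lie_iso_def linear_map_def
    using f g by (auto simp: lie_iso_def linear_map_def bij_betw_inv_into intro!: eq add smult mult)
qed

lemma lie_isoD:
  assumes "lie_iso K A B f"
  shows "x \<in> carrier A \<Longrightarrow> f x \<in> carrier B"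
    and "x \<in> carrier A \<Longrightarrow> y \<in> carrier A \<Longrightarrow> f (x \<oplus>\<^bsub>A\<^esub> y) = f x \<oplus>\<^bsub>B\<^esub> f y"
    and "x \<in> carrier A \<Longrightarrow> y \<in> carrier A \<Longrightarrow> f (x \<otimes>\<^bsub>A\<^esub> y) = f x \<otimes>\<^bsub>B\<^esub> f y"
    and "k \<in> carrier K \<Longrightarrow> x \<in> carrier A \<Longrightarrow> f (k \<odot>\<^bsub>A\<^esub> x) = k \<odot>\<^bsub>B\<^esub> f x"
  using assms unfolding lie_iso_def linear_map_def by blast+

lemma lie_iso_comp:
  assumes "lie_iso K A B f" "lie_iso K B C g" shows "lie_iso K A C (g \<circ> f)"
proof -
  have "f x \<in> carrier B" if "x \<in> carrier A" for x
    using assms(1) that by (auto simp: lie_iso_def linear_map_def)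
  then show ?thesis using assms bij_betw_trans[of f "carrier A" "carrier B" g "carrier C"]
    by (auto simp: lie_iso_def linear_map_def)
qed

lemma L_equivalent_refl: "L_equivalent K L A \<theta> A \<theta>"
  unfolding L_equivalent_def lie_iso_def linear_map_def by (rule exI[of _ "\<lambda>x. x"]) (auto simp: bij_betw_def inj_on_def)

lemma L_equivalent_trans:
  assumes "L_equivalent K L A \<theta> B \<eta>" "L_equivalent K L B \<eta> C \<zeta>"
  shows "L_equivalent K L A \<theta> C \<zeta>"
proof -
  obtain f where f: "lie_iso K (semidirect A \<theta> L) (semidirect B \<eta> L) f"
    "f ` (carrier A \<times> {\<zero>\<^bsub>L\<^esub>}) = carrier B \<times> {\<zero>\<^bsub>L\<^esub>}"
    "\<And>a x. a \<in> carrier A \<Longrightarrow> x \<in> carrier L \<Longrightarrow> snd (f (a, x)) = x"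
    using assms(1) unfolding L_equivalent_def by blast
  obtain g where g: "lie_iso K (semidirect B \<eta> L) (semidirect C \<zeta> L) g"
    "g ` (carrier B \<times> {\<zero>\<^bsub>L\<^esub>}) = carrier C \<times> {\<zero>\<^bsub>L\<^esub>}"
    "\<And>a x. a \<in> carrier B \<Longrightarrow> x \<in> carrier L \<Longrightarrow> snd (g (a, x)) = x"
    using assms(2) unfolding L_equivalent_def by blast
  have "snd ((g \<circ> f) (a, x)) = x" if ax: "a \<in> carrier A" "x \<in> carrier L" for a x
  proof -
    have "f (a, x) \<in> carrier B \<times> carrier L"
      using f(1) ax by (auto simp: lie_iso_def linear_map_def semidirect_def)
    then have "snd (g (f (a, x))) = snd (f (a, x))" using g(3) by (metis mem_Times_iff prod.collapse)
    then show ?thesis using f(3) ax by simp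
  qed
  moreover have "(g \<circ> f) ` (carrier A \<times> {\<zero>\<^bsub>L\<^esub>}) = carrier C \<times> {\<zero>\<^bsub>L\<^esub>}"
    unfolding image_comp[symmetric] f(2) g(2) ..
  ultimately show ?thesis unfolding L_equivalent_def using lie_iso_comp[OF f(1) g(1)] by blast
qed

context lie_alg begin

text \<open>The inverse bijection is a homomorphism once the carrier of the semi-direct sum of A
  with L is closed under the operations, and this closure comes from the axioms of an
  L-algebra.\<close>

lemma L_equivalent_sym:
  assumes A: "L_algebra K L A \<theta>" and e: "L_equivalent K L A \<theta> B \<eta>"
  shows "L_equivalent K L B \<eta> A \<theta>"
proof -
  let ?S = "semidirect A \<theta> L" and ?T = "semidirect B \<eta> L"
  obtain f where f: "lie_iso K ?S ?T f" "f ` (carrier A \<times> {\<zero>}) = carrier B \<times> {\<zero>}"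
    "\<And>a x. a \<in> carrier A \<Longrightarrow> x \<in> carrier L \<Longrightarrow> snd (f (a, x)) = x"
    using e unfolding L_equivalent_def by blast
  have cs: "carrier ?S = carrier A \<times> carrier L" "carrier ?T = carrier B \<times> carrier L"
    by (simp_all add: semidirect_def)
  interpret A: lie_alg A K using A by (simp add: lie_alg_def L_algebra_def)
  have \<theta>: "\<theta> x a \<in> carrier A" if "x \<in> carrier L" "a \<in> carrier A" for x a
    using A that by (auto simp: L_algebra_def derivation_def linear_map_def)
  let ?g = "inv_into (carrier ?S) f"
  have g: "lie_iso K ?T ?S ?g"
    by (rule lie_iso_inverse[OF f(1)]) (auto simp: semidirect_def \<theta>)
  have bij: "bij_betw f (carrier ?S) (carrier ?T)" using f(1) by (simp add: lie_iso_def)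
  have "?g ` (carrier B \<times> {\<zero>}) = carrier A \<times> {\<zero>}"
  proof -
    have sub: "carrier A \<times> {\<zero>} \<subseteq> carrier ?S" by (auto simp: cs)
    show ?thesis unfolding f(2)[symmetric]
      using inv_into_image_cancel[OF bij_betw_imp_inj_on[OF bij] sub] .
  qed
  moreover have "snd (?g (b, x)) = x" if bx: "b \<in> carrier B" "x \<in> carrier L" for b x
  proof -
    have "(b, x) \<in> carrier ?T" using bx by (simp add: cs)
    then have m: "?g (b, x) \<in> carrier A \<times> carrier L" "f (?g (b, x)) = (b, x)"
      using inv_into_into[of "(b, x)" f "carrier ?S"] f_inv_into_f[of "(b, x)" f "carrier ?S"] bij cs
      by (simp_all add: bij_betw_def)
    then have "snd (f (?g (b, x))) = snd (?g (b, x))" using f(3) by (metis mem_Times_iff prod.collapse)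
    then show ?thesis using m(2) by simp
  qed
  ultimately show ?thesis unfolding L_equivalent_def using g by blast
qed

definition factor_equiv :: "'a set \<Rightarrow> 'a set \<Rightarrow> 'a set \<Rightarrow> 'a set \<Rightarrow> bool" where
  "factor_equiv A B A' B' \<longleftrightarrow>
    L_equivalent K L (factor L A B) (factor_action L B) (factor L A' B') (factor_action L B')"

lemma factor_equiv_refl: "factor_equiv A B A B"
  by (simp add: factor_equiv_def L_equivalent_refl)

lemma factor_equiv_trans: "factor_equiv A B C D \<Longrightarrow> factor_equiv C D E F \<Longrightarrow> factor_equiv A B E F"
  unfolding factor_equiv_def by (rule L_equivalent_trans)

lemma factor_equiv_sym: "idl A \<Longrightarrow> idl B \<Longrightarrow> factor_equiv A B C D \<Longrightarrow> factor_equiv C D A B"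
  unfolding factor_equiv_def by (rule L_equivalent_sym[OF L_algebra_factor])

lemma semidirect_factor:
  assumes A: "idl A" and B: "idl B" and a: "a \<in> A" and b: "b \<in> A" and x: "x \<in> carrier L" and y: "y \<in> carrier L"
  shows "(B +> a, x) \<otimes>\<^bsub>semidirect (factor L A B) (factor_action L B) L\<^esub> (B +> b, y) =
      (B +> ((x \<otimes> b \<ominus> y \<otimes> a) \<oplus> a \<otimes> b), x \<otimes> y)"
    and "(B +> a, x) \<oplus>\<^bsub>semidirect (factor L A B) (factor_action L B) L\<^esub> (B +> b, y) = (B +> (a \<oplus> b), x \<oplus> y)"
    and "k \<in> carrier K \<Longrightarrow>
      k \<odot>\<^bsub>semidirect (factor L A B) (factor_action L B) L\<^esub> (B +> a, x) = (B +> (k \<odot> a), k \<odot> x)"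
    and "carrier (semidirect (factor L A B) (factor_action L B) L) = coset_image B A \<times> carrier L"
proof -
  note cl = subsp_closed[OF idl_subsp[OF A] a] subsp_closed[OF idl_subsp[OF A] b]
  note op = coset_add[OF idl_subsp[OF B]] coset_bracket[OF B] coset_smult[OF idl_subsp[OF B]]
    coset_action[OF B] factor_minus[OF idl_subalg[OF A] B]
  have "x \<otimes> b \<in> A" "y \<otimes> a \<in> A" using idl_left[OF A] a b x y by auto
  then show "(B +> a, x) \<otimes>\<^bsub>semidirect (factor L A B) (factor_action L B) L\<^esub> (B +> b, y) =
      (B +> ((x \<otimes> b \<ominus> y \<otimes> a) \<oplus> a \<otimes> b), x \<otimes> y)"
    using cl x y by (simp add: semidirect_def op) (simp add: factor_simps op)
  show "(B +> a, x) \<oplus>\<^bsub>semidirect (factor L A B) (factor_action L B) L\<^esub> (B +> b, y) = (B +> (a \<oplus> b), x \<oplus> y)"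
    using cl by (simp add: semidirect_def factor_simps op)
  show "k \<in> carrier K \<Longrightarrow>
      k \<odot>\<^bsub>semidirect (factor L A B) (factor_action L B) L\<^esub> (B +> a, x) = (B +> (k \<odot> a), k \<odot> x)"
    using cl by (simp add: semidirect_def factor_simps op)
  show "carrier (semidirect (factor L A B) (factor_action L B) L) = coset_image B A \<times> carrier L"
    by (simp add: semidirect_def factor_simps)
qed

text \<open>\<phi> and \<delta> represent the first components of the images of the pairs with zero
  second and zero first component. The rules of \<open>equiv_data\<close> are first components of
  the homomorphism equations for such pairs; injectivity and the image of A/B give the last
  two.\<close>

lemma factor_equiv_data:
  assumes i: "idl A" "idl B" "B \<subseteq> A" and i': "idl A'" "idl B'" "B' \<subseteq> A'"
    and e: "factor_equiv A B A' B'"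
  obtains \<phi> \<delta> where "equiv_data \<phi> \<delta> A B A' B'"
proof -
  note s = idl_subsp[OF i(1)] idl_subsp[OF i(2)] and s' = idl_subsp[OF i'(1)] idl_subsp[OF i'(2)]
  let ?S = "semidirect (factor L A B) (factor_action L B) L"
  let ?T = "semidirect (factor L A' B') (factor_action L B') L"
  note S = semidirect_factor[OF i(1,2)] and T = semidirect_factor[OF i'(1,2)]
  have cS: "carrier ?S = coset_image B A \<times> carrier L" and cT: "carrier ?T = coset_image B' A' \<times> carrier L"
    by (simp_all add: semidirect_def factor_simps)
  obtain f where f0: "lie_iso K ?S ?T f \<and>
      f ` (coset_image B A \<times> {\<zero>}) = coset_image B' A' \<times> {\<zero>} \<and>
      (\<forall>a\<in>coset_image B A. \<forall>x\<in>carrier L. snd (f (a, x)) = x)"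
    using e unfolding factor_equiv_def L_equivalent_def factor_simps(1) by (rule exE)
  note f = conjunct1[OF f0] conjunct1[OF conjunct2[OF f0]]
  note snd = conjunct2[OF conjunct2[OF f0], rule_format]
  note fm = lie_isoD(1)[OF f(1), unfolded cS cT] and fadd = lie_isoD(2)[OF f(1), unfolded cS]
    and fmul = lie_isoD(3)[OF f(1), unfolded cS] and fsm = lie_isoD(4)[OF f(1), unfolded cS]
  have inj: "inj_on f (coset_image B A \<times> carrier L)"
    using f(1) by (simp add: lie_iso_def cS bij_betw_def)
  have z: "\<zero> \<in> A" "\<zero> \<in> B'" using subsp_zero[OF s(1)] subsp_zero[OF s'(2)] by auto
  have "\<exists>g. \<forall>a\<in>A. g a \<in> A' \<and> f (B +> a, \<zero>) = (B' +> g a, \<zero>)"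
  proof (rule bchoice, intro ballI)
    fix a assume a: "a \<in> A"
    have "f (B +> a, \<zero>) \<in> coset_image B' A' \<times> carrier L" using fm a by simp
    moreover have "snd (f (B +> a, \<zero>)) = \<zero>" using snd[of "B +> a" \<zero>] a by simp
    ultimately show "\<exists>b. b \<in> A' \<and> f (B +> a, \<zero>) = (B' +> b, \<zero>)" by (cases "f (B +> a, \<zero>)") auto
  qed
  then obtain \<phi> where \<phi>: "\<And>a. a \<in> A \<Longrightarrow> \<phi> a \<in> A'" "\<And>a. a \<in> A \<Longrightarrow> f (B +> a, \<zero>) = (B' +> \<phi> a, \<zero>)"
    by blast
  have "\<exists>g. \<forall>x\<in>carrier L. g x \<in> A' \<and> f (B +> \<zero>, x) = (B' +> g x, x)"
  proof (rule bchoice, intro ballI)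
    fix x assume x: "x \<in> carrier L"
    have "f (B +> \<zero>, x) \<in> coset_image B' A' \<times> carrier L" using fm z x by simp
    moreover have "snd (f (B +> \<zero>, x)) = x" using snd[of "B +> \<zero>" x] z x by simp
    ultimately show "\<exists>b. b \<in> A' \<and> f (B +> \<zero>, x) = (B' +> b, x)" by (cases "f (B +> \<zero>, x)") auto
  qed
  then obtain \<delta> where \<delta>: "\<And>x. x \<in> carrier L \<Longrightarrow> \<delta> x \<in> A'"
      "\<And>x. x \<in> carrier L \<Longrightarrow> f (B +> \<zero>, x) = (B' +> \<delta> x, x)"
    by blast
  have Ac: "a \<in> carrier L" if "a \<in> A" for a using subsp_closed[OF s(1) that] .
  have A'c: "a \<in> carrier L" if "a \<in> A'" for a using subsp_closed[OF s'(1) that] .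
  have pc: "\<phi> a \<in> carrier L" if "a \<in> A" for a using A'c \<phi>(1)[OF that] .
  have dc: "\<delta> x \<in> carrier L" if "x \<in> carrier L" for x using A'c \<delta>(1)[OF that] .
  have ceq: "B' +> u = B' +> v \<Longrightarrow> eqm B' u v" if "u \<in> carrier L" "v \<in> carrier L" for u v
    using coset_eq[OF that s'(2)] by simp
  have mem: "(B +> a, x) \<in> coset_image B A \<times> carrier L" if "a \<in> A" "x \<in> carrier L" for a x using that by simp
  have "equiv_data \<phi> \<delta> A B A' B'" unfolding equiv_data_def linear_mod_def
  proof (intro conjI ballI)
    fix a b assume a: "a \<in> A" and b: "b \<in> A"
    have ab: "a \<oplus> b \<in> A" "a \<otimes> b \<in> A" using subsp_add[OF s(1) a b] idl_left[OF i(1) Ac[OF a] b] by auto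
    show "eqm B' (\<phi> (a \<oplus> b)) (\<phi> a \<oplus> \<phi> b)"
      using fadd[OF mem[OF a M.zero_closed] mem[OF b M.zero_closed]] a b ab pc \<phi>(1)
      by (intro ceq) (simp_all add: S(2) T(2) \<phi>(2))
    show "eqm B' (\<phi> (a \<otimes> b)) (\<phi> a \<otimes> \<phi> b)"
      using fmul[OF mem[OF a M.zero_closed] mem[OF b M.zero_closed]] a b ab pc \<phi>(1) Ac
      by (intro ceq) (simp_all add: S(1) T(1) \<phi>(2) M.minus_eq)
  next
    fix k a assume k: "k \<in> carrier K" and a: "a \<in> A"
    show "eqm B' (\<phi> (k \<odot> a)) (k \<odot> \<phi> a)"
      using fsm[OF k mem[OF a M.zero_closed]] a k pc \<phi>(1) subsp_smult[OF s(1) k a]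
      by (intro ceq) (simp_all add: S(3)[OF a a M.zero_closed M.zero_closed]
          T(3)[OF \<phi>(1)[OF a] \<phi>(1)[OF a] M.zero_closed M.zero_closed] \<phi>(2))
  next
    fix x y assume x: "x \<in> carrier L" and y: "y \<in> carrier L"
    note m = mem[OF z(1) x] mem[OF z(1) y]
    show "eqm B' (\<delta> (x \<oplus> y)) (\<delta> x \<oplus> \<delta> y)"
      using fadd[OF m] x y dc \<delta>(1) z by (intro ceq) (simp_all add: S(2) T(2) \<delta>(2))
    show "eqm B' (\<delta> (x \<otimes> y)) (x \<otimes> \<delta> y \<ominus> y \<otimes> \<delta> x \<oplus> \<delta> x \<otimes> \<delta> y)"
      using fmul[OF m] x y dc \<delta>(1) z
      by (intro ceq) (simp_all add: S(1) T(1) \<delta>(2) M.minus_eq)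
  next
    fix k x assume k: "k \<in> carrier K" and x: "x \<in> carrier L"
    show "eqm B' (\<delta> (k \<odot> x)) (k \<odot> \<delta> x)"
      using fsm[OF k mem[OF z(1) x]] x k dc \<delta>(1)
      by (intro ceq) (simp_all add: S(3)[OF z(1) z(1)] T(3)[OF \<delta>(1)[OF x] \<delta>(1)[OF x]] \<delta>(2))
  next
    fix x a assume x: "x \<in> carrier L" and a: "a \<in> A"
    show "eqm B' (\<phi> (x \<otimes> a)) (x \<otimes> \<phi> a \<oplus> \<delta> x \<otimes> \<phi> a)"
      using fmul[OF mem[OF z(1) x] mem[OF a M.zero_closed]] x a dc pc \<delta>(1) \<phi>(1) z Ac idl_left[OF i(1) x a]
      by (intro ceq) (simp_all add: S(1) T(1) \<delta>(2) \<phi>(2) M.minus_eq)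
  next
    fix a assume a: "a \<in> A"
    have 0: "f (B +> \<zero>, \<zero>) = (B' +> \<zero>, \<zero>)"
      using fsm[OF K_closed(1) mem[OF z(1) M.zero_closed]] dc[OF M.zero_closed]
      by (simp add: S(3)[OF z(1) z(1)] T(3)[OF \<delta>(1) \<delta>(1)] \<delta>(2))
    have "\<phi> a \<in> B' \<longleftrightarrow> f (B +> a, \<zero>) = f (B +> \<zero>, \<zero>)"
      unfolding 0 \<phi>(2)[OF a] using coset_eq_zero[OF s'(2) pc[OF a]] coset_zero[OF s'(2)] by simp
    also have "\<dots> \<longleftrightarrow> B +> a = B +> \<zero>"
      using inj_on_eq_iff[OF inj mem[OF a M.zero_closed] mem[OF z(1) M.zero_closed]] by simp
    also have "\<dots> \<longleftrightarrow> a \<in> B" using coset_eq_zero[OF s(2) Ac[OF a]] coset_zero[OF s(2)] by simp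
    finally show "\<phi> a \<in> B' \<longleftrightarrow> a \<in> B" .
  next
    fix b assume b: "b \<in> A'"
    then have "(B' +> b, \<zero>) \<in> f ` (coset_image B A \<times> {\<zero>})" unfolding f(2) by simp
    then obtain a where a: "a \<in> A" "f (B +> a, \<zero>) = (B' +> b, \<zero>)" by auto
    then have "eqm B' (\<phi> a) b" using \<phi>(2)[OF a(1)] pc[OF a(1)] A'c[OF b] by (intro ceq) auto
    then show "\<exists>a\<in>A. eqm B' (\<phi> a) b" using a(1) by blast
  qed (use \<phi>(1) \<delta>(1) in auto)
  then show ?thesis using that by blast
qed

text \<open>\<phi> preserves and reflects congruence, so the formula for the isomorphism does not
  depend on representatives and is injective. The crossed rules for \<phi> and \<delta> together
  give multiplicativity.\<close>

lemma data_factor_equiv: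
  assumes i: "idl A" "idl B" "B \<subseteq> A" and i': "idl A'" "idl B'" "B' \<subseteq> A'"
    and d: "equiv_data \<phi> \<delta> A B A' B'"
  shows "factor_equiv A B A' B'"
proof -
  note s = idl_subsp[OF i(1)] idl_subsp[OF i(2)] and s' = idl_subsp[OF i'(1)] idl_subsp[OF i'(2)]
  let ?S = "semidirect (factor L A B) (factor_action L B) L"
  let ?T = "semidirect (factor L A' B') (factor_action L B') L"
  note S = semidirect_factor[OF i(1,2)] and T = semidirect_factor[OF i'(1,2)]
  have cS: "carrier ?S = coset_image B A \<times> carrier L" and cT: "carrier ?T = coset_image B' A' \<times> carrier L"
    by (simp_all add: semidirect_def factor_simps)
  note D = equiv_dataD[OF d]
  note cm = conj_map[OF d i(1) i'(1,2)]
  have Ac: "a \<in> carrier L" if "a \<in> A" for a using subsp_closed[OF s(1) that] .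
  have A'c: "a \<in> carrier L" if "a \<in> A'" for a using subsp_closed[OF s'(1) that] .
  have pc: "\<phi> a \<in> carrier L" if "a \<in> A" for a using A'c D(1)[OF that] .
  have dc: "\<delta> x \<in> carrier L" if "x \<in> carrier L" for x using A'c D(2)[OF that] .
  have ceq: "B' +> u = B' +> v \<longleftrightarrow> eqm B' u v" if "u \<in> carrier L" "v \<in> carrier L" for u v
    using coset_eq[OF that s'(2)] .
  note add = eqm_add[OF s'(2)] and refl = eqm_refl[OF s'(2)] and trans = eqm_trans[OF s'(2)]
    and sym = eqm_sym[OF s'(2)]
  have neg: "eqm B' (\<phi> (\<ominus> a)) (\<ominus> \<phi> a)" if a: "a \<in> A" for a
  proof -
    have k: "\<ominus>\<^bsub>K\<^esub> \<one>\<^bsub>K\<^esub> \<in> carrier K" by simp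
    have "(\<ominus>\<^bsub>K\<^esub> \<one>\<^bsub>K\<^esub>) \<odot> x = \<ominus> x" if "x \<in> carrier L" for x
      using smult_l_minus[OF K_closed(2) that] that by simp
    then show ?thesis using D(4)[OF k a] Ac[OF a] pc[OF a] by simp
  qed
  have wd: "eqm B' (\<phi> a) (\<phi> b) \<longleftrightarrow> eqm B a b" if a: "a \<in> A" and b: "b \<in> A" for a b
  proof -
    have ab: "a \<ominus> b \<in> A" using subsp_minus[OF s(1) a b] .
    have "eqm B' (\<phi> (a \<ominus> b)) (\<phi> a \<ominus> \<phi> b)"
      using trans[OF D(3)[OF a subsp_neg[OF s(1) b]] add[OF refl[OF pc[OF a]] neg[OF b]]]
      by (simp add: M.minus_eq)
    then have "\<phi> a \<ominus> \<phi> b \<in> B' \<longleftrightarrow> \<phi> (a \<ominus> b) \<in> B'" using eqm_mem[OF s'(2) subset_refl] by blast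
    then show ?thesis using D(10)[OF ab] a b Ac pc by (simp add: eqm_def)
  qed
  define rep where "rep S = (SOME a. a \<in> A \<and> S = B +> a)" for S
  have rep: "rep (B +> a) \<in> A" "eqm B' (\<phi> (rep (B +> a))) (\<phi> a)" if a: "a \<in> A" for a
  proof -
    have "rep (B +> a) \<in> A \<and> B +> a = B +> rep (B +> a)"
      unfolding rep_def by (rule someI[of _ a]) (use a in simp)
    then show "rep (B +> a) \<in> A" "eqm B' (\<phi> (rep (B +> a))) (\<phi> a)"
      using wd[of "rep (B +> a)" a] coset_eq[OF Ac Ac s(2), of "rep (B +> a)" a] a by simp_all
  qed
  define f where "f = (\<lambda>(S, x). (B' +> (\<phi> (rep S) \<oplus> \<delta> x), x))"
  have f: "f (B +> a, x) = (B' +> (\<phi> a \<oplus> \<delta> x), x)" if a: "a \<in> A" and x: "x \<in> carrier L" for a x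
    using add[OF rep(2)[OF a] refl[OF dc[OF x]]] pc[OF rep(1)[OF a]] pc[OF a] dc[OF x] by (simp add: f_def ceq)
  have fA: "\<phi> a \<oplus> \<delta> x \<in> A'" if a: "a \<in> A" and x: "x \<in> carrier L" for a x
    using subsp_add[OF s'(1) D(1)[OF a] D(2)[OF x]] .
  have surj: "\<exists>a\<in>A. f (B +> a, x) = (B' +> b, x)" if b: "b \<in> A'" and x: "x \<in> carrier L" for b x
  proof -
    obtain a where a: "a \<in> A" "eqm B' (\<phi> a) (b \<ominus> \<delta> x)"
      using D(11)[OF subsp_minus[OF s'(1) b D(2)[OF x]]] by blast
    have "eqm B' (\<phi> a \<oplus> \<delta> x) (b \<ominus> \<delta> x \<oplus> \<delta> x)" using add[OF a(2) refl[OF dc[OF x]]] .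
    moreover have "b \<ominus> \<delta> x \<oplus> \<delta> x = b" using A'c[OF b] dc[OF x] by (simp add: lin_simps)
    ultimately have "f (B +> a, x) = (B' +> b, x)"
      using pc[OF a(1)] dc[OF x] A'c[OF b] ceq by (simp add: f[OF a(1) x])
    then show ?thesis using a(1) by blast
  qed
  have fmul: "f ((B +> a, x) \<otimes>\<^bsub>?S\<^esub> (B +> b, y)) = f (B +> a, x) \<otimes>\<^bsub>?T\<^esub> f (B +> b, y)"
    if a: "a \<in> A" and b: "b \<in> A" and x: "x \<in> carrier L" and y: "y \<in> carrier L" for a b x y
  proof -
    note cl = Ac[OF a] Ac[OF b] x y pc[OF a] pc[OF b] dc[OF x] dc[OF y]
    have m: "x \<otimes> b \<in> A" "y \<otimes> a \<in> A" "a \<otimes> b \<in> A"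
      using idl_left[OF i(1)] a b x y Ac by auto
    have xy: "x \<otimes> y \<in> carrier L" using x y by simp
    have m2: "x \<otimes> b \<ominus> y \<otimes> a \<in> A" using subsp_minus[OF s(1) m(1,2)] .
    have "eqm B' (\<phi> (x \<otimes> b \<ominus> y \<otimes> a)) (\<phi> (x \<otimes> b) \<ominus> \<phi> (y \<otimes> a))"
      using trans[OF D(3)[OF m(1) subsp_neg[OF s(1) m(2)]] add[OF refl[OF pc[OF m(1)]] neg[OF m(2)]]]
      by (simp add: M.minus_eq)
    then have e1: "eqm B' (\<phi> (x \<otimes> b \<ominus> y \<otimes> a)) (conj_map \<delta> x \<otimes> \<phi> b \<ominus> conj_map \<delta> y \<otimes> \<phi> a)"
      using trans eqm_minus[OF s'(2) cm(5)[OF x b] cm(5)[OF y a]] by blast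
    have e2: "eqm B' (\<phi> ((x \<otimes> b \<ominus> y \<otimes> a) \<oplus> a \<otimes> b))
        ((conj_map \<delta> x \<otimes> \<phi> b \<ominus> conj_map \<delta> y \<otimes> \<phi> a) \<oplus> \<phi> a \<otimes> \<phi> b)"
      using trans[OF D(3)[OF m2 m(3)] add[OF e1 D(7)[OF a b]]] .
    have e3: "eqm B' (\<phi> ((x \<otimes> b \<ominus> y \<otimes> a) \<oplus> a \<otimes> b) \<oplus> \<delta> (x \<otimes> y))
        (((conj_map \<delta> x \<otimes> \<phi> b \<ominus> conj_map \<delta> y \<otimes> \<phi> a) \<oplus> \<phi> a \<otimes> \<phi> b) \<oplus>
          ((x \<otimes> \<delta> y \<ominus> y \<otimes> \<delta> x) \<oplus> \<delta> x \<otimes> \<delta> y))"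
      using add[OF e2 D(8)[OF x y]] .
    \<comment> \<open>The parts of the action that are twisted by \<delta> supply exactly the mixed
      terms in the product of \<phi> a + \<delta> x and \<phi> b + \<delta> y; this sign turns one
      of them around.\<close>
    have "\<delta> y \<otimes> \<phi> a = \<ominus> (\<phi> a \<otimes> \<delta> y)" using bracket_anti cl by blast
    then have e4: "((conj_map \<delta> x \<otimes> \<phi> b \<ominus> conj_map \<delta> y \<otimes> \<phi> a) \<oplus> \<phi> a \<otimes> \<phi> b) \<oplus>
          ((x \<otimes> \<delta> y \<ominus> y \<otimes> \<delta> x) \<oplus> \<delta> x \<otimes> \<delta> y) =
        (x \<otimes> (\<phi> b \<oplus> \<delta> y) \<ominus> y \<otimes> (\<phi> a \<oplus> \<delta> x)) \<oplus> (\<phi> a \<oplus> \<delta> x) \<otimes> (\<phi> b \<oplus> \<delta> y)"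
      using cl by (simp add: conj_map_def bracket_add_left bracket_add_right M.minus_eq M.minus_add M.a_ac)
    have "f ((B +> a, x) \<otimes>\<^bsub>?S\<^esub> (B +> b, y)) =
        (B' +> (\<phi> ((x \<otimes> b \<ominus> y \<otimes> a) \<oplus> a \<otimes> b) \<oplus> \<delta> (x \<otimes> y)), x \<otimes> y)"
      unfolding S(1)[OF a b x y] by (rule f[OF subsp_add[OF s(1) m2 m(3)] xy])
    also have "\<dots> = (B' +> ((x \<otimes> (\<phi> b \<oplus> \<delta> y) \<ominus> y \<otimes> (\<phi> a \<oplus> \<delta> x)) \<oplus> (\<phi> a \<oplus> \<delta> x) \<otimes> (\<phi> b \<oplus> \<delta> y)), x \<otimes> y)"
      using e3 eqm_closed[OF e3] ceq unfolding e4 by simp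
    also have "\<dots> = f (B +> a, x) \<otimes>\<^bsub>?T\<^esub> f (B +> b, y)"
      unfolding f[OF a x] f[OF b y] T(1)[OF fA[OF a x] fA[OF b y] x y] ..
    finally show ?thesis .
  qed
  have fadd: "f ((B +> a, x) \<oplus>\<^bsub>?S\<^esub> (B +> b, y)) = f (B +> a, x) \<oplus>\<^bsub>?T\<^esub> f (B +> b, y)"
    if a: "a \<in> A" and b: "b \<in> A" and x: "x \<in> carrier L" and y: "y \<in> carrier L" for a b x y
  proof -
    note cl = pc[OF a] pc[OF b] dc[OF x] dc[OF y]
    have "eqm B' (\<phi> (a \<oplus> b) \<oplus> \<delta> (x \<oplus> y)) ((\<phi> a \<oplus> \<phi> b) \<oplus> (\<delta> x \<oplus> \<delta> y))"
      using add[OF D(3)[OF a b] D(5)[OF x y]] .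
    moreover have "(\<phi> a \<oplus> \<phi> b) \<oplus> (\<delta> x \<oplus> \<delta> y) = (\<phi> a \<oplus> \<delta> x) \<oplus> (\<phi> b \<oplus> \<delta> y)"
      using cl by (simp add: M.a_ac)
    ultimately have e: "eqm B' (\<phi> (a \<oplus> b) \<oplus> \<delta> (x \<oplus> y)) ((\<phi> a \<oplus> \<delta> x) \<oplus> (\<phi> b \<oplus> \<delta> y))" by simp
    show ?thesis
      unfolding S(2)[OF a b x y] f[OF a x] f[OF b y] T(2)[OF fA[OF a x] fA[OF b y] x y]
        f[OF subsp_add[OF s(1) a b] M.a_closed[OF x y]]
      using e ceq[OF eqm_closed[OF e]] by simp
  qed
  have fsm: "f (k \<odot>\<^bsub>?S\<^esub> (B +> a, x)) = k \<odot>\<^bsub>?T\<^esub> f (B +> a, x)"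
    if k: "k \<in> carrier K" and a: "a \<in> A" and x: "x \<in> carrier L" for a x k
  proof -
    have e: "eqm B' (\<phi> (k \<odot> a) \<oplus> \<delta> (k \<odot> x)) (k \<odot> (\<phi> a \<oplus> \<delta> x))"
      using add[OF D(4)[OF k a] D(6)[OF k x]] k pc[OF a] dc[OF x] by (simp add: smult_r_distr)
    show ?thesis
      unfolding S(3)[OF a a x x k] f[OF a x] T(3)[OF fA[OF a x] fA[OF a x] x x k]
        f[OF subsp_smult[OF s(1) k a] smult_closed[OF k x]]
      using e ceq[OF eqm_closed[OF e]] by simp
  qed
  have inj: "inj_on f (coset_image B A \<times> carrier L)"
  proof (rule inj_onI)
    fix p q assume p: "p \<in> coset_image B A \<times> carrier L" and q: "q \<in> coset_image B A \<times> carrier L" and e: "f p = f q"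
    obtain a x b y where ab: "a \<in> A" "x \<in> carrier L" "p = (B +> a, x)" "b \<in> A" "y \<in> carrier L" "q = (B +> b, y)"
      using p q by auto
    have xy: "x = y" and "B' +> (\<phi> a \<oplus> \<delta> x) = B' +> (\<phi> b \<oplus> \<delta> y)" using e f ab by auto
    then have "eqm B' (\<phi> a \<oplus> \<delta> x) (\<phi> b \<oplus> \<delta> x)" using ceq pc dc ab by simp
    then have "eqm B' (\<phi> a \<oplus> \<delta> x \<ominus> \<delta> x) (\<phi> b \<oplus> \<delta> x \<ominus> \<delta> x)"
      using eqm_minus[OF s'(2) _ refl[OF dc[OF ab(2)]]] by blast
    then have "eqm B' (\<phi> a) (\<phi> b)" using pc[OF ab(1)] pc[OF ab(4)] dc[OF ab(2)] by (simp add: lin_simps)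
    then show "p = q" using wd ab xy coset_eq[OF Ac Ac s(2)] by simp
  qed
  have iso: "lie_iso K ?S ?T f" unfolding lie_iso_def linear_map_def cS cT
  proof (intro conjI ballI)
    show "f \<in> coset_image B A \<times> carrier L \<rightarrow> coset_image B' A' \<times> carrier L" using f fA by auto
    show "bij_betw f (coset_image B A \<times> carrier L) (coset_image B' A' \<times> carrier L)"
      unfolding bij_betw_def
    proof (intro conjI inj subset_antisym subsetI)
      fix p assume "p \<in> coset_image B' A' \<times> carrier L"
      then obtain b x where b: "b \<in> A'" "x \<in> carrier L" "p = (B' +> b, x)" by auto
      then obtain a where "a \<in> A" "f (B +> a, x) = p" using surj by blast
      then show "p \<in> f ` (coset_image B A \<times> carrier L)" using b(2) by force
    next
      fix p assume "p \<in> f ` (coset_image B A \<times> carrier L)"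
      then show "p \<in> coset_image B' A' \<times> carrier L" using f fA by auto
    qed
  qed (use fadd fmul fsm in auto)
  moreover have "f ` (coset_image B A \<times> {\<zero>}) = coset_image B' A' \<times> {\<zero>}"
  proof (intro subset_antisym subsetI)
    fix p assume "p \<in> coset_image B' A' \<times> {\<zero>}"
    then obtain b where b: "b \<in> A'" "p = (B' +> b, \<zero>)" by auto
    then obtain a where "a \<in> A" "f (B +> a, \<zero>) = p" using surj[OF b(1) M.zero_closed] by blast
    then show "p \<in> f ` (coset_image B A \<times> {\<zero>})" by force
  next
    fix p assume "p \<in> f ` (coset_image B A \<times> {\<zero>})"
    then show "p \<in> coset_image B' A' \<times> {\<zero>}" using f fA by auto
  qed
  moreover have "snd (f (S, x)) = x" for S x by (simp add: f_def)
  ultimately show ?thesis unfolding factor_equiv_def L_equivalent_def factor_simps(1) by blast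
qed

end

section \<open>\<open>m\<close>-related factors\<close>

context lie_alg begin

text \<open>The isomorphism maps \<open>a + m\<close> with \<open>a \<in> A\<close>, \<open>m \<in> M\<close> to \<open>(Z + a, Z + m)\<close>.\<close>

lemma split_quotient_iso:
  assumes ch: "chief A B" and na: "\<not> abelian_factor A B" and M: "compl A B M"
    and Z_def: "Z = centralizer A B" and N_def: "N = M \<inter> Z"
  shows "\<exists>h. lie_iso K (lie_quot L N) (semidirect (factor L (Z \<boxplus> A) Z) (monoid.mult (lie_quot L Z))
      (factor L (Z \<boxplus> M) Z)) h"
proof -
  note i = chief_idl[OF ch] and s = chief_subsp[OF ch]
  note Z = centralizer_props[OF ch na, folded Z_def]
  note sZ = idl_subsp[OF Z(1)]
  have M': "subalg M" "A \<boxplus> M = carrier L" "A \<inter> M = B" using M by (auto simp: compl_def)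
  have sM: "subsp M" using M'(1) subalg_subsp by blast
  have sN: "subsp N" unfolding N_def using subsp_Int[OF sM sZ] .
  have Ac: "a \<in> carrier L" if "a \<in> A" for a using subsp_closed[OF s(1) that] .
  have Mc: "a \<in> carrier L" if "a \<in> M" for a using subsp_closed[OF sM that] .
  have BN: "B \<subseteq> N" using M'(3) Z(2) by (auto simp: N_def)
  have NZ: "N \<subseteq> Z" "N \<subseteq> M" by (auto simp: N_def)
  have decomp: "\<exists>a m. a \<in> A \<and> m \<in> M \<and> x = a \<oplus> m" if "x \<in> carrier L" for x
    using that unfolding M'(2)[symmetric] mem_sum by blast
  have iN: "idl N" unfolding N_def Z_def by (rule idl_complement_Int_centralizer[OF ch na M])
  let ?I = "Z \<boxplus> A" and ?F = "Z \<boxplus> M"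
  have iI: "idl ?I" using idl_sum[OF Z(1) i(1)] .
  have AI: "A \<subseteq> ?I" and MF: "M \<subseteq> ?F" using sum_upper2 sZ s(1) sM by blast+
  let ?S = "semidirect (factor L ?I Z) (monoid.mult (lie_quot L Z)) (factor L ?F Z)"
  note opN = coset_add[OF sN] coset_bracket[OF iN] coset_smult[OF sN]
  note opZ = coset_add[OF sZ] coset_bracket[OF Z(1)] coset_smult[OF sZ]
  \<comment> \<open>If a + m is in N, it is in M, so a lies in A \<inter> M = B \<subseteq> Z and m
    lies in Z as well. A coset of N thus determines both components modulo Z, and it is determined
    by them because A \<inter> Z = B \<subseteq> N and M \<inter> Z = N.\<close>
  have eqN: "eqm N (a \<oplus> m) (a' \<oplus> m') \<longleftrightarrow> eqm Z a a' \<and> eqm Z m m'"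
    if am: "a \<in> A" "m \<in> M" "a' \<in> A" "m' \<in> M" for a m a' m'
  proof -
    note cl = Ac[OF am(1)] Mc[OF am(2)] Ac[OF am(3)] Mc[OF am(4)]
    have d: "(a \<oplus> m) \<ominus> (a' \<oplus> m') = (a \<ominus> a') \<oplus> (m \<ominus> m')" using cl by (simp add: lin_simps)
    have mm: "m \<ominus> m' \<in> M" "a \<ominus> a' \<in> A" using subsp_minus[OF sM am(2,4)] subsp_minus[OF s(1) am(1,3)] by auto
    show ?thesis
    proof
      assume "eqm N (a \<oplus> m) (a' \<oplus> m')"
      then have n: "(a \<ominus> a') \<oplus> (m \<ominus> m') \<in> N" using d by (simp add: eqm_def)
      then have "a \<ominus> a' \<in> M" using subsp_add_cancel2[OF sM mm(1)] cl NZ by auto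
      then have 1: "a \<ominus> a' \<in> Z" using mm(2) M'(3) Z(2) by blast
      then have "m \<ominus> m' \<in> Z" using subsp_add_cancel[OF sZ 1] n NZ cl by auto
      then show "eqm Z a a' \<and> eqm Z m m'" using 1 cl by (simp add: eqm_def)
    next
      assume *: "eqm Z a a' \<and> eqm Z m m'"
      then have "a \<ominus> a' \<in> A \<inter> Z" "m \<ominus> m' \<in> N" using mm by (auto simp: eqm_def N_def)
      then have "(a \<ominus> a') \<oplus> (m \<ominus> m') \<in> N" using Z(3) BN subsp_add[OF sN] by blast
      then show "eqm N (a \<oplus> m) (a' \<oplus> m')" using d cl by (simp add: eqm_def)
    qed
  qed
  have eqN': "N +> (a \<oplus> m) = N +> (a' \<oplus> m') \<longleftrightarrow> Z +> a = Z +> a' \<and> Z +> m = Z +> m'"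
    if am: "a \<in> A" "m \<in> M" "a' \<in> A" "m' \<in> M" for a m a' m'
    using eqN[OF am] coset_eq[OF _ _ sN, of "a \<oplus> m" "a' \<oplus> m'"] coset_eq[OF _ _ sZ] Ac Mc am by simp
  define h where "h S = (SOME p. \<exists>a\<in>A. \<exists>m\<in>M. S = N +> (a \<oplus> m) \<and> p = (Z +> a, Z +> m))" for S
  have h: "h (N +> (a \<oplus> m)) = (Z +> a, Z +> m)" if am: "a \<in> A" "m \<in> M" for a m
  proof -
    have "\<exists>p. \<exists>a'\<in>A. \<exists>m'\<in>M. N +> (a \<oplus> m) = N +> (a' \<oplus> m') \<and> p = (Z +> a', Z +> m')"
      using am by blast
    then have "\<exists>a'\<in>A. \<exists>m'\<in>M. N +> (a \<oplus> m) = N +> (a' \<oplus> m') \<and> h (N +> (a \<oplus> m)) = (Z +> a', Z +> m')"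
      unfolding h_def by (rule someI_ex)
    then show ?thesis using eqN' am by auto
  qed
  have rep: "\<exists>a m. a \<in> A \<and> m \<in> M \<and> S = N +> (a \<oplus> m)" if "S \<in> carrier (lie_quot L N)" for S
    using that decomp unfolding quot_simps(1) by blast
  have cS: "carrier ?S = coset_image Z ?I \<times> coset_image Z ?F" by (simp add: semidirect_def factor_simps)
  \<comment> \<open>Cosets of Z in Z + A and in Z + M have representatives in A and in M; this
    yields surjectivity of h.\<close>
  have absorb: "\<exists>a\<in>H. Z +> u = Z +> a" if H: "subsp H" and u: "u \<in> Z \<boxplus> H" for H u
  proof -
    obtain z a where za: "z \<in> Z" "a \<in> H" "u = z \<oplus> a" using u unfolding mem_sum by blast
    note cl = subsp_closed[OF sZ za(1)] subsp_closed[OF H za(2)]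
    have "eqm Z u a" using za cl by (simp add: eqm_def lin_simps)
    then have "Z +> u = Z +> a" using coset_eq[OF _ cl(2) sZ, of u] za cl by simp
    then show ?thesis using za(2) by blast
  qed
  have "lie_iso K (lie_quot L N) ?S h" unfolding lie_iso_def linear_map_def
  proof (intro conjI ballI)
    show "h \<in> carrier (lie_quot L N) \<rightarrow> carrier ?S"
    proof
      fix S assume "S \<in> carrier (lie_quot L N)"
      then obtain a m where "a \<in> A" "m \<in> M" "S = N +> (a \<oplus> m)" using rep by blast
      then show "h S \<in> carrier ?S" using h AI MF by (auto simp: cS)
    qed
  next
    fix S T assume "S \<in> carrier (lie_quot L N)" "T \<in> carrier (lie_quot L N)"
    then obtain a m a' m' where am: "a \<in> A" "m \<in> M" "S = N +> (a \<oplus> m)" "a' \<in> A" "m' \<in> M" "T = N +> (a' \<oplus> m')"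
      using rep by meson
    note cl = Ac[OF am(1)] Mc[OF am(2)] Ac[OF am(4)] Mc[OF am(5)]
    have "S \<oplus>\<^bsub>lie_quot L N\<^esub> T = N +> ((a \<oplus> m) \<oplus> (a' \<oplus> m'))" using am cl by (simp add: quot_simps opN)
    also have "(a \<oplus> m) \<oplus> (a' \<oplus> m') = (a \<oplus> a') \<oplus> (m \<oplus> m')" using cl by (simp add: M.a_ac)
    finally have "h (S \<oplus>\<^bsub>lie_quot L N\<^esub> T) = (Z +> (a \<oplus> a'), Z +> (m \<oplus> m'))"
      using h subsp_add[OF s(1) am(1,4)] subsp_add[OF sM am(2,5)] by simp
    then show "h (S \<oplus>\<^bsub>lie_quot L N\<^esub> T) = h S \<oplus>\<^bsub>?S\<^esub> h T"
      using am cl by (simp add: h semidirect_def factor_simps opZ)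
    have mA: "m \<otimes> a' \<in> A" "m' \<otimes> a \<in> A" "a \<otimes> a' \<in> A" using idl_left[OF i(1)] cl am by auto
    have aA: "(m \<otimes> a' \<ominus> m' \<otimes> a) \<oplus> a \<otimes> a' \<in> A"
      using subsp_add[OF s(1) subsp_minus[OF s(1) mA(1,2)] mA(3)] .
    have mM: "m \<otimes> m' \<in> M" using subalg_bracket[OF M'(1) am(2,5)] .
    have "S \<otimes>\<^bsub>lie_quot L N\<^esub> T = N +> ((a \<oplus> m) \<otimes> (a' \<oplus> m'))" using am cl by (simp add: quot_simps opN)
    also have "(a \<oplus> m) \<otimes> (a' \<oplus> m') = ((m \<otimes> a' \<ominus> m' \<otimes> a) \<oplus> a \<otimes> a') \<oplus> m \<otimes> m'"
      using cl bracket_anti[OF cl(4,1)] by (simp add: bracket_add_left bracket_add_right M.minus_eq M.a_ac)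
    finally have e1: "h (S \<otimes>\<^bsub>lie_quot L N\<^esub> T) = (Z +> ((m \<otimes> a' \<ominus> m' \<otimes> a) \<oplus> a \<otimes> a'), Z +> (m \<otimes> m'))"
      using h[OF aA mM] by simp
    have "h S \<otimes>\<^bsub>?S\<^esub> h T = (((Z +> (m \<otimes> a')) \<ominus>\<^bsub>factor L ?I Z\<^esub> (Z +> (m' \<otimes> a))) \<boxplus> (Z +> (a \<otimes> a')),
        Z +> (m \<otimes> m'))"
      using am cl by (simp add: h semidirect_def factor_simps quot_simps opZ)
    also have "(Z +> (m \<otimes> a')) \<ominus>\<^bsub>factor L ?I Z\<^esub> (Z +> (m' \<otimes> a)) = Z +> (m \<otimes> a' \<ominus> m' \<otimes> a)"
      by (rule factor_minus[OF idl_subalg[OF iI] Z(1)]) (use mA AI in auto)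
    finally show "h (S \<otimes>\<^bsub>lie_quot L N\<^esub> T) = h S \<otimes>\<^bsub>?S\<^esub> h T"
      using e1 cl by (simp add: opZ)
  next
    fix k S assume k: "k \<in> carrier K" and "S \<in> carrier (lie_quot L N)"
    then obtain a m where am: "a \<in> A" "m \<in> M" "S = N +> (a \<oplus> m)" using rep by blast
    note cl = Ac[OF am(1)] Mc[OF am(2)]
    have "k \<odot>\<^bsub>lie_quot L N\<^esub> S = N +> (k \<odot> a \<oplus> k \<odot> m)"
      using am cl k by (simp add: quot_simps opN smult_r_distr)
    then show "h (k \<odot>\<^bsub>lie_quot L N\<^esub> S) = k \<odot>\<^bsub>?S\<^esub> h S"
      using am cl k subsp_smult[OF s(1) k am(1)] subsp_smult[OF sM k am(2)]
      by (simp add: h semidirect_def factor_simps opZ)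
  next
    show "bij_betw h (carrier (lie_quot L N)) (carrier ?S)" unfolding bij_betw_def
    proof
      show "inj_on h (carrier (lie_quot L N))"
      proof (rule inj_onI)
        fix S T assume "S \<in> carrier (lie_quot L N)" "T \<in> carrier (lie_quot L N)" and e: "h S = h T"
        then obtain a m a' m' where am: "a \<in> A" "m \<in> M" "S = N +> (a \<oplus> m)" "a' \<in> A" "m' \<in> M" "T = N +> (a' \<oplus> m')"
          using rep by meson
        then show "S = T" using e h eqN' by simp
      qed
      show "h ` carrier (lie_quot L N) = carrier ?S"
      proof (intro subset_antisym subsetI)
        fix p assume "p \<in> h ` carrier (lie_quot L N)"
        then obtain S where "S \<in> carrier (lie_quot L N)" "p = h S" by blast
        moreover then obtain a m where "a \<in> A" "m \<in> M" "S = N +> (a \<oplus> m)" using rep by blast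
        ultimately show "p \<in> carrier ?S" using h AI MF by (auto simp: cS)
      next
        fix p assume "p \<in> carrier ?S"
        then obtain u v where uv: "u \<in> ?I" "v \<in> ?F" "p = (Z +> u, Z +> v)" unfolding cS by auto
        obtain a where a: "a \<in> A" "Z +> u = Z +> a" using absorb[OF s(1) uv(1)] by blast
        obtain m where m: "m \<in> M" "Z +> v = Z +> m" using absorb[OF sM uv(2)] by blast
        have "p = h (N +> (a \<oplus> m))" using h a m uv(3) by simp
        moreover have "N +> (a \<oplus> m) \<in> carrier (lie_quot L N)" using Ac Mc a m by (simp add: quot_simps)
        ultimately show "p \<in> h ` carrier (lie_quot L N)" by blast
      qed
    qed
  qed
  then show ?thesis by blast
qed

end

context fd_lie_alg begin

text \<open>The witnesses are C = Z, N = M \<inter> Z, X = N + P and F = Z + M. Raising P/P' to X/N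
  keeps M as a complement, and X/N is perspective to I/Z, which has none.\<close>

lemma cc'_configurationI:
  assumes ch: "chief P P'" and na: "\<not> abelian_factor P P'" and M: "compl P P' M"
    and n: "nonabelian_center I Z" and P: "P' \<subseteq> Z" "\<not> P \<subseteq> Z"
    and chQ: "chief Q Q'" and Q: "Q' \<subseteq> Z" "\<not> Q \<subseteq> Z" and nc: "\<not> complemented I Z"
  shows "cc'_configuration K L P P' Q Q'"
proof -
  note fP = nonabelian_center_factor[OF n ch P] and fQ = nonabelian_center_factor[OF n chQ Q]
  note i = chief_idl[OF ch] and s = chief_subsp[OF ch]
  have chI: "chief I Z" using n by (simp add: nonabelian_center_def)
  note iI = chief_idl[OF chI] and sI = chief_subsp[OF chI]
  have M': "subalg M" "P \<boxplus> M = carrier L" "P \<inter> M = P'" using M by (auto simp: compl_def)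
  have sM: "subsp M" using M'(1) subalg_subsp by blast
  define N where "N = M \<inter> Z"
  define X where "X = N \<boxplus> P"
  note iso = split_quotient_iso[OF ch na M fP(2)[symmetric] N_def]
  have iN: "idl N" unfolding N_def fP(2)[symmetric] by (rule idl_complement_Int_centralizer[OF ch na M])
  note sN = idl_subsp[OF iN]
  have iX: "idl X" unfolding X_def using idl_sum[OF iN i(1)] .
  have NZ: "N \<subseteq> Z" by (auto simp: N_def)
  have P'N: "P' \<subseteq> N" using M'(3) P(1) by (auto simp: N_def)
  have XZ: "X \<inter> Z = N"
    unfolding X_def modular[OF sN s(1) sI(2) NZ] using fP(4) P'N sum_absorb[OF sN s(2)] by (simp add: Int_commute)
  have NP: "N \<inter> P = P'" using fP(4) P'N NZ i(3) by blast
  have XI: "X \<subseteq> I" unfolding X_def fP(3)[symmetric] by (rule sum_mono[OF NZ subset_refl])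
  have ZX: "Z \<boxplus> X = I"
  proof -
    have "Z \<boxplus> X = (Z \<boxplus> N) \<boxplus> P" unfolding X_def using sum_assoc[OF sI(2) sN s(1)] by simp
    then show ?thesis using sum_absorb[OF sI(2) sN NZ] fP(3) by simp
  qed
  have chX: "chief X N" unfolding X_def using chief_transfer[OF iN i(1)] ch NP by simp
  have "compl X N M" unfolding compl_def
  proof (intro conjI M'(1))
    have "carrier L \<subseteq> X \<boxplus> M"
      using sum_mono[OF sum_upper2[OF sN s(1)] subset_refl, of M] M'(2) by (simp add: X_def)
    then show "X \<boxplus> M = carrier L" using subsp_subset[OF subsp_sum[OF idl_subsp[OF iX] sM]] by blast
    show "X \<inter> M = N" unfolding X_def
      using modular[OF sN s(1) sM] M'(3) P'N sum_absorb[OF sN s(2)] by (simp add: N_def)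
  qed
  then have cX: "c_factor K L X N" using chX by (auto simp: c_factor_iff complemented_def)
  have c'I: "c'_factor K L I Z" using chI nc by (simp add: c'_factor_iff)
  have sup: "supplement K L I Z (Z \<boxplus> M)" unfolding supplement_def
  proof (intro conjI)
    show "subalg (Z \<boxplus> M)" using subalg_sum[OF iI(2) M'(1)] .
    have sub: "P \<boxplus> M \<subseteq> I \<boxplus> (Z \<boxplus> M)"
      by (rule sum_mono) (use fP(3) sum_upper2[OF sI(2) s(1)] sum_upper2[OF sI(2) sM] in auto)
    then show "carrier L = I \<boxplus> (Z \<boxplus> M)"
      using M'(2) subsp_subset[OF subsp_sum[OF sI(1) subsp_sum[OF sI(2) sM]]] by auto
    show "Z \<subseteq> I \<inter> (Z \<boxplus> M)" using iI(3) sum_upper1[OF sI(2) sM] by blast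
  qed
  have F: "\<exists>F. supplement K L I Z F \<and> (\<exists>h. lie_iso K (lie_quot L N)
      (semidirect (factor L I Z) (monoid.mult (lie_quot L Z)) (factor L F Z)) h)"
    using sup iso[unfolded fP(3)] by blast
  have sear: "searrow L I Z Q Q'" "searrow L X N P P'" "searrow L I Z X N"
    using fQ(3,4) NP ZX XZ by (auto simp: searrow_def X_def)
  have NX: "N = X \<inter> Z" using XZ by simp
  show ?thesis unfolding cc'_configuration_def
    by (rule exI[of _ I], rule exI[of _ Z], rule exI[of _ X], rule exI[of _ N], intro conjI)
      (fact iI(1,2) iX iN sear c'I XI NX cX F primitive_center[OF n])+
qed

section \<open>Frattini factors and m-crossings\<close>

lemma frattini_abelian: "frattini_factor K L U V \<Longrightarrow> abelian_factor U V"
proof (rule ccontr)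
  assume f: "frattini_factor K L U V" and na: "\<not> abelian_factor U V"
  have ch: "chief U V" and inc: "\<And>M. maximal_subalgebra K L M \<Longrightarrow> V \<subseteq> M \<Longrightarrow> U \<subseteq> M"
    using f by (auto simp: frattini_factor_iff)
  obtain M where M: "maximal_subalgebra K L M" "V \<subseteq> M" "U \<boxplus> M = carrier L"
    by (rule nonabelian_max_supplemented[OF ch na])
  have sM: "subsp M" "M \<noteq> carrier L" using M(1) by (simp_all add: maximal_subalgebra_def lie_subalgebra_def)
  have "carrier L \<subseteq> M" using sum_least[OF sM(1) inc[OF M(1,2)] subset_refl] M(3) by simp
  then show False using sM subsp_subset[OF sM(1)] by simp
qed

lemma max_supplemented_not_frattini:
  assumes f: "frattini_factor K L U V" shows "\<not> max_supplemented K L U V"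
proof
  assume "max_supplemented K L U V"
  then obtain M where M: "maximal_subalgebra K L M" "U \<boxplus> M = carrier L" "V \<subseteq> M"
    by (auto simp: max_supplemented_iff)
  have sM: "subsp M" "M \<noteq> carrier L" using M(1) by (simp_all add: maximal_subalgebra_def lie_subalgebra_def)
  have "U \<subseteq> M" using f M by (simp add: frattini_factor_iff)
  then have "carrier L \<subseteq> M" using sum_least[OF sM(1) _ subset_refl] M(2) by metis
  then show False using sM subsp_subset[OF sM(1)] by simp
qed

lemma max_supplemented_or_frattini:
  assumes ch: "chief A B" shows "max_supplemented K L A B \<or> frattini_factor K L A B"
  using ch maximal_sum_ideal[OF _ chief_idl(1)[OF ch]]
  unfolding max_supplemented_iff frattini_factor_iff by blast

lemma frattini_not_complemented:
  assumes f: "frattini_factor K L U V" shows "\<not> complemented U V"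
proof
  assume "complemented U V"
  then obtain M where M: "compl U V M" by (auto simp: complemented_def)
  have ch: "chief U V" using f by (simp add: frattini_factor_iff)
  have max: "maximal_subalgebra K L M" by (rule abelian_compl_maximal[OF ch frattini_abelian[OF f] M])
  have "max_supplemented K L U V" using max M ch by (auto simp: max_supplemented_iff compl_def)
  then show False using max_supplemented_not_frattini[OF f] by simp
qed

text \<open>The Frattini factor is abelian and has no complement, while the perspective lower factor
  is abelian and its maximal supplement is a complement. This is the situation of
  \<open>abelian_crossing\<close>, so the other lower side of the diamond is abelian too.\<close>

lemma m_crossing_abelian:
  assumes f: "frattini_factor K L (V \<boxplus> W) V" and m: "max_supplemented K L W (V \<inter> W)"
    and ch: "chief V (V \<inter> W)"
  shows "abelian_factor V (V \<inter> W)"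
proof -
  have chU: "chief (V \<boxplus> W) V" and chW: "chief W (V \<inter> W)"
    using f m by (auto simp: frattini_factor_iff max_supplemented_iff)
  obtain M where M: "maximal_subalgebra K L M" "W \<boxplus> M = carrier L" "V \<inter> W \<subseteq> M"
    using m by (auto simp: max_supplemented_iff)
  have ab: "abelian_factor W (V \<inter> W)"
    using abelian_factor_transfer[OF chief_idl(1)[OF ch] chief_idl(1)[OF chW]] frattini_abelian[OF f] by simp
  have "compl W (V \<inter> W) M"
    using abelian_supplement_compl[OF chW ab _ M(2,3)] M(1) by (simp add: maximal_subalgebra_def)
  then show ?thesis
    using abelian_crossing[OF ch chW ab] frattini_not_complemented[OF f] by (auto simp: complemented_def)
qed

lemma searrowD: "searrow L A B C D \<Longrightarrow> A = B \<boxplus> C" "searrow L A B C D \<Longrightarrow> B \<inter> C = D"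
  by (simp_all add: searrow_def)

lemma searrow_refl: "chief A B \<Longrightarrow> searrow L A B A B"
  using sum_absorb[of A B] sum_comm[of B A] chief_subsp[of A B] chief_idl(3)[of A B]
  unfolding searrow_def by auto

lemma m_related_cases:
  assumes "m_related K L A B C D"
  obtains (common) R S where "max_supplemented K L R S" "searrow L R S A B" "searrow L R S C D"
  | (above) U V W X where "m_crossing K L U V W X" "searrow L V X A B" "searrow L W X C D"
  | (frattini) Y Z where "frattini_factor K L Y Z" "searrow L A B Y Z" "searrow L C D Y Z"
  | (below) U V W X where "m_crossing K L U V W X" "searrow L A B U V" "searrow L C D U W"
  using assms unfolding m_related_def by blast

lemma m_related_chief:
  assumes "m_related K L A B C D" shows "chief A B" "chief C D"
  using assms by (auto simp: m_related_def chief_factor_iff)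

lemma m_related_refl:
  assumes ch: "chief A B" shows "m_related K L A B A B"
  using max_supplemented_or_frattini[OF ch] searrow_refl[OF ch] ch
  unfolding m_related_def chief_factor_iff by blast

text \<open>Both factors are tied to a common chief factor or to one m-crossing, and these would
  degenerate if one factor lay below the other; in the last case W = U would give a Frattini factor
  a maximal supplement. Different positions of one chief series are comparable in this way and so
  never m-related.\<close>

lemma m_related_not_comparable:
  assumes m: "m_related K L A B C D" shows "\<not> A \<subseteq> D" "\<not> C \<subseteq> B"
proof -
  note ch = m_related_chief[OF m]
  note p = chief_idl(3)[OF ch(1)] chief_idl(3)[OF ch(2)]
  have "\<not> A \<subseteq> D \<and> \<not> C \<subseteq> B" using m
  proof (cases rule: m_related_cases)
    case (common R S)
    then show ?thesis using p searrowD(2)[OF common(2)] searrowD(2)[OF common(3)] by blast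
  next
    case (above U V W X)
    then show ?thesis using p searrowD(2)[OF above(2)] searrowD(2)[OF above(3)] by blast
  next
    case (frattini Y Z)
    have YZ: "Z \<subset> Y" and iY: "subsp Y" using frattini(1) chief_idl(3) chief_subsp by (auto simp: frattini_factor_iff)
    have "Y \<subseteq> A" "Y \<subseteq> C"
      using searrowD(1)[OF frattini(2)] searrowD(1)[OF frattini(3)] sum_upper2 iY chief_subsp(2)[OF ch(1)]
        chief_subsp(2)[OF ch(2)] by blast+
    then show ?thesis using YZ searrowD(2)[OF frattini(2)] searrowD(2)[OF frattini(3)] by blast
  next
    case (below U V W X)
    have f: "frattini_factor K L U V" and x: "searrow L U V W X" and ms: "max_supplemented K L W X"
      using below(1) by (auto simp: m_crossing_def)
    have chU: "chief U V" using f by (simp add: frattini_factor_iff)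
    have "Y \<subseteq> A \<and> Y \<subseteq> C" if "Y = U" for Y
      using that searrowD(1)[OF below(2)] searrowD(1)[OF below(3)] sum_upper2 chief_subsp(1)[OF chU]
        chief_subsp(2)[OF ch(1)] chief_subsp(2)[OF ch(2)] by blast
    then have UA: "U \<subseteq> A" "U \<subseteq> C" by auto
    have "\<not> A \<subseteq> D"
    proof
      assume "A \<subseteq> D"
      then have WU: "W = U" using UA searrowD(2)[OF below(3)] by blast
      then have "X = V" using searrowD(2)[OF x] chief_idl(3)[OF chU] by blast
      then show False using ms max_supplemented_not_frattini[OF f] WU by simp
    qed
    moreover have "\<not> C \<subseteq> B" using UA searrowD(2)[OF below(2)] chief_idl(3)[OF chU] by blast
    ultimately show ?thesis ..
  qed
  then show "\<not> A \<subseteq> D" "\<not> C \<subseteq> B" by auto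
qed

lemma m_related_chain:
  assumes X: "chief_chain n X D T" and kl: "k \<in> {1..n}" "l \<in> {1..n}"
    and m: "m_related K L (X k) (X (k - 1)) (X l) (X (l - 1))"
  shows "k = l"
proof (rule ccontr)
  assume "k \<noteq> l"
  then consider "k \<le> l - 1" | "l \<le> k - 1" by linarith
  then show False
  proof cases
    case 1
    then have "X k \<subseteq> X (l - 1)" by (rule chief_chain_mono[OF X]) (use kl in auto)
    then show ?thesis using m_related_not_comparable(1)[OF m] by simp
  next
    case 2
    then have "X l \<subseteq> X (k - 1)" by (rule chief_chain_mono[OF X]) (use kl in auto)
    then show ?thesis using m_related_not_comparable(2)[OF m] by simp
  qed
qed

lemma nonabelian_frattini_transfer:
  assumes "frattini_factor K L Y Z" "searrow L A B Y Z" "idl B" shows "abelian_factor A B"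
  using abelian_factor_transfer[OF assms(3), of Y] frattini_abelian[OF assms(1)]
    searrowD[OF assms(2)] assms(1) chief_idl(1)[of Y Z] by (auto simp: frattini_factor_iff)

text \<open>The nonabelian U/D' has a maximal supplement and links P/D to itself. For U/P and D'/D
  an m-crossing is impossible, so either the upper one is supplemented or both are Frattini. The two
  lower sides are unrelated because a relation between them would make P/D abelian.\<close>

lemma m_related_diamond:
  assumes chP: "chief P D" and na: "\<not> abelian_factor P D" and chD: "chief D' D"
    and chUP: "chief U P" and chUD: "chief U D'" and ne: "P \<noteq> D'"
  shows "m_related K L P D U D'" "m_related K L U P D' D" "\<not> m_related K L P D D' D"
proof -
  note d = chief_diamond[OF chUP chUD ne]
  note iP = chief_idl[OF chP] and iD = chief_idl[OF chD]
  note sP = chief_subsp[OF chP] and sD = chief_subsp[OF chD]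
  have PD: "P \<inter> D' = D"
  proof -
    have "P \<inter> D' = D \<or> P \<inter> D' = P" by (rule chiefD[OF chP idl_Int[OF iP(1) iD(1)]]) (use iP iD in auto)
    moreover have "P \<inter> D' \<noteq> P"
      using chiefD[OF chD iP(1)] ne iP(3) by auto
    ultimately show ?thesis by simp
  qed
  have s1: "searrow L U P D' D" using d(1) PD by (simp add: searrow_def)
  have s2: "searrow L U D' P D"
    using d(1) PD sum_comm[OF sP(1) sD(1)] by (simp add: searrow_def Int_commute)
  have naU: "\<not> abelian_factor U D'"
    using abelian_factor_transfer[OF iD(1) iP(1)] na searrowD[OF s2] by simp
  have ms: "max_supplemented K L U D'"
    using max_supplemented_or_frattini[OF chUD] frattini_abelian naU by blast
  show "m_related K L P D U D'"
    unfolding m_related_def chief_factor_iff using ms s2 searrow_refl[OF chUD] chP chUD by blast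
  have cross: "\<not> (frattini_factor K L U P \<and> max_supplemented K L D' D)"
    using m_crossing_abelian[of P D'] searrowD[OF s1] chP na by auto
  consider "max_supplemented K L U P" | "frattini_factor K L U P" "frattini_factor K L D' D"
    using max_supplemented_or_frattini[OF chUP] max_supplemented_or_frattini[OF chD] cross by blast
  then show "m_related K L U P D' D"
  proof cases
    case 1
    then show ?thesis
      unfolding m_related_def chief_factor_iff using s1 searrow_refl[OF chUP] chUP chD by blast
  next
    case 2
    then show ?thesis
      unfolding m_related_def chief_factor_iff using s1 searrow_refl[OF chD] chUP chD by blast
  qed
  show "\<not> m_related K L P D D' D"
  proof
    assume "m_related K L P D D' D"
    then show False
    proof (cases rule: m_related_cases)
      case (common R S)
      have iS: "idl S" using common(1) chief_idl by (auto simp: max_supplemented_iff)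
      note e = searrowD[OF common(2)] searrowD[OF common(3)]
      \<comment> \<open>P lies in R = S + D'. Brackets of P with S fall into S \<inter> P = D, and
        those with D' into P \<inter> D' = D.\<close>
      have "x \<otimes> y \<in> D" if x: "x \<in> P" and y: "y \<in> P" for x y
      proof -
        have "x \<in> S \<boxplus> D'" using e x sum_upper2[OF idl_subsp[OF iS] sP(1)] by auto
        then obtain u v where uv: "u \<in> S" "v \<in> D'" "x = u \<oplus> v" unfolding mem_sum by blast
        note cl = subsp_closed[OF idl_subsp[OF iS] uv(1)] subsp_closed[OF sD(1) uv(2)] subsp_closed[OF sP(1) y]
        have "u \<otimes> y \<in> D" using idl_right[OF iS cl(3) uv(1)] idl_left[OF iP(1) cl(1) y] e by auto
        moreover have "v \<otimes> y \<in> D" using idl_right[OF iD(1) cl(3) uv(2)] idl_left[OF iP(1) cl(2) y] PD by auto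
        ultimately show ?thesis using uv cl subsp_add[OF sP(2)] by (simp add: bracket_add_left)
      qed
      then show ?thesis using na by (simp add: abelian_factor_def)
    next
      case (above U1 V W X)
      have f: "frattini_factor K L U1 V" and x: "searrow L U1 V W X" and m: "max_supplemented K L W X"
        using above(1) by (auto simp: m_crossing_def)
      have iX: "idl X" using m chief_idl by (auto simp: max_supplemented_iff)
      note e = searrowD[OF x] searrowD[OF above(2)]
      have chV: "chief V X" using chief_transfer[OF iX iP(1)] chP e by simp
      have "abelian_factor V X" using m_crossing_abelian[of V W] f m chV e by simp
      then show ?thesis using abelian_factor_transfer[OF iX iP(1)] na e by simp
    next
      case (frattini Y Z)
      then show ?thesis using nonabelian_frattini_transfer[OF frattini(1,2) iP(2)] na by simp
    next
      case (below U1 V W X)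
      then show ?thesis using nonabelian_frattini_transfer[OF _ below(2) iP(2)] na by (simp add: m_crossing_def)
    qed
  qed
qed

lemma m_perm_diamond:
  assumes X: "chief_chain n X {\<zero>} (carrier L)" and Y: "chief_chain n Y {\<zero>} (carrier L)"
    and i: "1 \<le> i" "i < n" and same: "\<And>k. k \<noteq> i \<Longrightarrow> X k = Y k" and ne: "X i \<noteq> Y i"
    and na: "\<not> abelian_factor (X i) (X (i - 1))"
  shows "m_perm K L n X Y = transpose i (Suc i)"
proof -
  let ?\<tau> = "transpose i (Suc i)"
  let ?rel = "\<lambda>k l. m_related K L (X k) (X (k - 1)) (Y l) (Y (l - 1))"
  have chX: "chief (X k) (X (k - 1))" and chY: "chief (Y k) (Y (k - 1))" if "k \<in> {1..n}" for k
    using X Y that by (auto simp: chief_chain_def)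
  have in1: "i \<in> {1..n}" "Suc i \<in> {1..n}" using i by auto
  have eqs: "X (i - 1) = Y (i - 1)" "X (Suc i) = Y (Suc i)" using same i by auto
  note dia = m_related_diamond[OF chX[OF in1(1)] na _ _ _ ne, of "X (Suc i)"]
  have D: "chief (Y i) (X (i - 1))" "chief (X (Suc i)) (X i)" "chief (X (Suc i)) (Y i)"
    using chY[OF in1(1)] chX[OF in1(2)] chY[OF in1(2)] eqs by simp_all
  note rel = dia[OF D]
  have fixed: "X k = Y k" "X (k - 1) = Y (k - 1)" if "k \<noteq> i" "k \<noteq> Suc i" "k \<in> {1..n}" for k
    using same that by auto
  have ex: "?\<tau> permutes {1..n} \<and> (\<forall>k\<in>{1..n}. ?rel k (?\<tau> k))"
  proof (intro conjI ballI)
    show "?\<tau> permutes {1..n}" using in1 by (rule permutes_swap_id)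
    fix k assume k: "k \<in> {1..n}"
    show "?rel k (?\<tau> k)"
    proof (cases "k = i \<or> k = Suc i")
      case True
      then show ?thesis using rel(1,2) eqs by auto
    next
      case False
      then have "?\<tau> k = k" by (simp add: transpose_def)
      then show ?thesis using m_related_refl[OF chX[OF k]] fixed[OF _ _ k] False by simp
    qed
  qed
  have uniq: "\<pi> = ?\<tau>" if \<pi>: "\<pi> permutes {1..n}" "\<forall>k\<in>{1..n}. ?rel k (\<pi> k)" for \<pi>
  proof -
    have in\<pi>: "\<pi> k \<in> {1..n}" if "k \<in> {1..n}" for k using \<pi>(1) permutes_in_image that by fastforce
    have inj: "\<pi> k = \<pi> l \<Longrightarrow> k = l" for k l using permutes_inj[OF \<pi>(1)] by (simp add: inj_eq)
    have outside: "l = k" if "k \<in> {1..n}" "l \<in> {1..n}" "l \<noteq> i" "l \<noteq> Suc i" "?rel k l" for k l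
      using m_related_chain[OF X that(1,2)] that(5) fixed[OF that(3,4,2)] by simp
    have pi: "\<pi> i = Suc i"
    proof -
      have r: "?rel i (\<pi> i)" using \<pi>(2) in1 by blast
      have "\<pi> i = i \<or> \<pi> i = Suc i" using outside[OF in1(1) in\<pi>[OF in1(1)]] r by auto
      moreover have "\<pi> i \<noteq> i" using r rel(3) eqs by auto
      ultimately show ?thesis by blast
    qed
    have pSi: "\<pi> (Suc i) = i"
    proof -
      have r: "?rel (Suc i) (\<pi> (Suc i))" using \<pi>(2) in1 by blast
      have "\<pi> (Suc i) \<noteq> Suc i" using inj[of "Suc i" i] pi by auto
      then show ?thesis using outside[OF in1(2) in\<pi>[OF in1(2)] _ _ r] by auto
    qed
    have "\<pi> k = ?\<tau> k" for k
    proof (cases "k \<in> {1..n} \<and> k \<noteq> i \<and> k \<noteq> Suc i")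
      case True
      then have r: "?rel k (\<pi> k)" using \<pi>(2) by blast
      have "\<pi> k \<noteq> i" "\<pi> k \<noteq> Suc i" using inj[of k "Suc i"] inj[of k i] pi pSi True by auto
      then have "\<pi> k = k" using outside[OF _ in\<pi> _ _ r] True by auto
      then show ?thesis using True by (simp add: transpose_def)
    next
      case False
      then show ?thesis using pi pSi permutes_not_in[OF \<pi>(1)] in1 by (auto simp: transpose_def)
    qed
    then show ?thesis by blast
  qed
  show ?thesis unfolding m_perm_def
    by (rule the_equality) (use ex uniq in blast)+
qed

end

section \<open>Counting complemented factors\<close>

context fd_lie_alg begin

definition centers :: "'a set set" where "centers = {Z. \<exists>I. nonabelian_center I Z}"

definition top_ideal :: "'a set \<Rightarrow> 'a set" where "top_ideal Z = (THE I. nonabelian_center I Z)"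

lemma nonabelian_center_chief: "nonabelian_center I Z \<Longrightarrow> chief I Z"
  by (simp add: nonabelian_center_def)

lemma top_ideal_eq: "nonabelian_center I Z \<Longrightarrow> top_ideal Z = I"
  unfolding top_ideal_def using nonabelian_center_unique[OF _ nonabelian_center_chief]
  by (metis the_equality)

lemma top_ideal: "Z \<in> centers \<Longrightarrow> nonabelian_center (top_ideal Z) Z"
  using top_ideal_eq by (auto simp: centers_def)

lemma top_ideal_chief:
  assumes "Z \<in> centers"
  shows "chief (top_ideal Z) Z" "\<not> abelian_factor (top_ideal Z) Z" "centralizer (top_ideal Z) Z = Z"
    "idl (top_ideal Z)" "idl Z" "Z \<subseteq> top_ideal Z"
proof -
  show "chief (top_ideal Z) Z" "\<not> abelian_factor (top_ideal Z) Z" "centralizer (top_ideal Z) Z = Z"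
    using top_ideal[OF assms] by (simp_all add: nonabelian_center_def)
  from chief_idl[OF this(1)] show "idl (top_ideal Z)" "idl Z" "Z \<subseteq> top_ideal Z" by auto
qed

text \<open>In a chief series \<open>X\<close>, the chief factor with centralizer \<open>Z\<close> sits at position
  \<open>level X Z\<close>.\<close>

definition level :: "(nat \<Rightarrow> 'a set) \<Rightarrow> 'a set \<Rightarrow> nat" where
  "level X Z = (LEAST k. \<not> X k \<subseteq> Z)"

lemma level:
  assumes X: "chief_chain n X {\<zero>} (carrier L)" and Z: "Z \<in> centers"
  shows "level X Z \<in> {1..n}" "X (level X Z - 1) \<subseteq> Z" "\<not> X (level X Z) \<subseteq> Z"
    "\<And>k. k < level X Z \<Longrightarrow> X k \<subseteq> Z"
proof -
  note t = top_ideal_chief[OF Z]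
  have "\<not> X n \<subseteq> Z"
    using X chief_idl(3)[OF t(1)] subsp_subset[OF idl_subsp[OF t(4)]] by (auto simp: chief_chain_def)
  then show 1: "\<not> X (level X Z) \<subseteq> Z" unfolding level_def by (rule LeastI)
  have "level X Z \<le> n" unfolding level_def by (rule Least_le) fact
  moreover have "level X Z \<noteq> 0"
  proof
    assume "level X Z = 0"
    then have "\<not> {\<zero>} \<subseteq> Z" using 1 X by (simp add: chief_chain_def)
    then show False using subsp_zero[OF idl_subsp[OF t(5)]] by simp
  qed
  ultimately show 2: "level X Z \<in> {1..n}" by simp
  show 3: "X k \<subseteq> Z" if "k < level X Z" for k using not_less_Least[of k "\<lambda>k. \<not> X k \<subseteq> Z"] that by (auto simp: level_def)
  show "X (level X Z - 1) \<subseteq> Z" by (rule 3) (use 2 in simp)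
qed

lemma level_eq:
  assumes X: "chief_chain n X {\<zero>} (carrier L)" and k: "k \<in> {1..n}" "X (k - 1) \<subseteq> Z" "\<not> X k \<subseteq> Z"
  shows "level X Z = k"
  unfolding level_def
proof (rule Least_equality)
  show "\<not> X k \<subseteq> Z" using k(3) .
next
  fix y assume y: "\<not> X y \<subseteq> Z"
  show "k \<le> y"
  proof (rule ccontr)
    assume "\<not> k \<le> y"
    then have "X y \<subseteq> X (k - 1)" by (intro chief_chain_mono[OF X]) (use k in auto)
    then show False using y k(2) by blast
  qed
qed

lemma level_factor:
  assumes X: "chief_chain n X {\<zero>} (carrier L)" and Z: "Z \<in> centers"
  shows "chief (X (level X Z)) (X (level X Z - 1))" "\<not> abelian_factor (X (level X Z)) (X (level X Z - 1))"
    "centralizer (X (level X Z)) (X (level X Z - 1)) = Z"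
proof -
  note l = level[OF X Z]
  show ch: "chief (X (level X Z)) (X (level X Z - 1))" using X l(1) unfolding chief_chain_def by blast
  show "\<not> abelian_factor (X (level X Z)) (X (level X Z - 1))"
    "centralizer (X (level X Z)) (X (level X Z - 1)) = Z"
    using nonabelian_center_factor(1,2)[OF top_ideal[OF Z] ch l(2,3)] by auto
qed

text \<open>Z is recovered from its factor as the centralizer, and every nonabelian factor arises
  from its own centralizer. So all chief series have the same number of nonabelian factors, namely
  \<open>card centers\<close>.\<close>

lemma level_image:
  assumes X: "chief_chain n X {\<zero>} (carrier L)"
  shows "inj_on (level X) centers"
    "level X ` centers = {k \<in> {1..n}. \<not> abelian_factor (X k) (X (k - 1))}"
proof -
  show "inj_on (level X) centers"
    using level_factor(3)[OF X] by (metis inj_onI)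
  show "level X ` centers = {k \<in> {1..n}. \<not> abelian_factor (X k) (X (k - 1))}"
  proof (intro subset_antisym subsetI)
    fix k assume "k \<in> level X ` centers"
    then show "k \<in> {k \<in> {1..n}. \<not> abelian_factor (X k) (X (k - 1))}"
      using level(1)[OF X] level_factor(2)[OF X] by blast
  next
    fix k assume "k \<in> {k \<in> {1..n}. \<not> abelian_factor (X k) (X (k - 1))}"
    then have k: "k \<in> {1..n}" "\<not> abelian_factor (X k) (X (k - 1))" by auto
    then have ch: "chief (X k) (X (k - 1))" using X unfolding chief_chain_def by blast
    let ?Z = "centralizer (X k) (X (k - 1))"
    have "?Z \<in> centers" using nonabelian_center_centralizer[OF ch k(2)] by (auto simp: centers_def)
    moreover have "level X ?Z = k"
      by (rule level_eq[OF X k(1)]) (use centralizer_props[OF ch k(2)] in auto)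
    ultimately show "k \<in> level X ` centers" by (metis imageI)
  qed
qed

definition noncomplemented_centers :: "(nat \<Rightarrow> 'a set) \<Rightarrow> 'a set set" where
  "noncomplemented_centers X = {Z \<in> centers. \<not> complemented (X (level X Z)) (X (level X Z - 1))}"

lemma finite_centers: "finite centers"
proof -
  obtain n X where "chief_chain n X {\<zero>} (carrier L)"
    using ex_chief_chain[OF idl_carrier idl_triv] by auto
  from level_image[OF this] have "finite (level X ` centers)" "inj_on (level X) centers" by auto
  then show ?thesis by (rule finite_imageD)
qed

text \<open>The right-hand side is the same for all chief series, so comparing
  \<open>num_c_factors\<close> amounts to comparing the noncomplemented nonabelian factors. The
  additive form avoids subtraction of natural numbers.\<close>

lemma num_c_factors_eq:
  assumes X: "chief_chain n X {\<zero>} (carrier L)"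
  shows "num_c_factors K L n X + card (noncomplemented_centers X) =
    (\<Sum>k\<in>{1..n}. abelian_complemented (X k) (X (k - 1))) + card centers"
proof -
  let ?ab = "\<lambda>k. abelian_factor (X k) (X (k - 1))" and ?c = "\<lambda>k. complemented (X k) (X (k - 1))"
  have ch: "chief (X k) (X (k - 1))" if "k \<in> {1..n}" for k using X that unfolding chief_chain_def by blast
  have "{k \<in> {1..n}. c_factor K L (X k) (X (k - 1))} =
      {k \<in> {1..n}. ?ab k \<and> ?c k} \<union> {k \<in> {1..n}. \<not> ?ab k \<and> ?c k}"
    using ch by (auto simp: c_factor_iff)
  then have 1: "num_c_factors K L n X = card {k \<in> {1..n}. ?ab k \<and> ?c k} + card {k \<in> {1..n}. \<not> ?ab k \<and> ?c k}"
    unfolding num_c_factors_def by (simp add: card_Un_disjoint disjoint_iff)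
  have 2: "(\<Sum>k\<in>{1..n}. abelian_complemented (X k) (X (k - 1))) = card {k \<in> {1..n}. ?ab k \<and> ?c k}"
    unfolding abelian_complemented_def by (simp add: sum.If_cases Int_def)
  let ?C = "{Z \<in> centers. ?c (level X Z)}"
  have "{k \<in> {1..n}. \<not> ?ab k \<and> ?c k} = {k \<in> level X ` centers. ?c k}"
    unfolding level_image(2)[OF X] by blast
  also have "\<dots> = level X ` ?C" by blast
  finally have img: "{k \<in> {1..n}. \<not> ?ab k \<and> ?c k} = level X ` ?C" .
  have 3: "card {k \<in> {1..n}. \<not> ?ab k \<and> ?c k} = card ?C"
    unfolding img by (intro card_image inj_on_subset[OF level_image(1)[OF X]]) simp
  have un: "centers = ?C \<union> noncomplemented_centers X" and dis: "?C \<inter> noncomplemented_centers X = {}"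
    by (auto simp: noncomplemented_centers_def)
  have "finite ?C" "finite (noncomplemented_centers X)"
    using finite_centers by (auto simp: noncomplemented_centers_def)
  then have "card centers = card ?C + card (noncomplemented_centers X)"
    using card_Un_disjoint[OF _ _ dis] un by simp
  then show ?thesis using 1 2 3 by simp
qed

definition center_equiv :: "'a set \<Rightarrow> 'a set \<Rightarrow> bool" where
  "center_equiv Z Z' \<longleftrightarrow> factor_equiv (top_ideal Z) Z (top_ideal Z') Z'"

lemma center_equiv_refl: "center_equiv Z Z"
  by (simp add: center_equiv_def factor_equiv_refl)

lemma center_equiv_sym: "Z \<in> centers \<Longrightarrow> center_equiv Z Z' \<Longrightarrow> center_equiv Z' Z"
  unfolding center_equiv_def by (rule factor_equiv_sym[OF top_ideal_chief(4,5)])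

lemma center_equiv_trans: "center_equiv Z Z' \<Longrightarrow> center_equiv Z' Z'' \<Longrightarrow> center_equiv Z Z''"
  unfolding center_equiv_def by (rule factor_equiv_trans)

lemma factor_equiv_center:
  assumes ch: "chief A B" and na: "\<not> abelian_factor A B" and Z: "Z = centralizer A B"
  shows "Z \<in> centers" "factor_equiv A B (top_ideal Z) Z" "factor_equiv (top_ideal Z) Z A B"
proof -
  note n = nonabelian_center_centralizer[OF ch na, folded Z]
  note p = centralizer_props[OF ch na, folded Z]
  show "Z \<in> centers" using n by (auto simp: centers_def)
  note i = chief_idl[OF ch]
  have e: "Z \<inter> A = B" using p(3) by blast
  have "equiv_data (\<lambda>x. x) (\<lambda>x. \<zero>) A B (Z \<boxplus> A) Z"
    using equiv_data_transfer[OF p(1) i(1)] e by simp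
  then have "factor_equiv A B (Z \<boxplus> A) Z"
    using i p(1) sum_upper1[OF idl_subsp[OF p(1)] idl_subsp[OF i(1)]]
    by (intro data_factor_equiv idl_sum) auto
  then show 1: "factor_equiv A B (top_ideal Z) Z" using top_ideal_eq[OF n] by simp
  show "factor_equiv (top_ideal Z) Z A B" by (rule factor_equiv_sym[OF i(1,2) 1])
qed

lemma noncomplemented_centers_inequivalent:
  assumes X: "chief_chain n X {\<zero>} (carrier L)"
    and Z: "Z \<in> noncomplemented_centers X" and Z': "Z' \<in> noncomplemented_centers X"
    and eq: "center_equiv Z Z'"
  shows "Z = Z'"
proof -
  have wlog: "complemented (X (level X Z)) (X (level X Z - 1))"
    if Z: "Z \<in> centers" and Z': "Z' \<in> centers" and eq: "center_equiv Z Z'" and lt: "level X Z < level X Z'"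
    for Z Z'
  proof -
    let ?A = "X (level X Z)" and ?B = "X (level X Z - 1)"
    let ?A' = "X (level X Z')" and ?B' = "X (level X Z' - 1)"
    note f = level_factor[OF X Z] and f' = level_factor[OF X Z']
    note i = chief_idl[OF f(1)] and i' = chief_idl[OF f'(1)]
    have "factor_equiv ?A ?B ?A' ?B'"
      using factor_equiv_trans[OF factor_equiv_trans[OF
        factor_equiv_center(2)[OF f(1,2) f(3)[symmetric]] eq[unfolded center_equiv_def]]
        factor_equiv_center(3)[OF f'(1,2) f'(3)[symmetric]]] .
    then obtain \<phi> \<delta> where d: "equiv_data \<phi> \<delta> ?A ?B ?A' ?B'"
      by (rule factor_equiv_data[rotated 6]) (use i i' in auto)
    \<comment> \<open>All terms of the series before the level of Z' lie inside Z', so the lower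
      factor centralizes the upper one, as \<open>equiv_complemented_below\<close> requires.\<close>
    have "?A \<subseteq> centralizer ?A' ?B'" unfolding f'(3) using level(4)[OF X Z' lt] .
    then show ?thesis by (rule equiv_complemented_below[OF d f(1) f'(1,2)])
  qed
  have c: "Z \<in> centers" "Z' \<in> centers" using Z Z' by (auto simp: noncomplemented_centers_def)
  have "level X Z = level X Z'"
    using wlog[OF c eq] wlog[OF c(2,1) center_equiv_sym[OF c(1) eq]] Z Z'
    by (auto simp: noncomplemented_centers_def intro: linorder_cases[of "level X Z" "level X Z'"])
  then show ?thesis using inj_onD[OF level_image(1)[OF X]] c by blast
qed

section \<open>Producing an \<open>L\<close>-algebra of cc'-type\<close>

lemma chief_chain_append:
  assumes f: "chief_chain p f D E" and c: "chief P E" and c': "chief U P" and g: "chief_chain q g U T"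
  shows "chief_chain (p + 2 + q) (\<lambda>k. if k \<le> p then f k else if k = Suc p then P else g (k - p - 2)) D T"
    (is "chief_chain _ ?h _ _")
proof -
  have "chief (?h k) (?h (k - 1))" if k: "k \<in> {1..p + 2 + q}" for k
  proof -
    consider "k \<le> p" | "k = Suc p" | "k = Suc (Suc p)" | "k > Suc (Suc p)" by linarith
    then show ?thesis
    proof cases
      case 1
      then show ?thesis using f k by (auto simp: chief_chain_def)
    next
      case 2
      then show ?thesis using f c by (simp add: chief_chain_def)
    next
      case 3
      then show ?thesis using g c' by (simp add: chief_chain_def)
    next
      case 4
      \<comment> \<open>The chain g starts with U at index p + 2, so position k holds the term of g
        with index j + 1, and j is the index of the term below it.\<close>
      define j where "j = k - p - 3"
      have j: "j < q" "k = j + p + 3" using 4 k by (auto simp: j_def)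
      then show ?thesis using chief_chain_step[OF g j(1)] by (simp add: Suc_diff_le numeral_3_eq_3)
    qed
  qed
  moreover have "?h 0 = D" using f by (simp add: chief_chain_def)
  moreover have "?h (p + 2 + q) = T" using g by (simp add: chief_chain_def)
  ultimately show ?thesis unfolding chief_chain_def by blast
qed

text \<open>Moving \<open>A/B\<close> up towards \<open>I/Z\<close>, complementability is lost at some step from \<open>D\<close> to \<open>D'\<close>; two
  chief series that differ only in this diamond match a \<open>c\<close>-factor with a \<open>c'\<close>-factor.\<close>

lemma cc'_type_exists:
  assumes ch: "chief A B" and na: "\<not> abelian_factor A B" and c: "complemented A B"
    and Z: "Z = centralizer A B" and nc: "\<not> complemented (top_ideal Z) Z"
    and m': "\<not> (\<exists>M. compl A B M \<and> maximal_subalgebra K L M)"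
  shows "\<exists>P D. cc'_type K L (factor L P D) (factor_action L D) \<and> chief P D \<and>
    \<not> abelian_factor P D \<and> centralizer P D = Z"
proof -
  note zc = factor_equiv_center(1)[OF ch na Z]
  note t = top_ideal_chief[OF zc] and n = top_ideal[OF zc]
  note p = centralizer_props[OF ch na, folded Z]
  note i = chief_idl[OF ch] and s = chief_subsp[OF ch] and sZ = idl_subsp[OF t(5)]
  have ZA: "Z \<boxplus> A = top_ideal Z" using nonabelian_center_factor(3)[OF n ch p(2,4)] .
  \<comment> \<open>The ideals to which A/B can be raised without losing the complement. B is one of
    them and Z is not, so above a maximal one, D, there is still a chief step D' inside Z.\<close>
  let ?R = "\<lambda>D. idl D \<and> B \<subseteq> D \<and> D \<subseteq> Z \<and> complemented (D \<boxplus> A) D"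
  have BA: "B \<boxplus> A = A" using sum_absorb[OF s] sum_comm[OF s] i(3) by auto
  obtain D where RD: "?R D" and max: "\<And>H. ?R H \<Longrightarrow> D \<subseteq> H \<Longrightarrow> H = D"
    by (rule ex_maximal_subsp[of ?R B]) (use i(2) p(2) c BA in \<open>auto simp: lie_ideal_def\<close>)
  then have D: "idl D" "B \<subseteq> D" "D \<subseteq> Z" "complemented (D \<boxplus> A) D" by auto
  note sD = idl_subsp[OF D(1)]
  have "D \<noteq> Z" using D(4) nc ZA by auto
  then obtain D' where D': "chief D' D" "D' \<subseteq> Z" using ex_chief_above[OF D(1) t(5)] D(3) by blast
  note iD' = chief_idl[OF D'(1)] and sD' = chief_subsp[OF D'(1)]
  have ncD': "\<not> complemented (D' \<boxplus> A) D'" using max[of D'] iD' D(2) D'(2) by blast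
  define P where "P = D \<boxplus> A"
  define U where "U = D' \<boxplus> A"
  have DA: "D \<inter> A = B" and D'A: "D' \<inter> A = B" using D(2,3) D'(2) iD'(3) p(3) i(3) by blast+
  have chP: "chief P D" unfolding P_def using chief_transfer[OF D(1) i(1)] ch DA by simp
  have chUD: "chief U D'" unfolding U_def using chief_transfer[OF iD'(1) i(1)] ch D'A by simp
  note sP = chief_subsp[OF chP] and iP = chief_idl[OF chP]
  have PZ: "D \<subseteq> Z" "\<not> P \<subseteq> Z" using D(3) p(4) sum_upper2[OF sD s(1)] by (auto simp: P_def)
  have UZ: "D' \<subseteq> Z" "\<not> U \<subseteq> Z" using D'(2) p(4) sum_upper2[OF sD'(1) s(1)] by (auto simp: U_def)
  note fP = nonabelian_center_factor[OF n chP PZ]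
  have UP: "P \<boxplus> D' = U"
  proof -
    have "P \<boxplus> D' = D' \<boxplus> (D \<boxplus> A)" unfolding P_def using sum_comm[OF subsp_sum[OF sD s(1)] sD'(1)] by simp
    also have "\<dots> = (D' \<boxplus> D) \<boxplus> A" using sum_assoc[OF sD'(1) sD s(1)] by simp
    also have "D' \<boxplus> D = D'" using sum_absorb[OF sD'(1) sD] iD'(3) by auto
    finally show ?thesis by (simp add: U_def)
  qed
  have PD': "P \<inter> D' = D"
  proof -
    have DD': "D \<subseteq> D'" using iD'(3) by auto
    have "P \<inter> D' = D \<boxplus> (A \<inter> D')" unfolding P_def by (rule modular[OF sD s(1) sD'(1) DD'])
    then show ?thesis using D'A sum_absorb[OF sD s(2) D(2)] by (simp add: Int_commute)
  qed
  have chUP: "chief U P"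
    using chief_transfer[OF iP(1) iD'(1)] D'(1) UP PD' by simp
  have ne: "P \<noteq> D'" using PZ(2) D'(2) by blast
  \<comment> \<open>A maximal complement of P/D would also complement A/B, as the same
    subalgebra.\<close>
  have m'P: "\<not> (\<exists>M. compl P D M \<and> maximal_subalgebra K L M)"
    using m' compl_transfer[OF D(1) i(1)] DA unfolding P_def by auto
  obtain M where M: "compl P D M" using D(4) by (auto simp: complemented_def P_def)
  have ncU: "\<not> complemented U D'" using ncD' by (simp add: U_def)
  have naU: "\<not> abelian_factor U D'" using nonabelian_center_factor(1)[OF n chUD UZ] .
  obtain q f where f: "chief_chain q f {\<zero>} D"
    using ex_chief_chain[OF D(1) idl_triv] subsp_zero[OF sD] by auto
  obtain r g where g: "chief_chain r g U (carrier L)"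
    using ex_chief_chain[OF idl_carrier chief_idl(1)[OF chUD]] subsp_subset[OF chief_subsp(1)[OF chUD]] by auto
  \<comment> \<open>Both series follow f up to D and g from U on; only the term at position q + 1
    differs, P in one and D' in the other.\<close>
  define X where "X k = (if k \<le> q then f k else if k = Suc q then P else g (k - q - 2))" for k
  define Y where "Y k = (if k \<le> q then f k else if k = Suc q then D' else g (k - q - 2))" for k
  let ?n = "q + 2 + r"
  have chX: "chief_chain ?n X {\<zero>} (carrier L)"
    using chief_chain_append[OF f chP chUP g] unfolding X_def .
  have chY: "chief_chain ?n Y {\<zero>} (carrier L)"
    using chief_chain_append[OF f D'(1) chUD g] unfolding Y_def .
  have fq: "f q = D" "g 0 = U" using f g by (auto simp: chief_chain_def)
  have vals: "X (Suc q) = P" "X (Suc q - 1) = D" "Y (Suc q) = D'" "Y (Suc (Suc q)) = U"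
    "Y (Suc (Suc q) - 1) = D'"
    using fq by (simp_all add: X_def Y_def)
  have perm: "m_perm K L ?n X Y = transpose (Suc q) (Suc (Suc q))"
    by (rule m_perm_diamond[OF chX chY]) (use vals ne fP(1) in \<open>auto simp: X_def Y_def\<close>)
  have pv: "m_perm K L ?n X Y (Suc q) = Suc (Suc q)" unfolding perm by simp
  have conf: "cc'_configuration K L P D U D'"
    by (rule cc'_configurationI[OF chP fP(1) M n PZ chUD UZ nc])
  have "cc'_type K L (factor L P D) (factor_action L D)"
    unfolding cc'_type_def
  proof (rule conjI[OF irreducible_factor[OF chP]], intro exI conjI bexI)
    show "chief_series K L ?n X" "chief_series K L ?n Y" using chX chY by (simp_all add: chief_series_iff)
    show "P = X (Suc q)" "D = X (Suc q - 1)" using vals by auto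
    show "U = Y (m_perm K L ?n X Y (Suc q))" "D' = Y (m_perm K L ?n X Y (Suc q) - 1)"
      unfolding pv using vals by auto
    show "L_equivalent K L (factor L P D) (factor_action L D) (factor L P D) (factor_action L D)"
      by (rule L_equivalent_refl)
    show "m'_factor K L P D" using chP m'P by (simp add: m'_factor_iff)
    show "m'_factor K L U D'" using chUD ncU by (auto simp: m'_factor_iff complemented_def)
    show "nonabelian_on (factor L P D) (carrier (factor L P D))"
      using nonabelian_on_iff[OF iP(1,2)] fP(1) by simp
    show "nonabelian_on (factor L U D') (carrier (factor L U D'))"
      using nonabelian_on_iff[OF chief_idl(1,2)[OF chUD]] naU by simp
    show "c_factor K L P D \<and> c'_factor K L U D' \<and> cc'_configuration K L P D U D' \<or>
        c_factor K L U D' \<and> c'_factor K L P D \<and> cc'_configuration K L U D' P D"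
      using conf M chP chUD ncU by (auto simp: c_factor_iff c'_factor_iff complemented_def)
    show "Suc q \<in> {1..?n}" by simp
  qed
  then show ?thesis using chP fP(1,2) by blast
qed

text \<open>The last factor of \<open>X\<close> in its \<open>L\<close>-equivalence class cannot have a maximal complement,
  for such a complement would produce an equivalent factor further up.\<close>

lemma class_cc'_type:
  assumes X: "chief_chain n X {\<zero>} (carrier L)" and Z: "Z \<in> centers"
    and nc: "\<not> complemented (top_ideal Z) Z"
    and all: "\<And>Z'. Z' \<in> centers \<Longrightarrow> center_equiv Z Z' \<Longrightarrow> Z' \<notin> noncomplemented_centers X"
  shows "\<exists>P D. cc'_type K L (factor L P D) (factor_action L D) \<and> factor_equiv (top_ideal Z) Z P D"
proof -
  let ?E = "{Z' \<in> centers. center_equiv Z Z'}"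
  have fin: "finite (level X ` ?E)" "level X ` ?E \<noteq> {}" using finite_centers Z center_equiv_refl by auto
  obtain Z1 where "Z1 \<in> ?E" "level X Z1 = Max (level X ` ?E)" using Max_in[OF fin] by force
  then have "Z1 \<in> ?E \<and> (\<forall>Z'\<in>?E. level X Z' \<le> level X Z1)" using Max_ge[OF fin(1)] by simp
  then obtain Z1 where Z1: "Z1 \<in> centers" "center_equiv Z Z1"
    and last: "\<And>Z'. Z' \<in> centers \<Longrightarrow> center_equiv Z Z' \<Longrightarrow> level X Z' \<le> level X Z1" by blast
  let ?A = "X (level X Z1)" and ?B = "X (level X Z1 - 1)"
  note f = level_factor[OF X Z1(1)] and l = level[OF X Z1(1)]
  note i = chief_idl[OF f(1)] and s = chief_subsp[OF f(1)]
  note t = top_ideal_chief[OF Z] and t1 = top_ideal_chief[OF Z1(1)]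
  have c: "complemented ?A ?B" using all[OF Z1] Z1(1) by (simp add: noncomplemented_centers_def)
  \<comment> \<open>Whether the top factor has a complement depends only on the equivalence class,
    by \<open>equiv_center_complemented\<close>.\<close>
  have nc1: "\<not> complemented (top_ideal Z1) Z1"
  proof
    assume c1: "complemented (top_ideal Z1) Z1"
    obtain \<phi> \<delta> where d: "equiv_data \<phi> \<delta> (top_ideal Z) Z (top_ideal Z1) Z1"
      using factor_equiv_data[OF t(4-6) t1(4-6)] Z1(2) unfolding center_equiv_def by metis
    have e: "Z \<boxplus> top_ideal Z = top_ideal Z" "Z1 \<boxplus> top_ideal Z1 = top_ideal Z1"
      using t t1 sum_absorb sum_comm idl_subsp by metis+
    have "complemented (centralizer (top_ideal Z) Z \<boxplus> top_ideal Z) (centralizer (top_ideal Z) Z)"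
      by (rule equiv_center_complemented[OF d t(1) t1(1) t(2) t1(2)]) (simp add: t1(3) e c1)
    then show False using nc by (simp add: t(3) e)
  qed
  have m': "\<not> (\<exists>M. compl ?A ?B M \<and> maximal_subalgebra K L M)"
  proof
    assume "\<exists>M. compl ?A ?B M \<and> maximal_subalgebra K L M"
    then obtain M where M: "compl ?A ?B M" and max: "maximal_subalgebra K L M" by blast
    have M': "subalg M" "?A \<boxplus> M = carrier L" "?A \<inter> M = ?B" using M by (auto simp: compl_def)
    have sM: "subsp M" using M'(1) subalg_subsp by blast
    note g = nonabelian_center_factor[OF top_ideal[OF Z1(1)] f(1) l(2,3)]
    note sZ1 = idl_subsp[OF t1(5)]
    show False
    proof (cases "Z1 \<subseteq> M")
      \<comment> \<open>With Z1 inside M, the modular law turns M into a complement of the top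
        factor over Z1, which has none.\<close>
      case True
      have "top_ideal Z1 \<inter> M = Z1 \<boxplus> (?A \<inter> M)"
        unfolding g(3)[symmetric] by (rule modular[OF sZ1 s(1) sM True])
      then have 1: "top_ideal Z1 \<inter> M = Z1" using M'(3) sum_absorb[OF sZ1 s(2) l(2)] by simp
      have "?A \<boxplus> M \<subseteq> top_ideal Z1 \<boxplus> M"
        unfolding g(3)[symmetric] by (rule sum_mono[OF sum_upper2[OF sZ1 s(1)] subset_refl])
      then have "top_ideal Z1 \<boxplus> M = carrier L"
        using M'(2) subsp_subset[OF subsp_sum[OF idl_subsp[OF t1(4)] sM]] by auto
      then show False using 1 M'(1) nc1 unfolding complemented_def compl_def by blast
    next
      case False
      then obtain \<phi> \<delta> N where N: "equiv_data \<phi> \<delta> ?A ?B Z1 N" "chief Z1 N" "\<not> abelian_factor Z1 N"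
        "?A \<subseteq> centralizer Z1 N"
        using maximal_complement_equiv[OF f(1,2) M max] unfolding f(3) by blast
      \<comment> \<open>Z2 contains all terms of X up to the level of Z1, so its own level is larger
        although it belongs to the same class; this contradicts the choice of Z1.\<close>
      define Z2 where "Z2 = centralizer Z1 N"
      note z2 = factor_equiv_center[OF N(2,3) Z2_def]
      have "factor_equiv ?A ?B Z1 N"
        by (rule data_factor_equiv[OF i(1,2) _ chief_idl(1,2)[OF N(2)] _ N(1)])
          (use i(3) chief_idl(3)[OF N(2)] in auto)
      from factor_equiv_trans[OF factor_equiv_trans[OF
          factor_equiv_center(3)[OF f(1,2) f(3)[symmetric]] this] z2(2)]
      have "center_equiv Z1 Z2" by (simp add: center_equiv_def)
      then have "level X Z2 \<le> level X Z1" using last z2(1) center_equiv_trans Z1(2) by blast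
      moreover have "X k \<subseteq> Z2" if "k \<le> level X Z1" for k
        using chief_chain_mono[OF X that] l(1) N(4) unfolding Z2_def by auto
      ultimately show False using level(3)[OF X z2(1)] by blast
    qed
  qed
  obtain P D where PD: "cc'_type K L (factor L P D) (factor_action L D)" "chief P D"
      "\<not> abelian_factor P D" "centralizer P D = Z1"
    using cc'_type_exists[OF f(1,2) c f(3)[symmetric] nc1 m'] by blast
  have "factor_equiv (top_ideal Z) Z P D"
    using factor_equiv_trans[OF Z1(2)[unfolded center_equiv_def] factor_equiv_center(3)[OF PD(2,3) PD(4)[symmetric]]] .
  then show ?thesis using PD(1) by blast
qed

section \<open>Comparison with the classes of cc'-type\<close>

definition class_of_center :: "'a set \<Rightarrow> (('k, 'a set) module \<times> ('a \<Rightarrow> 'a set \<Rightarrow> 'a set)) set" where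
  "class_of_center Z = {(B, \<eta>) \<in> cc'_algebras K L.
     L_equivalent K L (factor L (top_ideal Z) Z) (factor_action L Z) B \<eta>}"

lemma cc'_algebra_class:
  assumes a: "(A, \<theta>) \<in> cc'_algebras K L"
    and e: "L_equivalent K L (factor L (top_ideal Z) Z) (factor_action L Z) A \<theta>" and Z: "Z \<in> centers"
  shows "{((A, \<theta>), (B, \<eta>)). (A, \<theta>) \<in> cc'_algebras K L \<and> (B, \<eta>) \<in> cc'_algebras K L \<and>
        L_equivalent K L A \<theta> B \<eta>} `` {(A, \<theta>)} = class_of_center Z"
proof -
  have e': "L_equivalent K L A \<theta> (factor L (top_ideal Z) Z) (factor_action L Z)"
    by (rule L_equivalent_sym[OF L_algebra_factor[OF top_ideal_chief(4,5)[OF Z]] e])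
  show ?thesis
    using a L_equivalent_trans[OF e] L_equivalent_trans[OF e'] unfolding class_of_center_def by auto
qed

text \<open>An algebra of cc'-type is equivalent to a nonabelian chief factor, hence to the top
  factor over its centralizer. The finiteness that follows matters because \<open>card\<close> of an
  infinite set is 0.\<close>

lemma cc'_classes_subset: "cc'_classes K L \<subseteq> class_of_center ` centers"
proof
  fix C assume "C \<in> cc'_classes K L"
  then obtain A \<theta> where a: "(A, \<theta>) \<in> cc'_algebras K L" and C:
    "C = {((A, \<theta>), (B, \<eta>)). (A, \<theta>) \<in> cc'_algebras K L \<and> (B, \<eta>) \<in> cc'_algebras K L \<and>
        L_equivalent K L A \<theta> B \<eta>} `` {(A, \<theta>)}"
    unfolding cc'_classes_def by (elim quotientE) auto
  have t: "cc'_type K L A \<theta>" using a by (simp add: cc'_algebras_def)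
  then have alg: "L_algebra K L A \<theta>" by (simp add: cc'_type_def irreducible_L_algebra_def)
  obtain P D where PD: "m'_factor K L P D" "L_equivalent K L A \<theta> (factor L P D) (factor_action L D)"
    "nonabelian_on (factor L P D) (carrier (factor L P D))"
    using t unfolding cc'_type_def by blast
  have ch: "chief P D" using PD(1) by (simp add: m'_factor_iff)
  have na: "\<not> abelian_factor P D" using PD(3) nonabelian_on_iff[OF chief_idl(1,2)[OF ch]] by simp
  define Z where "Z = centralizer P D"
  note z = factor_equiv_center[OF ch na Z_def]
  have "L_equivalent K L (factor L (top_ideal Z) Z) (factor_action L Z) A \<theta>"
    by (rule L_equivalent_trans[OF z(3)[unfolded factor_equiv_def] L_equivalent_sym[OF alg PD(2)]])
  from cc'_algebra_class[OF a this z(1)] C show "C \<in> class_of_center ` centers" using z(1) by blast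
qed

lemma finite_cc'_classes: "finite (cc'_classes K L)"
  using finite_subset[OF cc'_classes_subset finite_imageI[OF finite_centers]] .

text \<open>A class occurs at most once among the noncomplemented factors of Y. So the elements of
  \<open>?NY\<close> equivalent to some element of \<open>?NX\<close> inject into
  \<open>?NX\<close>, and the remaining ones inject into the classes of cc'-type by
  \<open>class_cc'_type\<close>.\<close>

lemma noncomplemented_le:
  assumes X: "chief_chain n X {\<zero>} (carrier L)" and Y: "chief_chain m Y {\<zero>} (carrier L)"
  shows "card (noncomplemented_centers Y) \<le> card (noncomplemented_centers X) + card (cc'_classes K L)"
proof -
  let ?NX = "noncomplemented_centers X" and ?NY = "noncomplemented_centers Y"
  let ?S = "{Z \<in> ?NY. \<not> (\<exists>Z'\<in>?NX. center_equiv Z Z')}"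
  have sub: "?NX \<subseteq> centers" "?NY \<subseteq> centers" by (auto simp: noncomplemented_centers_def)
  have fin: "finite ?NX" "finite ?NY" using finite_subset[OF _ finite_centers] sub by blast+
  have ex: "\<exists>P D. (factor L P D, factor_action L D) \<in> class_of_center Z" and
    cls: "class_of_center Z \<in> cc'_classes K L" if Z: "Z \<in> ?S" for Z
  proof -
    have Zc: "Z \<in> centers" using Z sub by blast
    note l = level[OF Y Zc] and f = level_factor[OF Y Zc]
    \<comment> \<open>The factor of Y over Z has no complement, so neither has the top factor, since
      complements pass downwards.\<close>
    have "\<not> complemented (top_ideal Z) Z"
      using complemented_of_center[OF top_ideal[OF Zc] f(1) l(2,3)] Z by (auto simp: noncomplemented_centers_def)
    then obtain P D where PD: "cc'_type K L (factor L P D) (factor_action L D)" "factor_equiv (top_ideal Z) Z P D"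
      using class_cc'_type[OF X Zc] Z by blast
    have a: "(factor L P D, factor_action L D) \<in> cc'_algebras K L" using PD(1) by (simp add: cc'_algebras_def)
    then show "\<exists>P D. (factor L P D, factor_action L D) \<in> class_of_center Z"
      using PD(2) by (auto simp: class_of_center_def factor_equiv_def)
    show "class_of_center Z \<in> cc'_classes K L"
      unfolding cc'_classes_def cc'_algebra_class[OF a PD(2)[unfolded factor_equiv_def] Zc, symmetric]
      by (rule quotientI[OF a])
  qed
  have "inj_on class_of_center ?S"
  proof (rule inj_onI)
    fix Z Z' assume Z: "Z \<in> ?S" and Z': "Z' \<in> ?S" and e: "class_of_center Z = class_of_center Z'"
    obtain P D where "(factor L P D, factor_action L D) \<in> class_of_center Z" using ex[OF Z] by blast
    then have "factor_equiv (top_ideal Z) Z P D" "factor_equiv (top_ideal Z') Z' P D"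
      using e by (auto simp: class_of_center_def factor_equiv_def)
    moreover have Zc: "Z' \<in> centers" using Z' sub by blast
    ultimately have "center_equiv Z Z'"
      unfolding center_equiv_def using factor_equiv_trans factor_equiv_sym[OF top_ideal_chief(4,5)[OF Zc]] by blast
    then show "Z = Z'" using noncomplemented_centers_inequivalent[OF Y] Z Z' by blast
  qed
  then have 1: "card ?S \<le> card (cc'_classes K L)"
    by (rule card_inj_on_le[OF _ _ finite_cc'_classes]) (use cls in blast)
  have "\<forall>Z\<in>?NY - ?S. \<exists>Z'. Z' \<in> ?NX \<and> center_equiv Z Z'" by blast
  from bchoice[OF this] obtain h where "\<forall>Z\<in>?NY - ?S. h Z \<in> ?NX \<and> center_equiv Z (h Z)" by (rule exE)
  then have h: "\<And>Z. Z \<in> ?NY - ?S \<Longrightarrow> h Z \<in> ?NX \<and> center_equiv Z (h Z)" by (rule bspec)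
  have "inj_on h (?NY - ?S)"
  proof (rule inj_onI)
    fix Z Z' assume Z: "Z \<in> ?NY - ?S" and Z': "Z' \<in> ?NY - ?S" and e: "h Z = h Z'"
    have "center_equiv (h Z') Z'" using center_equiv_sym h[OF Z'] Z' sub by blast
    then have "center_equiv Z Z'" using center_equiv_trans h[OF Z] e by metis
    then show "Z = Z'" using noncomplemented_centers_inequivalent[OF Y] Z Z' by blast
  qed
  then have 2: "card (?NY - ?S) \<le> card ?NX"
    by (rule card_inj_on_le[OF _ _ fin(1)]) (use h in blast)
  have "card ?NY = card ?S + card (?NY - ?S)"
    using card_Diff_subset[of ?S ?NY] card_mono[of ?NY ?S] fin(2) finite_subset[of ?S ?NY] by auto
  then show ?thesis using 1 2 by linarith
qed

lemma num_c_factors_diff: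
  assumes X: "chief_series K L n X" and Y: "chief_series K L m Y"
  shows "\<bar>int (num_c_factors K L n X) - int (num_c_factors K L m Y)\<bar> \<le> int (card (cc'_classes K L))"
proof -
  have cX: "chief_chain n X {\<zero>} (carrier L)" and cY: "chief_chain m Y {\<zero>} (carrier L)"
    using X Y by (simp_all add: chief_series_iff)
  show ?thesis
    using num_c_factors_eq[OF cX] num_c_factors_eq[OF cY] abelian_complemented_invariant[OF cX cY]
      noncomplemented_le[OF cX cY] noncomplemented_le[OF cY cX] by linarith
qed

end

theorem proposition2p5:
  fixes K :: "('k, 'r) ring_scheme" and L :: "('k, 'a, 'm) module_scheme"
    and n m :: nat and X Y :: "nat \<Rightarrow> 'a set"
  assumes "lie_algebra K L"
    and "finite_dimensional K L"
    and "chief_series K L n X"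
    and "chief_series K L m Y"
  shows "\<bar>int (num_c_factors K L n X) - int (num_c_factors K L m Y)\<bar>
    \<le> int (card (cc'_classes K L))"
proof -
  interpret fd_lie_alg L K
    using assms(1,2) by (simp add: fd_lie_alg_def lie_alg_def fd_lie_alg_axioms_def)
  show ?thesis using num_c_factors_diff[OF assms(3,4)] .
qed

end
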